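(* Fix $\theta\in\mathbb R$ and let $(\lambda_N)_{N\ge2}$ satisfy $\lambda_N=1+\frac{\theta}{\log N}(1+o(1))$ as $N\to\infty$. Then for any fixed $0<\delta<T<\infty$, $$U_{N,\lambda_N}(n)=\frac{\log N}{N}\,G_\theta\big(\tfrac nN\big)(1+o(1))\quad\text{as }N\to\infty,\ \text{uniformly for }\delta N\le n\le TN.$$ Moreover, for any fixed $T<\infty$ there is $C\in(0,\infty)$ such that $U_{N,\lambda_N}(n)\le C\,\frac{\log N}{N}\,G_\theta(\tfrac nN)$ for all $N\ge 2$ and all integers $0<n\le TN$.
   Context: Fix positive reals $r(n)$, $n\in\mathbb N$, with $r(n)=\frac an(1+o(1))$ as $n\to\infty$ for some $a\in(0,\infty)$; $R_N:=\sum_{n=1}^Nr(n)$. For each $N$, $(T^{(N)}_i)_{i\ge1}$ are i.i.d. with $\P(T^{(N)}_i=n)=\frac{r(n)}{R_N}\mathbf 1_{\{1,\dots,N\}}(n)$, $\tau^{(N)}_0=0$, $\tau^{(N)}_k=\sum_{i=1}^kT^{(N)}_i$. For $\lambda\in(0,\infty)$, $U_{N,\lambda}(n):=\sum_{k\ge0}\lambda^k\P(\tau^{(N)}_k=n)$. Let $f_s$ denote the density of $Y_s$, where $Y$ is the Dickman subordinator (pure-jump subordinator with Lévy measure $\frac1t\mathbf 1_{(0,1)}(t)\mathrm dt$), and for $\theta\in\mathbb R$, $t>0$, $G_\theta(t):=\int_0^\infty e^{\theta s}f_s(t)\,\mathrm ds$; for $t\in(0,1]$ this equals $\int_0^\infty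 \frac{e^{(\theta-\gamma)s}s\,t^{s-1}}{\Gamma(s+1)}\mathrm ds$, with $\gamma$ the Euler–Mascheroni constant. *)

theory Defs
  imports "HOL-Analysis.Analysis" "HOL-Library.Landau_Symbols"
begin

definition RN :: "(nat \<Rightarrow> real) \<Rightarrow> nat \<Rightarrow> real" where
  "RN r N = (\<Sum>n=1..N. r n)"

definition Tprob :: "(nat \<Rightarrow> real) \<Rightarrow> nat \<Rightarrow> nat \<Rightarrow> real" where
  "Tprob r N m = (if 1 \<le> m \<and> m \<le> N then r m / RN r N else 0)"

text \<open>P(tau_k = n) for the sum of k i.i.d. copies of T (k-fold convolution).\<close>
primrec tau_prob :: "(nat \<Rightarrow> real) \<Rightarrow> nat \<Rightarrow> nat \<Rightarrow> nat \<Rightarrow> real" where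
  "tau_prob r N 0 n = (if n = 0 then 1 else 0)"
| "tau_prob r N (Suc k) n = (\<Sum>m=1..n. Tprob r N m * tau_prob r N k (n - m))"

definition U :: "(nat \<Rightarrow> real) \<Rightarrow> nat \<Rightarrow> real \<Rightarrow> nat \<Rightarrow> real" where
  "U r N lam n = (\<Sum>k. lam ^ k * tau_prob r N k n)"

text \<open>Dickman subordinator: Y_s has Laplace transform
  E exp(-l Y_s) = exp(-s * int_0^1 (1 - exp(-l u))/u du)
  (Levy measure 1/t on (0,1), no drift). Its density f_s (s > 0) is the
  continuous version on (0,infinity), vanishing on (-infinity,0].\<close>
definition is_dickman_density :: "real \<Rightarrow> (real \<Rightarrow> real) \<Rightarrow> bool" where
  "is_dickman_density s g \<longleftrightarrow>
     (\<forall>t. g t \<ge> 0) \<and> (\<forall>t\<le>0. g t = 0) \<and> continuous_on {0<..} g \<and>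
     g \<in> borel_measurable borel \<and> integrable lborel g \<and>
     (\<forall>l\<ge>0. (\<integral>t. exp (- l * t) * g t \<partial>lborel) =
              exp (- s * (LBINT u:{0<..<1}. (1 - exp (- l * u)) / u)))"

definition dickman_density :: "real \<Rightarrow> real \<Rightarrow> real" where
  "dickman_density s = (SOME g. is_dickman_density s g)"

definition G :: "real \<Rightarrow> real \<Rightarrow> real" where
  "G \<theta> t = (LBINT s:{0<..}. exp (\<theta> * s) * dickman_density s t)"

end

theory Submission
  imports Defs "HOL-Computational_Algebra.Formal_Power_Series"
begin

text \<open>
  Let \<open>u\<close> be the renewal mass function and \<open>v = u * u\<close>. Differentiating the generating function gives
  \<open>n u(n) = \<Sum>m. m p(m) v(n - m)\<close>, and \<open>m r(m)\<close> tends to \<open>a\<close>; hence \<open>n u(n)\<close> is, up to the factor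
  \<open>1 / log N\<close>, the mass that \<open>v\<close> gives to the window \<open>[n - N, n)\<close>. So the local statement follows from
  weak convergence of \<open>v / (log N)\<^sup>2\<close> after rescaling space by \<open>N\<close>, and that follows from convergence of
  Laplace transforms: \<open>(log N)\<^sup>-\<^sup>1 \<Sum>n. u(n) exp (- l n / N)\<close> tends to \<open>1 / (\<psi>(l) - \<theta>)\<close>, where
  \<open>\<psi>(l) = \<integral>\<^sub>0\<^sup>1 (1 - exp (- l t)) / t dt\<close>. On the limit side the Dickman density satisfies
  \<open>t f\<^sub>s(t) = s (F\<^sub>s(t) - F\<^sub>s(t - 1))\<close>, so \<open>t G\<^sub>\<theta>(t)\<close> is the mass of \<open>[t - 1, t]\<close> under the measure with
  Laplace transform \<open>1 / (\<psi> - \<theta>)\<^sup>2\<close>. For \<open>n\<close> much smaller than \<open>N\<close> the same identity together with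
  \<open>\<Sum>j\<le>n. u(j) \<le> e \<Sum>j. u(j) exp (- j / n)\<close> gives the upper bound.
\<close>

section \<open>Renewal sequences\<close>

lemma tau_prob_eq_0: "n < k \<Longrightarrow> tau_prob r N k n = 0"
proof (induction k arbitrary: n)
  case (Suc k)
  have "tau_prob r N k (n - m) = 0" if "m \<in> {1..n}" for m
    using Suc.prems that by (intro Suc.IH) auto
  then show ?case by simp
qed simp

lemma U_eq_sum:
  assumes "n \<le> K"
  shows "U r N lam n = (\<Sum>k\<le>K. lam ^ k * tau_prob r N k n)"
  unfolding U_def using assms
  by (intro suminf_finite) (auto simp: tau_prob_eq_0)

lemma U_renewal:
  "U r N lam n = (if n = 0 then 1 else 0) + (\<Sum>m=1..n. lam * Tprob r N m * U r N lam (n - m))"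
proof -
  have "U r N lam n = (\<Sum>k\<le>Suc n. lam ^ k * tau_prob r N k n)"
    by (rule U_eq_sum) simp
  also have "\<dots> = (if n = 0 then 1 else 0)
      + (\<Sum>k\<le>n. \<Sum>m=1..n. lam * Tprob r N m * (lam ^ k * tau_prob r N k (n - m)))"
    unfolding sum.atMost_Suc_shift by (simp add: sum_distrib_left mult_ac)
  also have "(\<Sum>k\<le>n. \<Sum>m=1..n. lam * Tprob r N m * (lam ^ k * tau_prob r N k (n - m)))
      = (\<Sum>m=1..n. lam * Tprob r N m * U r N lam (n - m))"
    by (subst sum.swap) (simp add: U_eq_sum[where K = n] sum_distrib_left)
  finally show ?thesis .
qed

definition renewal_seq :: "(nat \<Rightarrow> real) \<Rightarrow> (nat \<Rightarrow> real) \<Rightarrow> bool" where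
  "renewal_seq p u \<longleftrightarrow> p 0 = 0 \<and> (\<forall>n. u n = (if n = 0 then 1 else 0) + (\<Sum>m=1..n. p m * u (n - m)))"

definition self_conv :: "(nat \<Rightarrow> real) \<Rightarrow> nat \<Rightarrow> real" where
  "self_conv u n = (\<Sum>i\<le>n. u i * u (n - i))"

lemma renewal_seqD:
  assumes "renewal_seq p u"
  shows "p 0 = 0" "u n = (if n = 0 then 1 else 0) + (\<Sum>m=1..n. p m * u (n - m))"
  using assms unfolding renewal_seq_def by blast+

lemma renewal_seq_atMost:
  assumes "renewal_seq p u"
  shows "u n = (if n = 0 then 1 else 0) + (\<Sum>m\<le>n. p m * u (n - m))"
proof -
  have "(\<Sum>m\<le>n. p m * u (n - m)) = (\<Sum>m=1..n. p m * u (n - m))"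
    using renewal_seqD(1)[OF assms] by (intro sum.mono_neutral_right) (auto simp: not_less_eq_eq)
  then show ?thesis
    using renewal_seqD(2)[OF assms, of n] by simp
qed

lemma renewal_seq_nonneg:
  assumes "renewal_seq p u" "\<And>m. p m \<ge> 0"
  shows "u n \<ge> 0"
proof (induction n rule: less_induct)
  case (less n)
  have "u n = (if n = 0 then 1 else 0) + (\<Sum>m=1..n. p m * u (n - m))"
    by (rule renewal_seqD[OF assms(1)])
  also have "\<dots> \<ge> 0"
    using assms(2) less by (intro add_nonneg_nonneg sum_nonneg mult_nonneg_nonneg) auto
  finally show ?case .
qed

lemma self_conv_nonneg:
  assumes "\<And>n. u n \<ge> 0" shows "self_conv u n \<ge> 0"
  unfolding self_conv_def using assms by (intro sum_nonneg) auto

text \<open>The generating function satisfies \<open>(1 - P) U = 1\<close>, hence \<open>U' = U\<^sup>2 P'\<close>.\<close>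

lemma renewal_seq_derivative:
  assumes "renewal_seq p u"
  shows "real n * u n = (\<Sum>m=1..n. real m * p m * self_conv u (n - m))"
proof (cases n)
  case (Suc k)
  define P where "P = Abs_fps p"
  define W where "W = Abs_fps u"
  have W: "W = 1 + P * W"
  proof (rule fps_ext)
    fix n
    have "u n = (if n = 0 then 1 else 0) + (\<Sum>m\<le>n. p m * u (n - m))"
      by (rule renewal_seq_atMost[OF assms])
    then show "fps_nth W n = fps_nth (1 + P * W) n"
      by (simp add: P_def W_def fps_mult_nth atMost_atLeast0)
  qed
  have "fps_deriv W = fps_deriv P * W + P * fps_deriv W"
    using arg_cong[OF W, of fps_deriv] by (simp add: algebra_simps)
  then have 1: "(1 - P) * fps_deriv W = fps_deriv P * W"
    by (simp add: algebra_simps)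
  have 2: "W * (1 - P) = 1"
  proof -
    have "W * (1 - P) = W - P * W" by (simp add: right_diff_distrib mult.commute)
    also have "\<dots> = 1" by (subst (1) W) simp
    finally show ?thesis .
  qed
  have "fps_deriv W = W * (1 - P) * fps_deriv W"
    by (simp add: 2)
  also have "\<dots> = fps_deriv P * (W * W)"
    by (simp only: mult.assoc 1) (simp only: mult_ac)
  finally have "fps_nth (fps_deriv W) k = fps_nth (fps_deriv P * (W * W)) k"
    by simp
  then have "real (Suc k) * u (Suc k) = (\<Sum>i\<le>k. real (Suc i) * p (Suc i) * self_conv u (k - i))"
    unfolding fps_mult_nth[of "fps_deriv P"] fps_mult_nth[of W]
    by (simp add: W_def P_def self_conv_def atMost_atLeast0)
  also have "\<dots> = (\<Sum>m=1..n. real m * p m * self_conv u (n - m))"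
    unfolding Suc by (rule sum.reindex_bij_witness[of _ "\<lambda>m. m - 1" Suc]) auto
  finally show ?thesis by (simp add: Suc)
qed simp

lemma renewal_seq_sums:
  assumes u: "renewal_seq p u" and p: "\<And>m. p m \<ge> 0" and fin: "\<And>m. m > N \<Longrightarrow> p m = 0"
    and z: "z \<ge> 0" and q: "q = (\<Sum>m=1..N. p m * z ^ m)" "q < 1"
  shows "(\<lambda>n. u n * z ^ n) sums (1 / (1 - q))"
    and "(\<lambda>n. self_conv u n * z ^ n) sums (1 / (1 - q))\<^sup>2"
proof -
  have u0: "u n \<ge> 0" for n using renewal_seq_nonneg[OF u p] .
  have p0: "p 0 = 0" using renewal_seqD[OF u] by simp
  let ?a = "\<lambda>m. p m * z ^ m" and ?b = "\<lambda>n. u n * z ^ n"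
  have a_sums: "?a sums q"
  proof -
    have "?a sums (\<Sum>m\<in>{1..N}. ?a m)"
    proof (rule sums_finite)
      fix m assume "m \<notin> {1..N}"
      then have "m = 0 \<or> m > N" by auto
      then show "?a m = 0" using p0 fin by auto
    qed simp
    then show ?thesis by (simp add: q)
  qed
  have conv: "?b n = (if n = 0 then 1 else 0) + (\<Sum>m\<le>n. ?a m * ?b (n - m))" for n
  proof -
    have "?b n = (if n = 0 then 1 else 0) + (\<Sum>m\<le>n. p m * u (n - m)) * z ^ n"
      using renewal_seq_atMost[OF u, of n] by (simp add: algebra_simps)
    also have "(\<Sum>m\<le>n. p m * u (n - m)) * z ^ n = (\<Sum>m\<le>n. ?a m * ?b (n - m))"
      unfolding sum_distrib_right
    proof (rule sum.cong)
      fix m assume "m \<in> {..n}"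
      then have "z ^ n = z ^ m * z ^ (n - m)" by (simp flip: power_add)
      then show "p m * u (n - m) * z ^ n = ?a m * ?b (n - m)" by simp
    qed simp
    finally show ?thesis .
  qed
  have q0: "q \<ge> 0" using q p z by (auto intro!: sum_nonneg)
  have bd: "(\<Sum>n<M. ?b n) \<le> 1 / (1 - q)" for M
  proof -
    have "(\<Sum>n<M. ?b n) = (\<Sum>n<M. if n = 0 then 1 else 0) + (\<Sum>n<M. \<Sum>m\<le>n. ?a m * ?b (n - m))"
      unfolding sum.distrib[symmetric] by (rule sum.cong[OF refl conv])
    also have "(\<Sum>n<M. if n = 0 then 1 else 0 :: real) \<le> 1"
      by (subst sum.delta) auto
    also have "(\<Sum>n<M. \<Sum>m\<le>n. ?a m * ?b (n - m)) = (\<Sum>(m,i)\<in>{(m,i). m + i < M}. ?a m * ?b i)"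
      using sum.triangle_reindex[of "\<lambda>m i. ?a m * ?b i" M] by simp
    also have "\<dots> \<le> (\<Sum>(m,i)\<in>{..<M}\<times>{..<M}. ?a m * ?b i)"
      using p u0 z by (intro sum_mono2) auto
    also have "\<dots> = (\<Sum>m<M. ?a m) * (\<Sum>i<M. ?b i)"
      by (simp add: sum_product sum.cartesian_product)
    also have "\<dots> \<le> q * (\<Sum>i<M. ?b i)"
      using a_sums p u0 z
      by (intro mult_right_mono sum_nonneg) (auto simp: sums_iff intro!: sum_le_suminf)
    finally have "(1 - q) * (\<Sum>n<M. ?b n) \<le> 1" by (simp add: algebra_simps)
    then show ?thesis using q(2) by (simp add: field_simps)
  qed
  have summ: "summable ?b"
    using u0 z bd by (intro summableI_nonneg_bounded[where x = "1 / (1 - q)"]) auto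
  have "(\<lambda>n. \<Sum>m\<le>n. ?a m * ?b (n - m)) sums ((\<Sum>m. ?a m) * (\<Sum>n. ?b n))"
    using a_sums summ p u0 z by (intro Cauchy_product_sums) (auto simp: sums_iff)
  then have "(\<lambda>n. (if n = 0 then 1 else 0) + (\<Sum>m\<le>n. ?a m * ?b (n - m))) sums (1 + q * (\<Sum>n. ?b n))"
    using a_sums by (intro sums_add) (auto simp: sums_iff intro: sums_single[of 0 "\<lambda>_. 1::real", simplified])
  then have "?b sums (1 + q * (\<Sum>n. ?b n))" by (subst (asm) conv[symmetric])
  then have "(\<Sum>n. ?b n) = 1 + q * (\<Sum>n. ?b n)" by (simp add: sums_iff)
  then have eq: "(\<Sum>n. ?b n) = 1 / (1 - q)" using q(2) by (simp add: field_simps)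
  then show 1: "?b sums (1 / (1 - q))" using summ by (simp add: sums_iff)
  have "(\<lambda>n. \<Sum>i\<le>n. ?b i * ?b (n - i)) sums ((\<Sum>n. ?b n) * (\<Sum>n. ?b n))"
    using summ u0 z by (intro Cauchy_product_sums) auto
  moreover have "(\<Sum>i\<le>n. ?b i * ?b (n - i)) = self_conv u n * z ^ n" for n
    unfolding self_conv_def sum_distrib_right
  proof (rule sum.cong)
    fix m assume "m \<in> {..n}"
    then have "z ^ n = z ^ m * z ^ (n - m)" by (simp flip: power_add)
    then show "?b m * ?b (n - m) = u m * u (n - m) * z ^ n" by simp
  qed simp
  ultimately show "(\<lambda>n. self_conv u n * z ^ n) sums (1 / (1 - q))\<^sup>2"
    by (simp add: eq power2_eq_square)
qed

lemma sum_self_conv_le: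
  assumes "\<And>n. u n \<ge> (0::real)"
  shows "(\<Sum>j\<le>n. self_conv u j) \<le> (\<Sum>j\<le>n. u j)\<^sup>2"
proof -
  have "(\<Sum>j\<le>n. self_conv u j) = (\<Sum>(i,j)\<in>{(i,j). i + j < Suc n}. u i * u j)"
    using sum.triangle_reindex[of "\<lambda>i j. u i * u j" "Suc n"]
    by (simp add: self_conv_def lessThan_Suc_atMost)
  also have "\<dots> \<le> (\<Sum>(i,j)\<in>{..n}\<times>{..n}. u i * u j)"
    using assms by (intro sum_mono2) auto
  also have "\<dots> = (\<Sum>j\<le>n. u j)\<^sup>2"
    by (simp add: power2_eq_square sum_product sum.cartesian_product)
  finally show ?thesis .
qed

section \<open>The Dickman density\<close>

text \<open>The limit \<open>\<phi>\<close> of these iterates solves \<open>t \<phi>'(t) = s (\<phi>(t) - \<phi>(t - 1))\<close> with \<open>\<phi>(t) = t powr s\<close> on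
  \<open>(0, 1]\<close>; up to normalisation it is the distribution function of the Dickman subordinator at time
  \<open>s\<close>. The \<open>n\<close>-th iterate is already correct up to \<open>n + 1\<close>.\<close>

primrec delay_iter :: "nat \<Rightarrow> real \<Rightarrow> real \<Rightarrow> real" where
  "delay_iter 0 s t = (if t \<le> 0 then 0 else t powr s)"
| "delay_iter (Suc n) s t = (if t \<le> 0 then 0 else t powr s *
     (1 - s * (LBINT u:{1..t}. u powr (- s - 1) * delay_iter n s (u - 1))))"

definition delay_fun :: "real \<Rightarrow> real \<Rightarrow> real" where
  "delay_fun s t = lim (\<lambda>n. delay_iter n s t)"

lemma delay_integral:
  fixes g :: "real \<Rightarrow> real" and s :: real
  assumes g: "continuous_on UNIV g" "\<And>t. t \<le> 0 \<Longrightarrow> g t = 0"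
  defines "J \<equiv> \<lambda>t. LBINT u:{1..t}. u powr (- s - 1) * g (u - 1)"
  shows "continuous_on {0..} J" "t > 0 \<Longrightarrow> (J has_real_derivative t powr (- s - 1) * g (t - 1)) (at t)"
    "t \<le> 1 \<Longrightarrow> J t = 0"
proof -
  define k where "k = (\<lambda>u. (max 1 u) powr (- s - 1) * g (u - 1))"
  have gc: "continuous_on A (\<lambda>x. g (h x))" if "continuous_on A h" for h and A :: "real set"
    by (rule continuous_on_compose2[OF g(1) that]) auto
  have k: "continuous_on A k" for A
    unfolding k_def by (intro continuous_intros gc) auto
  have k0: "k u = 0" if "u \<le> 1" for u using g(2) that by (simp add: k_def)
  have J: "J t = integral {0..t} k" if "t \<ge> 0" for t
  proof -
    have "J t = (LBINT u:{1..t}. k u)"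
      unfolding J_def by (intro set_lebesgue_integral_cong) (auto simp: k_def max_def)
    also have "\<dots> = (LBINT u:{0..t}. k u)"
      unfolding set_lebesgue_integral_def
      by (intro Bochner_Integration.integral_cong) (auto simp: indicator_def k0)
    also have "\<dots> = integral {0..t} k"
      unfolding set_lebesgue_integral_def[symmetric]
      by (rule set_borel_integral_eq_integral(2)[OF borel_integrable_atLeastAtMost'[OF k]])
    finally show ?thesis .
  qed
  have I: "((\<lambda>x. integral {0..x} k) has_real_derivative k x) (at x within {0..b})"
    if "x \<in> {0..b}" for x b
    using that by (intro integral_has_real_derivative k) auto
  have Jd: "(J has_real_derivative k x) (at x within {0..b})" if "x \<in> {0..b}" for x b
    by (rule has_field_derivative_transform_within[OF I[OF that], of 1]) (use that J in auto)
  show "(J has_real_derivative t powr (- s - 1) * g (t - 1)) (at t)" if "t > 0"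
  proof -
    have "(J has_real_derivative k t) (at t within {0..t+1})" using that by (intro Jd) auto
    then have "(J has_real_derivative k t) (at t)"
      using that by (simp add: at_within_Icc_at)
    moreover have "k t = t powr (- s - 1) * g (t - 1)"
      by (cases "t \<le> 1") (use k0 g(2) in \<open>auto simp: k_def\<close>)
    ultimately show ?thesis by simp
  qed
  have "continuous (at x within {0..}) J" if "x \<ge> 0" for x
  proof -
    have "continuous (at x within {0..x+1}) J"
      using Jd[of x "x+1"] that by (auto intro: DERIV_continuous)
    moreover have "at x within {0..x+1} = at x within {0..}"
      by (rule at_within_nhd[of x "{..<x+1}"]) (use that in auto)
    ultimately show ?thesis by simp
  qed
  then show "continuous_on {0..} J" by (simp add: continuous_on_eq_continuous_within)
  show "J t = 0" if "t \<le> 1"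
  proof -
    have "J t = (LBINT u:{1..t}. 0)"
      unfolding J_def using that g(2) by (intro set_lebesgue_integral_cong) auto
    then show ?thesis by simp
  qed
qed

lemma delay_iter_nonpos: "t \<le> 0 \<Longrightarrow> delay_iter n s t = 0"
  by (cases n) auto

lemma continuous_on_max_powr:
  "s > 0 \<Longrightarrow> continuous_on A (\<lambda>t. max 0 t powr s :: real)"
  by (intro continuous_on_powr' continuous_intros) auto

lemma continuous_delay_iter:
  assumes "s > 0" shows "continuous_on UNIV (delay_iter n s)"
proof (induction n)
  case 0
  have "delay_iter 0 s = (\<lambda>t. max 0 t powr s)" by (auto simp: fun_eq_iff max_def)
  then show ?case using continuous_on_max_powr[OF assms] by simp
next
  case (Suc n)
  define J where "J = (\<lambda>t. LBINT u:{1..t}. u powr (- s - 1) * delay_iter n s (u - 1))"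
  have J: "continuous_on {0..} J"
    unfolding J_def by (rule delay_integral[OF Suc delay_iter_nonpos])
  have "delay_iter (Suc n) s = (\<lambda>t. max 0 t powr s * (1 - s * J (max 0 t)))"
    by (auto simp: fun_eq_iff max_def J_def)
  moreover have "continuous_on UNIV (\<lambda>t. J (max 0 t))"
    by (rule continuous_on_compose2[OF J]) (auto intro!: continuous_intros)
  ultimately show ?case
    by (auto intro!: continuous_intros continuous_on_max_powr assms)
qed

lemma delay_iter_stable:
  assumes "s > 0" "m \<ge> n" "t \<le> real n + 1"
  shows "delay_iter m s t = delay_iter n s t"
  using assms(2,3)
proof (induction n arbitrary: m t)
  case 0
  show ?case
  proof (cases m)
    case (Suc k)
    then show ?thesis
      using delay_integral(3)[OF continuous_delay_iter[OF assms(1)] delay_iter_nonpos] 0 by auto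
  qed simp
next
  case (Suc n)
  obtain k where k: "m = Suc k" "k \<ge> n" using Suc.prems by (cases m) auto
  have "(LBINT u:{1..t}. u powr (- s - 1) * delay_iter k s (u - 1)) =
      (LBINT u:{1..t}. u powr (- s - 1) * delay_iter n s (u - 1))"
  proof (rule set_lebesgue_integral_cong)
    show "\<forall>u. u \<in> {1..t} \<longrightarrow> u powr (- s - 1) * delay_iter k s (u - 1) = u powr (- s - 1) * delay_iter n s (u - 1)"
      using Suc.IH[OF k(2)] Suc.prems by auto
  qed auto
  then show ?case by (simp add: k)
qed

lemma delay_eq_iter:
  assumes "s > 0" "t \<le> real n + 1"
  shows "delay_fun s t = delay_iter n s t"
  unfolding delay_fun_def
proof (rule limI, rule tendsto_eventually)
  show "\<forall>\<^sub>F m in sequentially. delay_iter m s t = delay_iter n s t"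
    using delay_iter_stable[OF assms(1) _ assms(2)] unfolding eventually_sequentially by blast
qed

lemma delay_nonpos: "s > 0 \<Longrightarrow> t \<le> 0 \<Longrightarrow> delay_fun s t = 0"
  by (simp add: delay_eq_iter[where n = 0])

lemma delay_le_1: "s > 0 \<Longrightarrow> 0 < t \<Longrightarrow> t \<le> 1 \<Longrightarrow> delay_fun s t = t powr s"
  by (simp add: delay_eq_iter[where n = 0])

lemma isCont_delay_fun:
  assumes "s > 0" shows "isCont (delay_fun s) t"
proof -
  obtain n :: nat where n: "t < real n" using reals_Archimedean2 by blast
  have "isCont (delay_iter n s) t"
    using continuous_delay_iter[OF assms] by (simp add: continuous_on_eq_continuous_at)
  moreover have "\<forall>\<^sub>F x in nhds t. delay_fun s x = delay_iter n s x"
    by (rule eventually_mono[OF eventually_nhds_in_open[of "{..<real n}" t]])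
      (use n in \<open>auto intro!: delay_eq_iter assms\<close>)
  ultimately show ?thesis by (simp add: isCont_cong)
qed

lemma continuous_on_delay_fun:
  assumes "s > 0" "continuous_on A h" shows "continuous_on A (\<lambda>x. delay_fun s (h x))"
  by (rule continuous_on_compose2[OF _ assms(2), of UNIV])
    (auto simp: continuous_on_eq_continuous_at isCont_delay_fun assms)

lemma delay_eq:
  assumes "s > 0" "t > 0"
  shows "delay_fun s t = t powr s * (1 - s * (LBINT u:{1..t}. u powr (- s - 1) * delay_fun s (u - 1)))"
proof -
  obtain n :: nat where n: "t < real n" using reals_Archimedean2 by blast
  have "delay_fun s t = delay_iter (Suc n) s t" using n by (intro delay_eq_iter assms) auto
  also have "(LBINT u:{1..t}. u powr (- s - 1) * delay_iter n s (u - 1)) =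
      (LBINT u:{1..t}. u powr (- s - 1) * delay_fun s (u - 1))"
    using n assms by (intro set_lebesgue_integral_cong) (auto simp: delay_eq_iter[where n = n])
  then have "delay_iter (Suc n) s t = t powr s * (1 - s * (LBINT u:{1..t}. u powr (- s - 1) * delay_fun s (u - 1)))"
    using assms by simp
  finally show ?thesis .
qed

lemma delay_deriv:
  assumes "s > 0" "t > 0"
  shows "(delay_fun s has_real_derivative s * (delay_fun s t - delay_fun s (t - 1)) / t) (at t)"
proof -
  define J where "J = (\<lambda>t. LBINT u:{1..t}. u powr (- s - 1) * delay_fun s (u - 1))"
  have J: "(J has_real_derivative t powr (- s - 1) * delay_fun s (t - 1)) (at t)"
    unfolding J_def
    by (intro delay_integral(2) delay_nonpos continuous_on_delay_fun[OF assms(1), of UNIV "\<lambda>x. x"]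
        continuous_on_id assms)
  have "((\<lambda>t. t powr s * (1 - s * J t)) has_real_derivative
      s * t powr (s - 1) * (1 - s * J t) + (0 - s * (t powr (- s - 1) * delay_fun s (t - 1))) * t powr s) (at t)"
    using assms by (intro DERIV_mult DERIV_diff DERIV_cmult DERIV_const J has_real_derivative_powr)
  moreover have "s * t powr (s - 1) * (1 - s * J t) + (0 - s * (t powr (- s - 1) * delay_fun s (t - 1))) * t powr s
     = s * (delay_fun s t - delay_fun s (t - 1)) / t"
  proof -
    have 1: "t powr (- s - 1) * t powr s = 1 / t"
      using assms by (simp flip: powr_add add: powr_minus_divide)
    have 2: "t powr (s - 1) = t powr s / t"
      using assms by (simp add: powr_diff)
    have 3: "delay_fun s t = t powr s * (1 - s * J t)"
      unfolding J_def by (rule delay_eq[OF assms])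
    have "s * t powr (s - 1) * (1 - s * J t) + (0 - s * (t powr (- s - 1) * delay_fun s (t - 1))) * t powr s
      = s * (t powr s * (1 - s * J t)) / t - s * delay_fun s (t - 1) * (t powr (- s - 1) * t powr s)"
      unfolding 2 by (simp add: algebra_simps)
    also have "\<dots> = s * (delay_fun s t - delay_fun s (t - 1)) / t"
      unfolding 1 3[symmetric] by (simp add: right_diff_distrib diff_divide_distrib)
    finally show ?thesis .
  qed
  ultimately have "((\<lambda>t. t powr s * (1 - s * J t)) has_real_derivative s * (delay_fun s t - delay_fun s (t - 1)) / t) (at t)"
    by simp
  then show ?thesis
    by (rule has_field_derivative_transform_within_open[where S = "{0<..}"])
      (use assms delay_eq in \<open>auto simp: J_def\<close>)
qed

text \<open>At the first zero of the derivative, \<open>delay_fun s\<close> would have been strictly increasing so far,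
  so the delay equation makes the derivative positive there.\<close>

lemma delay_diff_pos:
  assumes s: "s > 0" and t: "t > 0"
  shows "delay_fun s t - delay_fun s (t - 1) > 0"
proof (rule ccontr)
  define D where "D = (\<lambda>t. delay_fun s t - delay_fun s (t - 1))"
  assume "\<not> ?thesis"
  then have Dt: "D t \<le> 0" by (simp add: D_def)
  have small: "D x > 0" if "0 < x" "x \<le> 1" for x
    using that s by (simp add: D_def delay_le_1 delay_nonpos)
  have "t > 1" using small[of t] Dt t by force
  define S where "S = {x \<in> {1..t}. D x \<in> {..0}}"
  have "continuous_on {1..t} D"
    unfolding D_def by (intro continuous_intros continuous_on_delay_fun s)
  then have "closed S"
    using continuous_closed_preimage[of "{1..t}" D "{..0}"]
    by (simp add: S_def vimage_def Int_def)
  moreover have "S \<noteq> {}" using Dt \<open>t > 1\<close> by (auto simp: S_def)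
  moreover have "bdd_below S" by (auto simp: S_def)
  ultimately have I: "Inf S \<in> S" by (rule closed_contains_Inf[rotated 2])
  define x where "x = Inf S"
  have x: "x \<ge> 1" "D x \<le> 0" using I by (auto simp: S_def x_def)
  have pos: "D y > 0" if "0 < y" "y < x" for y
  proof (rule ccontr)
    assume "\<not> D y > 0"
    with small[of y] that have "1 \<le> y" "D y \<le> 0" by linarith+
    moreover have "x \<le> t" using I by (auto simp: S_def x_def)
    ultimately have "y \<in> S" using that by (auto simp: S_def)
    then have "x \<le> y" unfolding x_def by (intro cInf_lower \<open>bdd_below S\<close>)
    with that show False by simp
  qed
  have "delay_fun s (x - 1) < delay_fun s x"
  proof (rule DERIV_pos_imp_increasing_open[where f = "delay_fun s" and a = "x - 1" and b = x])
    show "x - 1 < x" by simp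
    show "\<exists>d. (delay_fun s has_real_derivative d) (at y) \<and> d > 0" if "x - 1 < y" "y < x" for y
      using delay_deriv[OF s, of y] pos[of y] that x s
      by (intro exI[of _ "s * (delay_fun s y - delay_fun s (y - 1)) / y"]) (auto simp: D_def)
    show "continuous_on {x - 1..x} (delay_fun s)"
      using continuous_on_delay_fun[OF s, of _ "\<lambda>x. x"] by simp
  qed
  then show False using x by (simp add: D_def)
qed

lemma delay_strict_mono:
  assumes "s > 0" "0 \<le> x" "x < y" shows "delay_fun s x < delay_fun s y"
proof (rule DERIV_pos_imp_increasing_open[OF assms(3)])
  show "\<exists>d. (delay_fun s has_real_derivative d) (at z) \<and> d > 0" if "x < z" "z < y" for z
    using delay_deriv[OF assms(1), of z] delay_diff_pos[OF assms(1), of z] that assms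
    by (intro exI[of _ "s * (delay_fun s z - delay_fun s (z - 1)) / z"]) auto
  show "continuous_on {x..y} (delay_fun s)"
    using continuous_on_delay_fun[OF assms(1), of _ "\<lambda>x. x"] by simp
qed

lemma delay_mono:
  assumes "s > 0" "x \<le> y" shows "delay_fun s x \<le> delay_fun s y"
proof (cases "y \<le> 0")
  case False
  then show ?thesis
    using delay_strict_mono[of s 0 y] delay_strict_mono[of s x y] assms
    by (cases "x \<le> 0"; cases "x = y") (auto simp: delay_nonpos)
qed (use assms in \<open>simp add: delay_nonpos\<close>)

lemma delay_bounded:
  assumes "s > 0" shows "\<exists>B. \<forall>t. delay_fun s t \<le> B"
proof -
  define A where "A = 2 * s + 1"
  define J where "J = (\<lambda>t. integral {0..t} (delay_fun s))"
  have cont: "continuous_on A (delay_fun s)" for A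
    using continuous_on_delay_fun[OF assms, of _ "\<lambda>x. x"] by simp
  have J: "(J has_real_derivative delay_fun s t) (at t)" if "t > 0" for t
  proof -
    have "(J has_real_derivative delay_fun s t) (at t within {0..t+1})"
      unfolding J_def using that by (intro integral_has_real_derivative cont) auto
    then show ?thesis using that by (simp add: at_within_Icc_at)
  qed
  have J1: "((\<lambda>t. J (t - 1)) has_real_derivative delay_fun s (t - 1)) (at t)" if "t > 1" for t
  proof -
    have "((\<lambda>t. t - 1) has_real_derivative 1) (at t)"
      by (auto intro!: derivative_eq_intros)
    then show ?thesis
      using DERIV_chain2[where f = J and g = "\<lambda>t. t - 1" and x = t and Db = 1, OF J] that by simp
  qed
  define E where "E = (\<lambda>t. A * delay_fun s t - s * (J t - J (t - 1)))"
  have "delay_fun s t \<le> A * delay_fun s A / (A - s)" for t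
  proof (cases "t \<le> A")
    case True
    have "delay_fun s t \<le> delay_fun s A" using delay_mono[OF assms True] .
    also have "\<dots> \<le> A * delay_fun s A / (A - s)"
      using assms delay_mono[OF assms, of 0 A] by (auto simp: A_def field_simps delay_nonpos)
    finally show ?thesis .
  next
    case False
    have "E t \<le> E A"
    proof (rule DERIV_nonpos_imp_nonincreasing[where f = E and a = A and b = t])
      fix x assume x: "A \<le> x" "x \<le> t"
      let ?d = "s * (delay_fun s x - delay_fun s (x - 1)) / x"
      have x1: "x > 1" using x assms by (simp add: A_def)
      have "(E has_real_derivative A * ?d - s * (delay_fun s x - delay_fun s (x - 1))) (at x)"
        unfolding E_def using x1 assms
        by (intro DERIV_diff DERIV_cmult delay_deriv J J1) auto
      moreover have "A * ?d \<le> x * ?d"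
        using x x1 delay_diff_pos[OF assms, of x] assms by (intro mult_right_mono) auto
      ultimately show "\<exists>y. (E has_real_derivative y) (at x) \<and> y \<le> 0"
        using x1 by (intro exI[of _ "A * ?d - s * (delay_fun s x - delay_fun s (x - 1))"]) auto
    qed (use False in simp)
    have JJ: "0 \<le> J y - J (y - 1) \<and> J y - J (y - 1) \<le> delay_fun s y" if "y > 1" for y
    proof -
      have "\<exists>z. y - 1 < z \<and> z < y \<and> J y - J (y - 1) = (y - (y - 1)) * delay_fun s z"
        using that by (intro MVT2 J) auto
      then obtain z where "z < y" "y - 1 < z" "J y - J (y - 1) = delay_fun s z" by auto
      then show ?thesis
        using delay_mono[OF assms, of z y] delay_mono[OF assms, of 0 z] that by (auto simp: delay_nonpos assms)
    qed
    have "A * delay_fun s t - s * delay_fun s t \<le> E t"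
      using JJ[of t] False assms by (auto simp: E_def A_def intro!: mult_left_mono)
    also note \<open>E t \<le> E A\<close>
    also have "E A \<le> A * delay_fun s A"
      using JJ[of A] assms by (auto simp: E_def A_def)
    finally show ?thesis
      using assms by (simp add: field_simps A_def)
  qed
  then show ?thesis by blast
qed

definition delay_lim :: "real \<Rightarrow> real" where
  "delay_lim s = lim (\<lambda>n. delay_fun s (real n))"

lemma delay_lim:
  assumes "s > 0"
  shows "(\<lambda>n. delay_fun s (real n)) \<longlonglongrightarrow> delay_lim s" and delay_le_lim: "delay_fun s t \<le> delay_lim s"
    and delay_lim_pos: "delay_lim s > 0" and delay_tendsto: "(delay_fun s \<longlongrightarrow> delay_lim s) at_top"
proof -
  have inc: "incseq (\<lambda>n. delay_fun s (real n))"
    by (intro monoI delay_mono assms) simp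
  obtain B where "\<And>t. delay_fun s t \<le> B" using delay_bounded[OF assms] by blast
  then have "convergent (\<lambda>n. delay_fun s (real n))"
    using inc incseq_convergent[of "\<lambda>n. delay_fun s (real n)" B] unfolding convergent_def by blast
  then show lim: "(\<lambda>n. delay_fun s (real n)) \<longlonglongrightarrow> delay_lim s"
    by (simp add: convergent_LIMSEQ_iff delay_lim_def)
  have le: "delay_fun s t \<le> delay_lim s" for t
  proof -
    obtain n :: nat where n: "t < real n" using reals_Archimedean2 by blast
    have "delay_fun s t \<le> delay_fun s (real n)" using n by (intro delay_mono assms) simp
    also have "\<dots> \<le> delay_lim s" by (rule incseq_le[OF inc lim])
    finally show ?thesis .
  qed
  then show "delay_fun s t \<le> delay_lim s" .
  show "delay_lim s > 0"
    using le[of 1] assms by (simp add: delay_le_1)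
  show "(delay_fun s \<longlongrightarrow> delay_lim s) at_top"
  proof (rule increasing_tendsto)
    show "\<forall>\<^sub>F t in at_top. delay_fun s t \<le> delay_lim s" using le by simp
    fix x assume "x < delay_lim s"
    then obtain n :: nat where "x < delay_fun s (real n)"
      using order_tendstoD(1)[OF lim] eventually_happens'[OF sequentially_bot] by blast
    then have "\<forall>t\<ge>real n. x < delay_fun s t" using delay_mono[OF assms] by (meson less_le_trans)
    then show "\<forall>\<^sub>F t in at_top. x < delay_fun s t" unfolding eventually_at_top_linorder by blast
  qed
qed

definition dickman_psi :: "real \<Rightarrow> real" where
  "dickman_psi l = (LBINT u:{0<..<1}. (1 - exp (- l * u)) / u)"

definition exp_quot :: "real \<Rightarrow> real" where
  "exp_quot v = (if v = 0 then 1 else (1 - exp (- v)) / v)"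

lemma continuous_on_exp_quot: "continuous_on A exp_quot"
proof -
  have "isCont exp_quot v" for v
  proof (cases "v = 0")
    case True
    have "((\<lambda>v::real. (1 - exp (- v)) / v) \<longlongrightarrow> 1) (at 0)"
    proof -
      have "((\<lambda>v::real. 1 - exp (- v)) has_real_derivative 1) (at 0)"
        by (auto intro!: derivative_eq_intros)
      then show ?thesis by (simp add: has_field_derivative_iff)
    qed
    then have "(exp_quot \<longlongrightarrow> 1) (at 0)"
      by (rule Lim_transform_eventually) (auto simp: exp_quot_def eventually_at_filter)
    then show ?thesis by (simp add: True isCont_def exp_quot_def)
  next
    case False
    have "isCont (\<lambda>v. (1 - exp (- v)) / v) v" using False by (intro continuous_intros)
    moreover have "\<forall>\<^sub>F x in nhds v. exp_quot x = (1 - exp (- x)) / x"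
      by (rule eventually_mono[OF eventually_nhds_in_open[of "- {0}" v]]) (use False in \<open>auto simp: exp_quot_def\<close>)
    ultimately show ?thesis by (simp add: isCont_cong)
  qed
  then show ?thesis by (simp add: continuous_at_imp_continuous_on)
qed

lemma exp_quot_nonneg: "v \<ge> 0 \<Longrightarrow> exp_quot v \<ge> 0"
  by (simp add: exp_quot_def)

lemma exp_quot_le_1: "v \<ge> 0 \<Longrightarrow> exp_quot v \<le> 1"
  using exp_ge_add_one_self[of "- v"] by (simp add: exp_quot_def field_simps)

lemma dickman_psi_eq:
  assumes "l \<ge> 0"
  shows "dickman_psi l = integral {0..l} exp_quot"
    and "((\<lambda>u. l * exp_quot (l * u)) has_integral dickman_psi l) {0..1}"
proof -
  have K: "((\<lambda>x. integral {0..x} exp_quot) has_real_derivative exp_quot x) (at x within {0..l})"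
    if "x \<in> {0..l}" for x
    using that by (intro integral_has_real_derivative continuous_on_exp_quot) auto
  have "((\<lambda>u. integral {0..l * u} exp_quot) has_real_derivative l * exp_quot (l * u)) (at u within {0..1})"
    if u: "u \<in> {0..1}" for u
  proof -
    have "l * u \<le> l * 1" using u assms by (intro mult_left_mono) auto
    then have 1: "((\<lambda>x. integral {0..x} exp_quot) has_real_derivative exp_quot (l * u)) (at (l * u) within {0..l})"
      using u assms by (intro K) auto
    have "(\<lambda>u. l * u) ` {0..1} \<subseteq> {0..l}"
      using assms mult_left_mono[OF _ assms, of _ 1] by auto
    from has_field_derivative_subset[OF 1 this]
    have 2: "((\<lambda>x. integral {0..x} exp_quot) has_real_derivative exp_quot (l * u)) (at (l * u) within (\<lambda>u. l * u) ` {0..1})" .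
    have "((\<lambda>u. l * u) has_real_derivative l) (at u within {0..1})"
      by (auto intro!: derivative_eq_intros)
    from DERIV_image_chain[OF 2 this] show ?thesis by (simp add: o_def mult.commute)
  qed
  then have I: "((\<lambda>u. l * exp_quot (l * u)) has_integral (integral {0..l * 1} exp_quot - integral {0..l * 0} exp_quot)) {0..1}"
    by (intro fundamental_theorem_of_calculus) (auto simp: has_real_derivative_iff_has_vector_derivative)
  have cont: "continuous_on {0..1} (\<lambda>u. l * exp_quot (l * u))"
    by (intro continuous_intros continuous_on_compose2[OF continuous_on_exp_quot[of UNIV]]) auto
  have "dickman_psi l = (LBINT u:{0<..<1}. l * exp_quot (l * u))"
    unfolding dickman_psi_def by (intro set_lebesgue_integral_cong) (auto simp: exp_quot_def)
  also have "\<dots> = integral {0<..<1} (\<lambda>u. l * exp_quot (l * u))"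
    by (intro set_borel_integral_eq_integral(2) set_integrable_subset[OF borel_integrable_atLeastAtMost'[OF cont]]) auto
  also have "\<dots> = integral {0..1} (\<lambda>u. l * exp_quot (l * u))"
    by (simp add: integral_open_interval_real)
  also have "\<dots> = integral {0..l} exp_quot"
    using integral_unique[OF I] by simp
  finally show *: "dickman_psi l = integral {0..l} exp_quot" .
  show "((\<lambda>u. l * exp_quot (l * u)) has_integral dickman_psi l) {0..1}"
    using I by (simp add: *)
qed

lemma dickman_psi_0: "dickman_psi 0 = 0"
  by (simp add: dickman_psi_eq)

lemma dickman_psi_deriv_within:
  assumes "x \<in> {0..b}"
  shows "(dickman_psi has_real_derivative exp_quot x) (at x within {0..b})"
proof -
  have "((\<lambda>x. integral {0..x} exp_quot) has_real_derivative exp_quot x) (at x within {0..b})"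
    using assms by (intro integral_has_real_derivative continuous_on_exp_quot) auto
  then show ?thesis
    by (rule has_field_derivative_transform_within[of _ _ _ _ 1]) (use assms in \<open>auto simp: dickman_psi_eq\<close>)
qed

lemma dickman_psi_deriv:
  assumes "x > 0"
  shows "(dickman_psi has_real_derivative (1 - exp (- x)) / x) (at x)"
proof -
  have "(dickman_psi has_real_derivative exp_quot x) (at x within {0..x+1})"
    using assms by (intro dickman_psi_deriv_within) auto
  then show ?thesis using assms by (simp add: at_within_Icc_at exp_quot_def)
qed

lemma dickman_psi_tendsto_0: "(\<lambda>n. dickman_psi (1 / real (Suc n))) \<longlonglongrightarrow> 0"
proof -
  have "continuous_on {0..1} dickman_psi"
    using dickman_psi_deriv_within by (intro DERIV_continuous_on) auto
  moreover have "(\<lambda>n. 1 / real (Suc n)) \<longlonglongrightarrow> 0"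
    using LIMSEQ_inverse_real_of_nat by (simp add: inverse_eq_divide)
  ultimately have "(\<lambda>n. dickman_psi (1 / real (Suc n))) \<longlonglongrightarrow> dickman_psi 0"
    by (elim continuous_on_tendsto_compose) auto
  then show ?thesis by (simp add: dickman_psi_0)
qed

lemma dickman_psi_mono:
  assumes "0 \<le> x" "x \<le> y" shows "dickman_psi x \<le> dickman_psi y"
proof -
  have "integral {0..x} exp_quot \<le> integral {0..y} exp_quot"
    using assms exp_quot_nonneg
    by (intro integral_subset_le integrable_continuous_interval continuous_on_exp_quot) auto
  then show ?thesis using assms by (simp add: dickman_psi_eq)
qed

lemma dickman_psi_nonneg: "x \<ge> 0 \<Longrightarrow> dickman_psi x \<ge> 0"
  using dickman_psi_mono[of 0 x] by (simp add: dickman_psi_0)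

lemma dickman_psi_large: "\<exists>l>0. \<forall>x\<ge>l. dickman_psi x > \<theta>"
proof -
  define c where "c = 1 - exp (- 1 :: real)"
  have c: "c > 0" by (simp add: c_def)
  have ge: "c * ln x \<le> dickman_psi x" if "x \<ge> 1" for x
  proof -
    have "dickman_psi 1 - c * ln 1 \<le> dickman_psi x - c * ln x"
    proof (rule DERIV_nonneg_imp_nondecreasing[OF that])
      fix y :: real assume y: "1 \<le> y" "y \<le> x"
      have "((\<lambda>x. dickman_psi x - c * ln x) has_real_derivative (1 - exp (- y)) / y - c * (1 / y)) (at y)"
        using y by (intro DERIV_diff DERIV_cmult dickman_psi_deriv DERIV_ln_divide) auto
      moreover have "(1 - exp (- y)) / y - c * (1 / y) \<ge> 0"
        using y by (simp add: c_def divide_right_mono flip: diff_divide_distrib)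
      ultimately show "\<exists>d. ((\<lambda>x. dickman_psi x - c * ln x) has_real_derivative d) (at y) \<and> 0 \<le> d"
        by blast
    qed
    then show ?thesis using dickman_psi_nonneg[of 1] by simp
  qed
  define l where "l = exp (max 0 (\<theta> / c) + 1)"
  have l: "l \<ge> 1" by (simp add: l_def)
  have "dickman_psi x > \<theta>" if "x \<ge> l" for x
  proof -
    have "\<theta> < c * (max 0 (\<theta> / c) + 1)" using c by (auto simp: max_def field_simps)
    also have "\<dots> = c * ln l" by (simp add: l_def)
    also have "\<dots> \<le> dickman_psi l" using ge l by simp
    also have "\<dots> \<le> dickman_psi x" using that l by (intro dickman_psi_mono) auto
    finally show ?thesis .
  qed
  then show ?thesis using l by (intro exI[of _ l]) auto
qed

definition dcdf :: "real \<Rightarrow> real \<Rightarrow> real" where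
  "dcdf s t = delay_fun s t / delay_lim s"

definition dpdf :: "real \<Rightarrow> real \<Rightarrow> real" where
  "dpdf s t = (if t \<le> 0 then 0 else s * (dcdf s t - dcdf s (t - 1)) / t)"

lemma dpdf_nonpos [simp]: "t \<le> 0 \<Longrightarrow> dpdf s t = 0"
  by (simp add: dpdf_def)

lemma mult_dpdf: "t > 0 \<Longrightarrow> t * dpdf s t = s * (dcdf s t - dcdf s (t - 1))"
  by (simp add: dpdf_def)

lemma dcdf_nonpos: "s > 0 \<Longrightarrow> t \<le> 0 \<Longrightarrow> dcdf s t = 0"
  by (simp add: dcdf_def delay_nonpos)

lemma dcdf_mono: "s > 0 \<Longrightarrow> x \<le> y \<Longrightarrow> dcdf s x \<le> dcdf s y"
  using delay_lim_pos[of s] by (simp add: dcdf_def divide_right_mono delay_mono)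

lemma dcdf_nonneg: "s > 0 \<Longrightarrow> dcdf s x \<ge> 0"
  using dcdf_mono[of s "min x 0" x] dcdf_nonpos[of s "min x 0"] by simp

lemma dcdf_le_1: "s > 0 \<Longrightarrow> dcdf s x \<le> 1"
  using delay_lim_pos[of s] delay_le_lim[of s x] by (simp add: dcdf_def)

lemma dcdf_tendsto_1: "s > 0 \<Longrightarrow> (dcdf s \<longlongrightarrow> 1) at_top"
  using tendsto_divide[OF delay_tendsto[of s] tendsto_const[of "delay_lim s"]] delay_lim_pos[of s]
  by (simp add: dcdf_def[abs_def])

lemma continuous_on_dcdf: "s > 0 \<Longrightarrow> continuous_on A h \<Longrightarrow> continuous_on A (\<lambda>x. dcdf s (h x))"
  unfolding dcdf_def using delay_lim_pos[of s]
  by (intro continuous_intros continuous_on_delay_fun) auto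

lemma isCont_dcdf: "s > 0 \<Longrightarrow> isCont (dcdf s) t"
  using continuous_on_dcdf[of s UNIV "\<lambda>x. x"] by (simp add: continuous_on_eq_continuous_at)

lemma dcdf_small: "s > 0 \<Longrightarrow> 0 < t \<Longrightarrow> t \<le> 1 \<Longrightarrow> dcdf s t = dcdf s 1 * t powr s"
  by (simp add: dcdf_def delay_le_1)

lemma dcdf_diff_pos: "s > 0 \<Longrightarrow> t > 0 \<Longrightarrow> dcdf s t - dcdf s (t - 1) > 0"
  using delay_diff_pos[of s t] delay_lim_pos[of s] by (simp add: dcdf_def divide_strict_right_mono)

lemma dcdf_deriv:
  assumes "s > 0" "t > 0" shows "(dcdf s has_real_derivative dpdf s t) (at t)"
  unfolding dcdf_def[abs_def]
  using DERIV_cdivide[OF delay_deriv[OF assms], of "delay_lim s"] assms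
  by (simp add: dpdf_def dcdf_def diff_divide_distrib right_diff_distrib mult.commute)

lemma dpdf_pos: "s > 0 \<Longrightarrow> t > 0 \<Longrightarrow> dpdf s t > 0"
  using dcdf_diff_pos[of s t] by (simp add: dpdf_def)

lemma dpdf_nonneg: "s > 0 \<Longrightarrow> dpdf s t \<ge> 0"
  using dpdf_pos[of s t] by (cases "t > 0") (auto simp: dpdf_def)

lemma continuous_on_dpdf: "s > 0 \<Longrightarrow> continuous_on {0<..} (dpdf s)"
proof -
  assume s: "s > 0"
  have "continuous_on {0<..} (\<lambda>t. s * (dcdf s t - dcdf s (t - 1)) / t)"
    using s by (intro continuous_intros continuous_on_dcdf) auto
  then show ?thesis
    by (rule continuous_on_cong[THEN iffD1, rotated 2]) (auto simp: dpdf_def)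
qed

lemma isCont_dpdf: "s > 0 \<Longrightarrow> t > 0 \<Longrightarrow> isCont (dpdf s) t"
  using continuous_on_dpdf[of s] by (simp add: continuous_on_eq_continuous_at)

lemma measurable_delay_iter:
  "(\<lambda>(s, t). delay_iter n s t) \<in> borel_measurable (borel \<Otimes>\<^sub>M borel)"
proof (induction n)
  case 0
  show ?case by simp
next
  case (Suc n)
  have [measurable]: "(\<lambda>x. delay_iter n (a x) (b x)) \<in> borel_measurable M"
    if [measurable]: "a \<in> borel_measurable M" "b \<in> borel_measurable M" for a b and M :: "'x measure"
    using measurable_compose[OF measurable_Pair[OF that] Suc] by simp
  have "(\<lambda>(s, t). LBINT u:{1..t}. u powr (- s - 1) * delay_iter n s (u - 1))
      = (\<lambda>(s, t). \<integral>u. (if 1 \<le> u \<and> u \<le> t then 1 else 0) * (u powr (- s - 1) * delay_iter n s (u - 1)) \<partial>lborel)"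
    unfolding set_lebesgue_integral_def
    by (intro ext) (auto simp: indicator_def intro!: Bochner_Integration.integral_cong)
  moreover have "\<dots> \<in> borel_measurable (borel \<Otimes>\<^sub>M borel)"
    by measurable
  ultimately have [measurable]: "(\<lambda>p. LBINT u:{1..snd p}. u powr (- fst p - 1) * delay_iter n (fst p) (u - 1))
      \<in> borel_measurable (borel \<Otimes>\<^sub>M borel)" by (simp add: case_prod_beta')
  show ?case by (simp add: case_prod_beta')
qed

lemma measurable_delay_fun:
  assumes [measurable]: "a \<in> borel_measurable M" "b \<in> borel_measurable M"
  shows "(\<lambda>x. delay_fun (a x) (b x)) \<in> borel_measurable M"
  unfolding delay_fun_def
  using measurable_compose[OF measurable_Pair[OF assms] measurable_delay_iter]
  by (intro borel_measurable_lim_metric) simp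

lemma measurable_dcdf [measurable]:
  assumes [measurable]: "a \<in> borel_measurable M" "b \<in> borel_measurable M"
  shows "(\<lambda>x. dcdf (a x) (b x)) \<in> borel_measurable M"
  unfolding dcdf_def delay_lim_def
  by (intro borel_measurable_divide borel_measurable_lim_metric measurable_delay_fun) measurable

lemma measurable_dpdf [measurable]:
  assumes [measurable]: "a \<in> borel_measurable M" "b \<in> borel_measurable M"
  shows "(\<lambda>x. dpdf (a x) (b x)) \<in> borel_measurable M"
  unfolding dpdf_def by measurable

lemma FTC_Ioi_nonneg:
  fixes f F :: "real \<Rightarrow> real"
  assumes "\<And>x. x > 0 \<Longrightarrow> (F has_real_derivative f x) (at x)" "\<And>x. x > 0 \<Longrightarrow> isCont f x"
    and "\<And>x. x > 0 \<Longrightarrow> f x \<ge> 0" "(F \<longlongrightarrow> A) (at_right 0)" "(F \<longlongrightarrow> B) at_top"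
  shows "set_integrable lborel {0<..} f" "(LBINT x:{0<..}. f x) = B - A"
proof -
  have "set_integrable lborel (einterval 0 \<infinity>) f" "(LBINT x=0..\<infinity>. f x) = B - A"
    using assms by (intro interval_integral_FTC_nonneg[where F = F];
        auto simp: zero_ereal_def ereal_tendsto_simps)+
  then show "set_integrable lborel {0<..} f" "(LBINT x:{0<..}. f x) = B - A"
    by (simp_all add: interval_lebesgue_integral_def zero_ereal_def)
qed

lemma FTC_Ioi_integrable:
  fixes f F :: "real \<Rightarrow> real"
  assumes "\<And>x. x > 0 \<Longrightarrow> (F has_real_derivative f x) (at x)" "\<And>x. x > 0 \<Longrightarrow> isCont f x"
    and "set_integrable lborel {0<..} f" "(F \<longlongrightarrow> A) (at_right 0)" "(F \<longlongrightarrow> B) at_top"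
  shows "(LBINT x:{0<..}. f x) = B - A"
proof -
  have "(LBINT x=0..\<infinity>. f x) = B - A"
    using assms by (intro interval_integral_FTC_integrable[where F = F])
        (auto simp: zero_ereal_def ereal_tendsto_simps
          has_real_derivative_iff_has_vector_derivative)
  then show ?thesis
    by (simp add: interval_lebesgue_integral_def zero_ereal_def)
qed

lemma dpdf_integral:
  assumes "s > 0"
  shows "integrable lborel (dpdf s)" "(\<integral>t. dpdf s t \<partial>lborel) = 1"
    and "(\<integral>u. indicator {..t} u * dpdf s u \<partial>lborel) = dcdf s t"
proof -
  have 0: "(dcdf s \<longlongrightarrow> 0) (at_right 0)"
    using isCont_dcdf[OF assms, of 0] by (simp add: isCont_def filterlim_at_split dcdf_nonpos assms)
  have "set_integrable lborel {0<..} (dpdf s)" "(LBINT x:{0<..}. dpdf s x) = 1 - 0"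
    using FTC_Ioi_nonneg[OF dcdf_deriv[OF assms] isCont_dpdf[OF assms] dpdf_nonneg[OF assms]
        0 dcdf_tendsto_1[OF assms]] by auto
  moreover have eq: "(\<lambda>x. indicator {0<..} x *\<^sub>R dpdf s x) = dpdf s"
    by (auto simp: fun_eq_iff indicator_def dpdf_def)
  ultimately show "integrable lborel (dpdf s)" "(\<integral>t. dpdf s t \<partial>lborel) = 1"
    by (auto simp: set_integrable_def set_lebesgue_integral_def eq)
  have lim0: "((dcdf s \<circ> real_of_ereal) \<longlongrightarrow> 0) (at_right 0)"
    using 0 by (simp add: ereal_tendsto_simps zero_ereal_def)
  show "(\<integral>u. indicator {..t} u * dpdf s u \<partial>lborel) = dcdf s t"
  proof (cases "t > 0")
    case True
    have limt: "((dcdf s \<circ> real_of_ereal) \<longlongrightarrow> dcdf s t) (at_left (ereal t))"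
    proof -
      have "(dcdf s \<longlongrightarrow> dcdf s t) (at_left t)"
        using isCont_dcdf[OF assms, of t] by (simp add: isCont_def filterlim_at_split)
      then show ?thesis by (simp add: ereal_tendsto_simps)
    qed
    have "(LBINT x=0..ereal t. dpdf s x) = dcdf s t - 0"
      using assms lim0 limt True
      by (intro interval_integral_FTC_nonneg(2)[where F = "dcdf s"])
        (auto intro!: dcdf_deriv isCont_dpdf dpdf_nonneg simp: zero_ereal_def)
    moreover have "(LBINT x=0..ereal t. dpdf s x) = (\<integral>u. indicator {0<..<t} u * dpdf s u \<partial>lborel)"
      using True by (simp add: interval_lebesgue_integral_def set_lebesgue_integral_def zero_ereal_def)
    moreover have "\<dots> = (\<integral>u. indicator {..t} u * dpdf s u \<partial>lborel)"
    proof (rule integral_cong_AE)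
      show "AE u in lborel. indicator {0<..<t} u * dpdf s u = indicator {..t} u * dpdf s u"
        using AE_lborel_singleton[of t] by eventually_elim (auto simp: indicator_def dpdf_def)
    qed measurable
    ultimately show ?thesis by simp
  next
    case False
    then have "(\<lambda>u. indicator {..t} u * dpdf s u) = (\<lambda>u. 0)"
      by (auto simp: fun_eq_iff indicator_def dpdf_def)
    then show ?thesis using False assms by (simp add: dcdf_nonpos)
  qed
qed

section \<open>Positive functionals and moment convergence\<close>

definition pos_functional :: "((real \<Rightarrow> real) \<Rightarrow> real) \<Rightarrow> bool" where
  "pos_functional P \<longleftrightarrow>
    (\<forall>f g. continuous_on UNIV f \<longrightarrow> continuous_on UNIV g \<longrightarrow> P (\<lambda>x. f x + g x) = P f + P g) \<and>
    (\<forall>c f. continuous_on UNIV f \<longrightarrow> P (\<lambda>x. c * f x) = c * P f) \<and>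
    (\<forall>f g. continuous_on UNIV f \<longrightarrow> continuous_on UNIV g \<longrightarrow> (\<forall>x\<in>{0..1}. f x \<le> g x) \<longrightarrow> P f \<le> P g)"

lemma pos_functional_add:
  assumes "pos_functional P" "continuous_on UNIV f" "continuous_on UNIV g"
  shows "P (\<lambda>x. f x + g x) = P f + P g"
  by (rule assms(1)[unfolded pos_functional_def, THEN conjunct1, rule_format, OF assms(2,3)])

lemma pos_functional_cmult:
  assumes "pos_functional P" "continuous_on UNIV f"
  shows "P (\<lambda>x. c * f x) = c * P f"
  by (rule assms(1)[unfolded pos_functional_def, THEN conjunct2, THEN conjunct1, rule_format, OF assms(2)])

lemma pos_functional_mono:
  assumes "pos_functional P" "continuous_on UNIV f" "continuous_on UNIV g"
    and "\<And>x. 0 \<le> x \<Longrightarrow> x \<le> 1 \<Longrightarrow> f x \<le> g x"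
  shows "P f \<le> P g"
proof (rule assms(1)[unfolded pos_functional_def, THEN conjunct2, THEN conjunct2, rule_format, OF assms(2,3)])
  show "f x \<le> g x" if "x \<in> {0..1}" for x using assms(4) that by auto
qed

lemma pos_functional_poly:
  assumes P: "pos_functional P"
  shows "P (\<lambda>x. \<Sum>i\<le>(n::nat). a i * x ^ i) = (\<Sum>i\<le>n. a i * P (\<lambda>x. x ^ i))"
proof (induction n)
  case 0
  show ?case using pos_functional_cmult[OF P, of "\<lambda>x. x ^ 0" "a 0"] by simp
next
  case (Suc n)
  have "P (\<lambda>x. (\<Sum>i\<le>n. a i * x ^ i) + a (Suc n) * x ^ Suc n) =
      P (\<lambda>x. \<Sum>i\<le>n. a i * x ^ i) + P (\<lambda>x. a (Suc n) * x ^ Suc n)"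
    by (intro pos_functional_add[OF P] continuous_intros)
  also have "P (\<lambda>x. a (Suc n) * x ^ Suc n) = a (Suc n) * P (\<lambda>x. x ^ Suc n)"
    by (intro pos_functional_cmult[OF P] continuous_intros)
  finally show ?case using Suc by simp
qed

lemma pos_functional_close:
  assumes P: "pos_functional P" and f: "continuous_on UNIV f" and g: "continuous_on UNIV g"
    and close: "\<And>x. 0 \<le> x \<Longrightarrow> x \<le> 1 \<Longrightarrow> \<bar>f x - g x\<bar> \<le> e"
  shows "\<bar>P f - P g\<bar> \<le> e * P (\<lambda>x. 1)"
proof -
  have *: "P f' \<le> P g' + e * P (\<lambda>x. 1)"
    if c: "continuous_on UNIV f'" "continuous_on UNIV g'"
      and "\<And>x. 0 \<le> x \<Longrightarrow> x \<le> 1 \<Longrightarrow> \<bar>f' x - g' x\<bar> \<le> e" for f' g'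
  proof -
    have "P f' \<le> P (\<lambda>x. g' x + e * 1)"
      using that(3) by (intro pos_functional_mono[OF P] continuous_intros c) (auto simp: abs_le_iff algebra_simps)
    also have "\<dots> = P g' + P (\<lambda>x. e * 1)"
      by (intro pos_functional_add[OF P] continuous_intros c)
    also have "P (\<lambda>x. e * 1) = e * P (\<lambda>x. 1)"
      by (intro pos_functional_cmult[OF P] continuous_intros)
    finally show ?thesis .
  qed
  show ?thesis using *[OF f g close] *[OF g f] close by (simp add: abs_le_iff abs_minus_commute)
qed

text \<open>Karamata's method: by Weierstrass approximation, convergence of the moments suffices.\<close>

lemma pos_functional_tendsto:
  assumes PN: "\<forall>\<^sub>F N in sequentially. pos_functional (PN N)" and P: "pos_functional P"
    and mom: "\<And>k::nat. (\<lambda>N. PN N (\<lambda>x. x ^ k)) \<longlonglongrightarrow> P (\<lambda>x. x ^ k)"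
    and h: "continuous_on UNIV h"
  shows "(\<lambda>N. PN N h) \<longlonglongrightarrow> P h"
proof (rule tendstoI)
  fix e :: real assume e: "e > 0"
  have one: "(\<lambda>N. PN N (\<lambda>x. 1)) \<longlonglongrightarrow> P (\<lambda>x. 1)" using mom[of 0] by simp
  have "P (\<lambda>x. 0 * 1) = 0 * P (\<lambda>x. 1)" by (intro pos_functional_cmult[OF P] continuous_intros)
  moreover have "P (\<lambda>x. 0 * 1) \<le> P (\<lambda>x. 1)"
    by (rule pos_functional_mono[OF P]) (auto intro!: continuous_intros)
  ultimately have P1: "P (\<lambda>x. 1) \<ge> 0" by simp
  define d where "d = e / (3 * (P (\<lambda>x. 1) + 1))"
  have d: "d > 0" using e P1 by (simp add: d_def)
  obtain g where g: "real_polynomial_function g" "\<And>x. x \<in> {0..1} \<Longrightarrow> \<bar>h x - g x\<bar> < d"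
    using Stone_Weierstrass_real_polynomial_function[of "{0..1}" h d] d continuous_on_subset[OF h]
    by (metis compact_Icc subset_UNIV)
  then obtain a n where ga: "g = (\<lambda>x. \<Sum>i\<le>n. a i * x ^ i)"
    by (auto simp: real_polynomial_function_iff_sum)
  have gc: "continuous_on UNIV g" unfolding ga by (intro continuous_intros)
  have Pg: "(\<lambda>N. \<Sum>i\<le>n. a i * PN N (\<lambda>x. x ^ i)) \<longlonglongrightarrow> P g"
    unfolding ga pos_functional_poly[OF P] by (intro tendsto_intros mom)
  have "\<forall>\<^sub>F N in sequentially. PN N (\<lambda>x. 1) < P (\<lambda>x. 1) + 1"
    using order_tendstoD(2)[OF one] by simp
  moreover have "\<forall>\<^sub>F N in sequentially. dist (\<Sum>i\<le>n. a i * PN N (\<lambda>x. x ^ i)) (P g) < e / 3"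
    using Pg e by (intro tendstoD) auto
  ultimately show "\<forall>\<^sub>F N in sequentially. dist (PN N h) (P h) < e"
    using PN
  proof eventually_elim
    case (elim N)
    have "\<bar>PN N h - PN N g\<bar> \<le> d * PN N (\<lambda>x. 1)"
      using elim(3) h gc by (rule pos_functional_close) (use g(2) in \<open>auto simp: less_imp_le\<close>)
    also have "\<dots> < d * (P (\<lambda>x. 1) + 1)" using elim(1) d by simp
    also have "\<dots> = e / 3" using P1 by (simp add: d_def divide_simps)
    finally have 1: "\<bar>PN N h - PN N g\<bar> < e / 3" .
    have "\<bar>P h - P g\<bar> \<le> d * P (\<lambda>x. 1)"
      using P h gc by (rule pos_functional_close) (use g(2) in \<open>auto simp: less_imp_le\<close>)
    also have "\<dots> < d * (P (\<lambda>x. 1) + 1)" using d by simp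
    also have "\<dots> = e / 3" using P1 by (simp add: d_def divide_simps)
    finally have 2: "\<bar>P h - P g\<bar> < e / 3" .
    have "PN N g = (\<Sum>i\<le>n. a i * PN N (\<lambda>x. x ^ i))"
      unfolding ga by (rule pos_functional_poly[OF elim(3)])
    then have 3: "\<bar>PN N g - P g\<bar> < e / 3" using elim(2) by (simp add: dist_real_def)
    have "\<bar>PN N h - P h\<bar> < e" using 1 2 3 by linarith
    then show ?case by (simp add: dist_real_def)
  qed
qed

lemma continuous_on_comp_ln:
  fixes q :: "real \<Rightarrow> real"
  assumes q: "continuous_on UNIV q" and 0: "\<And>x. x \<ge> K \<Longrightarrow> q x = 0"
  shows "continuous_on UNIV (\<lambda>y. if y \<le> 0 then 0 else q (- ln y))"
proof -
  let ?h = "\<lambda>y. if y \<le> 0 then 0 else q (- ln y)"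
  have 1: "continuous_on {0<..} ?h"
  proof (rule continuous_on_cong[THEN iffD1, rotated 2])
    show "continuous_on {0<..} (\<lambda>y. q (- ln y))"
      by (rule continuous_on_compose2[OF q]) (auto intro!: continuous_intros)
  qed auto
  have "?h y = 0" if "y < exp (- K)" for y
  proof (cases "y \<le> 0")
    case False
    then have "ln y < - K" using that by (metis exp_less_cancel_iff exp_ln linorder_not_le)
    then show ?thesis using 0[of "- ln y"] by simp
  qed simp
  then have 2: "continuous_on {..<exp (- K)} ?h"
    by (intro continuous_on_cong[THEN iffD1, rotated 2, OF continuous_on_const[of _ 0]]) auto
  have "continuous_on ({0<..} \<union> {..<exp (- K)}) ?h"
    by (rule continuous_on_open_Un[OF _ _ 1 2]) auto
  moreover have "{0<..} \<union> {..<exp (- K)} = (UNIV::real set)"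
  proof -
    have "y < exp (- K)" if "y \<le> 0" for y using that exp_gt_zero[of "- K"] by linarith
    then show ?thesis by force
  qed
  ultimately show ?thesis by simp
qed

lemma continuous_bounded_01:
  fixes h :: "real \<Rightarrow> real"
  assumes "continuous_on UNIV h"
  obtains B where "B \<ge> 0" "\<And>x. 0 \<le> x \<Longrightarrow> x \<le> 1 \<Longrightarrow> \<bar>h x\<bar> \<le> B"
proof -
  have "bounded (h ` {0..1::real})"
    by (intro compact_imp_bounded compact_continuous_image continuous_on_subset[OF assms]) auto
  then obtain B where B: "\<And>x. 0 \<le> x \<Longrightarrow> x \<le> 1 \<Longrightarrow> \<bar>h x\<bar> \<le> B"
    by (auto simp: bounded_iff) (meson atLeastAtMost_iff)
  have "\<bar>h 0\<bar> \<le> B" by (rule B) auto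
  then have "B \<ge> 0" by linarith
  then show ?thesis using B that by blast
qed

lemma integrable_comp_exp:
  fixes g h :: "real \<Rightarrow> real"
  assumes g: "integrable lborel g" "\<And>t. t \<le> 0 \<Longrightarrow> g t = 0" and h: "continuous_on UNIV h"
  shows "integrable lborel (\<lambda>t. h (exp (- t)) * g t)"
proof -
  obtain B where B: "B \<ge> 0" "\<And>x. 0 \<le> x \<Longrightarrow> x \<le> 1 \<Longrightarrow> \<bar>h x\<bar> \<le> B"
    using continuous_bounded_01[OF h] by blast
  have [measurable]: "h \<in> borel_measurable borel" "g \<in> borel_measurable borel"
    using h g by (auto intro: borel_measurable_continuous_onI)
  show ?thesis
  proof (rule Bochner_Integration.integrable_bound)
    show "integrable lborel (\<lambda>t. B * g t)" using g by simp
    show "AE t in lborel. norm (h (exp (- t)) * g t) \<le> norm (B * g t)"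
    proof (rule AE_I2)
      fix t show "norm (h (exp (- t)) * g t) \<le> norm (B * g t)"
        using B g(2) by (cases "t > 0") (auto simp: abs_mult intro!: mult_right_mono)
    qed
  qed measurable
qed

lemma pos_functional_density:
  assumes g: "integrable lborel g" "\<And>t. t \<le> 0 \<Longrightarrow> g t = 0" "\<And>t. g t \<ge> 0"
  shows "pos_functional (\<lambda>h. \<integral>t. h (exp (- t)) * g t \<partial>lborel)"
  unfolding pos_functional_def
proof (intro conjI allI impI)
  fix f h :: "real \<Rightarrow> real" assume c: "continuous_on UNIV f" "continuous_on UNIV h"
  show "(\<integral>t. (f (exp (- t)) + h (exp (- t))) * g t \<partial>lborel) =
      (\<integral>t. f (exp (- t)) * g t \<partial>lborel) + (\<integral>t. h (exp (- t)) * g t \<partial>lborel)"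
    unfolding distrib_right by (intro Bochner_Integration.integral_add integrable_comp_exp g c)
  assume le: "\<forall>x\<in>{0..1}. f x \<le> h x"
  show "(\<integral>t. f (exp (- t)) * g t \<partial>lborel) \<le> (\<integral>t. h (exp (- t)) * g t \<partial>lborel)"
  proof (intro integral_mono integrable_comp_exp g c)
    fix t show "f (exp (- t)) * g t \<le> h (exp (- t)) * g t"
      using le g by (cases "t > 0") (auto intro!: mult_right_mono)
  qed
qed (simp add: mult.assoc)

lemma laplace_determines_density_le:
  fixes f g :: "real \<Rightarrow> real"
  assumes f: "integrable lborel f" "\<And>t. t \<le> 0 \<Longrightarrow> f t = 0" "\<And>t. f t \<ge> 0" "continuous_on {0<..} f"
    and g: "integrable lborel g" "\<And>t. t \<le> 0 \<Longrightarrow> g t = 0" "\<And>t. g t \<ge> 0" "continuous_on {0<..} g"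
    and L: "\<And>l. l \<ge> 0 \<Longrightarrow> (\<integral>t. exp (- l * t) * f t \<partial>lborel) = (\<integral>t. exp (- l * t) * g t \<partial>lborel)"
    and t: "t > 0"
  shows "f t \<le> g t"
proof (rule ccontr)
  assume neg: "\<not> f t \<le> g t"
  have eq: "(\<integral>t. h (exp (- t)) * f t \<partial>lborel) = (\<integral>t. h (exp (- t)) * g t \<partial>lborel)"
    if h: "continuous_on UNIV h" for h
  proof -
    have "(\<lambda>N::nat. \<integral>t. h (exp (- t)) * f t \<partial>lborel) \<longlonglongrightarrow> (\<integral>t. h (exp (- t)) * g t \<partial>lborel)"
    proof (rule pos_functional_tendsto[where PN = "\<lambda>N h. \<integral>t. h (exp (- t)) * f t \<partial>lborel"
          and P = "\<lambda>h. \<integral>t. h (exp (- t)) * g t \<partial>lborel"])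
      fix k :: nat
      show "(\<lambda>N. \<integral>t. exp (- t) ^ k * f t \<partial>lborel) \<longlonglongrightarrow> (\<integral>t. exp (- t) ^ k * g t \<partial>lborel)"
        using L[of "real k"] by (simp flip: exp_of_nat_mult)
      show "\<forall>\<^sub>F N in sequentially. pos_functional (\<lambda>h. \<integral>t. h (exp (- t)) * f t \<partial>lborel)"
        using pos_functional_density[OF f(1-3)] by simp
      show "pos_functional (\<lambda>h. \<integral>t. h (exp (- t)) * g t \<partial>lborel)"
        by (rule pos_functional_density[OF g(1-3)])
      show "continuous_on UNIV h" by (fact h)
    qed
    then show ?thesis by (simp add: LIMSEQ_const_iff)
  qed
  have "isCont (\<lambda>x. f x - g x) t"
    using f(4) g(4) t by (intro continuous_intros) (auto simp: continuous_on_eq_continuous_at)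
  then have "((\<lambda>x. f x - g x) \<longlongrightarrow> f t - g t) (nhds t)"
    unfolding isCont_def using tendsto_at_iff_tendsto_nhds by fastforce
  then have "\<forall>\<^sub>F x in nhds t. f x - g x > 0"
    using neg by (intro order_tendstoD(1)) auto
  moreover have "\<forall>\<^sub>F x in nhds t. x > 0"
    using eventually_nhds_in_open[of "{0<..}" t] t by simp
  ultimately obtain e where e: "e > 0" "\<And>x. dist x t < e \<Longrightarrow> f x - g x > 0"
    unfolding eventually_nhds_metric by blast
  define q where "q = (\<lambda>x. max 0 (e - \<bar>x - t\<bar>))"
  define h where "h = (\<lambda>y. if y \<le> 0 then 0 else q (- ln y))"
  have h: "continuous_on UNIV h"
    unfolding h_def by (rule continuous_on_comp_ln[where K = "t + e"])
      (auto simp: q_def intro!: continuous_intros)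
  have hq: "h (exp (- u)) = q u" for u by (simp add: h_def)
  have i: "integrable lborel (\<lambda>u. q u * f u)" "integrable lborel (\<lambda>u. q u * g u)"
    using integrable_comp_exp[OF f(1,2) h] integrable_comp_exp[OF g(1,2) h] by (simp_all add: hq)
  have "(\<integral>u. q u * f u - q u * g u \<partial>lborel) = 0"
    using eq[OF h] i by (simp add: hq)
  moreover have "q u * f u - q u * g u \<ge> 0" for u
  proof (cases "dist u t < e")
    case True
    then have "q u * (f u - g u) \<ge> 0" using e(2)[of u] by (intro mult_nonneg_nonneg) (auto simp: q_def)
    then show ?thesis by (simp add: right_diff_distrib)
  qed (auto simp: q_def dist_real_def)
  ultimately have "AE u in lborel. q u * f u - q u * g u = 0"
    using i by (subst (asm) integral_nonneg_eq_0_iff_AE) auto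
  moreover have "q u * f u - q u * g u \<noteq> 0" if "u \<in> {t - e<..<t + e}" for u
  proof -
    have "\<bar>u - t\<bar> < e" using that by auto
    then have "q u * (f u - g u) > 0" using e(2)[of u] by (intro mult_pos_pos) (auto simp: q_def dist_real_def)
    then have "q u * f u - q u * g u > 0" by (simp add: right_diff_distrib)
    then show ?thesis by (metis less_irrefl)
  qed
  ultimately have "AE u in lborel. u \<notin> {t - e<..<t + e}"
    by (elim eventually_mono) blast
  then have "{t - e<..<t + e} \<in> null_sets lborel"
    by (subst AE_iff_null_sets) auto
  then have "emeasure lborel {t - e<..<t + e} = 0" by auto
  then show False using e(1) by simp
qed

lemma is_dickman_densityD:
  assumes "is_dickman_density s g"
  shows "integrable lborel g" "t \<le> 0 \<Longrightarrow> g t = 0" "g t \<ge> 0" "continuous_on {0<..} g"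
    "l \<ge> 0 \<Longrightarrow> (\<integral>t. exp (- l * t) * g t \<partial>lborel) = exp (- s * dickman_psi l)"
proof -
  note D = assms[unfolded is_dickman_density_def, folded dickman_psi_def]
  show "integrable lborel g" using D by (elim conjE)
  show "continuous_on {0<..} g" using D by (elim conjE)
  show "g t \<ge> 0" using D by (elim conjE) (erule spec)
  show "g t = 0" if "t \<le> 0" using D that by (elim conjE) (erule allE, erule mp)
  show "(\<integral>t. exp (- l * t) * g t \<partial>lborel) = exp (- s * dickman_psi l)" if "l \<ge> 0"
    by (rule D[THEN conjunct2, THEN conjunct2, THEN conjunct2, THEN conjunct2, THEN conjunct2, THEN spec, THEN mp, OF that])
qed

lemma dickman_density_unique:
  assumes f: "is_dickman_density s f" and g: "is_dickman_density s g"
  shows "f = g"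
proof
  note D = is_dickman_densityD
  fix t show "f t = g t"
  proof (cases "t > 0")
    case True
    have L: "(\<integral>t. exp (- l * t) * f t \<partial>lborel) = (\<integral>t. exp (- l * t) * g t \<partial>lborel)" if "l \<ge> 0" for l
      using D(5)[OF f that] D(5)[OF g that] by simp
    show ?thesis
    proof (rule antisym)
      show "f t \<le> g t"
        by (rule laplace_determines_density_le[OF D(1,2,3,4)[OF f] D(1,2,3,4)[OF g] L True])
      show "g t \<le> f t"
        by (rule laplace_determines_density_le[OF D(1,2,3,4)[OF g] D(1,2,3,4)[OF f] L[symmetric] True])
    qed
  next
    case False
    then show ?thesis using D(2)[OF f, of t] D(2)[OF g, of t] by simp
  qed
qed

lemma integrable_mult_dpdf:
  assumes "s > 0" and [measurable]: "h \<in> borel_measurable borel" and B: "\<And>t. t > 0 \<Longrightarrow> \<bar>h t\<bar> \<le> B"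
  shows "integrable lborel (\<lambda>t. h t * dpdf s t)"
proof (rule Bochner_Integration.integrable_bound)
  show "integrable lborel (\<lambda>t. B * dpdf s t)" using dpdf_integral(1)[OF assms(1)] by simp
  show "AE t in lborel. norm (h t * dpdf s t) \<le> norm (B * dpdf s t)"
  proof (rule AE_I2)
    fix t
    show "norm (h t * dpdf s t) \<le> norm (B * dpdf s t)"
    proof (cases "t > 0")
      case True
      have "\<bar>h t\<bar> \<le> \<bar>B\<bar>" using B[OF True] by simp
      then show ?thesis by (simp add: abs_mult mult_right_mono)
    qed (simp add: dpdf_def)
  qed
qed measurable

definition dickman_lt :: "real \<Rightarrow> real \<Rightarrow> real" where
  "dickman_lt s l = (\<integral>t. exp (- l * t) * dpdf s t \<partial>lborel)"

lemma integrable_exp_dpdf: "s > 0 \<Longrightarrow> l \<ge> 0 \<Longrightarrow> integrable lborel (\<lambda>t. exp (- l * t) * dpdf s t)"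
  by (intro integrable_mult_dpdf[where B = 1]) auto

lemma dickman_lt_nonneg: "s > 0 \<Longrightarrow> dickman_lt s l \<ge> 0"
  unfolding dickman_lt_def using dpdf_nonneg by (intro integral_nonneg_AE) auto

lemma dickman_lt_le_1:
  assumes "s > 0" "l \<ge> 0" shows "dickman_lt s l \<le> 1"
proof -
  have "dickman_lt s l \<le> (\<integral>t. dpdf s t \<partial>lborel)"
    unfolding dickman_lt_def
  proof (intro integral_mono integrable_exp_dpdf assms dpdf_integral(1))
    fix t show "exp (- l * t) * dpdf s t \<le> dpdf s t"
      using assms dpdf_nonneg[of s t] by (cases "t > 0") (auto intro!: mult_left_le_one_le)
  qed
  then show ?thesis using dpdf_integral[OF assms(1)] by simp
qed

lemma LBINT_exp:
  fixes c :: real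
  assumes c: "c > 0"
  shows "set_integrable lborel {0<..} (\<lambda>x. exp (- c * x))" "(LBINT x:{0<..}. exp (- c * x)) = 1 / c"
    and "set_integrable lborel {0<..} (\<lambda>x. x * exp (- c * x))" "(LBINT x:{0<..}. x * exp (- c * x)) = 1 / c\<^sup>2"
proof -
  have cx: "filterlim (\<lambda>x. c * x) at_top at_top"
    using c by (intro filterlim_tendsto_pos_mult_at_top[OF tendsto_const] filterlim_ident)
  have e: "((\<lambda>x. exp (- c * x)) \<longlongrightarrow> 0) at_top"
    using filterlim_compose[OF tendsto_power_div_exp_0[of 0] cx] by (simp add: exp_minus divide_inverse)
  have xe: "((\<lambda>x. x * exp (- c * x)) \<longlongrightarrow> 0) at_top"
  proof -
    have "((\<lambda>x. 1 / c * ((c * x) ^ 1 / exp (c * x))) \<longlongrightarrow> 1 / c * 0) at_top"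
      by (intro tendsto_mult_left filterlim_compose[OF tendsto_power_div_exp_0 cx])
    moreover have "1 / c * ((c * x) ^ 1 / exp (c * x)) = x * exp (- c * x)" for x
      using c by (simp add: exp_minus field_simps)
    ultimately show ?thesis by simp
  qed
  have "((\<lambda>x. - exp (- c * x) / c) has_real_derivative exp (- c * x)) (at x)" for x
    using c by (auto intro!: derivative_eq_intros)
  moreover have "isCont (\<lambda>x. exp (- c * x)) x" for x by (intro continuous_intros)
  moreover have "((\<lambda>x. - exp (- c * x) / c) \<longlongrightarrow> - exp (- c * 0) / c) (at_right 0)"
    using c by (intro tendsto_intros) auto
  moreover have "((\<lambda>x. - exp (- c * x) / c) \<longlongrightarrow> - 0 / c) at_top"
    using c by (intro tendsto_intros e) auto
  ultimately show "set_integrable lborel {0<..} (\<lambda>x. exp (- c * x))" "(LBINT x:{0<..}. exp (- c * x)) = 1 / c"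
    using FTC_Ioi_nonneg[of "\<lambda>x. - exp (- c * x) / c" "\<lambda>x. exp (- c * x)" "- exp (- c * 0) / c" "- 0 / c"]
    by auto
  let ?F = "\<lambda>x. - (x * exp (- c * x)) / c - exp (- c * x) / c\<^sup>2"
  have "(?F has_real_derivative x * exp (- c * x)) (at x)" for x
    using c by (auto intro!: derivative_eq_intros simp: field_simps power2_eq_square)
  moreover have "isCont (\<lambda>x. x * exp (- c * x)) x" for x by (intro continuous_intros)
  moreover have "(?F \<longlongrightarrow> - (0 * exp (- c * 0)) / c - exp (- c * 0) / c\<^sup>2) (at_right 0)"
    using c by (intro tendsto_intros) auto
  moreover have "(?F \<longlongrightarrow> - 0 / c - 0 / c\<^sup>2) at_top"
    using c by (intro tendsto_intros e xe) auto
  ultimately show "set_integrable lborel {0<..} (\<lambda>x. x * exp (- c * x))" "(LBINT x:{0<..}. x * exp (- c * x)) = 1 / c\<^sup>2"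
    using FTC_Ioi_nonneg[of ?F "\<lambda>x. x * exp (- c * x)" "- (0 * exp (- c * 0)) / c - exp (- c * 0) / c\<^sup>2" "- 0 / c - 0 / c\<^sup>2"]
    by auto
qed

lemma laplace_dcdf:
  assumes s: "s > 0" and l: "l > 0"
  shows "integrable lborel (\<lambda>t. exp (- l * t) * dcdf s t)"
    and "l * (\<integral>t. exp (- l * t) * dcdf s t \<partial>lborel) = dickman_lt s l"
proof -
  let ?g = "\<lambda>t. exp (- l * t) * dcdf s t"
  have g0: "(\<lambda>t. indicator {0<..} t *\<^sub>R ?g t) = ?g"
    using s by (auto simp: fun_eq_iff indicator_def dcdf_nonpos)
  show int: "integrable lborel ?g"
  proof (rule Bochner_Integration.integrable_bound)
    show "integrable lborel (\<lambda>t. indicator {0<..} t *\<^sub>R exp (- l * t))"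
      using LBINT_exp(1)[OF l] by (simp add: set_integrable_def)
    show "AE t in lborel. norm (?g t) \<le> norm (indicator {0<..} t *\<^sub>R exp (- l * t))"
      using s dcdf_nonneg[OF s] dcdf_le_1[OF s]
      by (intro AE_I2) (auto simp: indicator_def dcdf_nonpos abs_mult)
  qed (use s in measurable)
  have f0: "(\<lambda>t. indicator {0<..} t *\<^sub>R (exp (- l * t) * dpdf s t)) = (\<lambda>t. exp (- l * t) * dpdf s t)"
    by (auto simp: fun_eq_iff indicator_def dpdf_def)
  have i: "set_integrable lborel {0<..} (\<lambda>t. l * ?g t)"
      "set_integrable lborel {0<..} (\<lambda>t. exp (- l * t) * dpdf s t)"
    using int integrable_exp_dpdf[OF s, of l] l g0 f0 unfolding set_integrable_def
    by (auto simp del: scaleR_conv_of_real simp: mult.left_commute[of _ l])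
  have "(LBINT t:{0<..}. l * ?g t - exp (- l * t) * dpdf s t) = 0 - - (exp (- l * 0) * dcdf s 0)"
  proof (rule FTC_Ioi_integrable)
    show "((\<lambda>t. - (exp (- l * t) * dcdf s t)) has_real_derivative l * ?g t - exp (- l * t) * dpdf s t) (at t)"
      if "t > 0" for t
      using that s by (auto intro!: derivative_eq_intros dcdf_deriv simp: algebra_simps)
    show "isCont (\<lambda>t. l * ?g t - exp (- l * t) * dpdf s t) t" if "t > 0" for t
      using that s by (intro continuous_intros isCont_dcdf isCont_dpdf)
    show "set_integrable lborel {0<..} (\<lambda>t. l * ?g t - exp (- l * t) * dpdf s t)"
      using i by (rule set_integral_diff(1))
    have "isCont (\<lambda>t. - ?g t) 0" by (intro continuous_intros isCont_dcdf s)
    then show "((\<lambda>t. - ?g t) \<longlongrightarrow> - (exp (- l * 0) * dcdf s 0)) (at_right 0)"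
      by (simp add: isCont_def filterlim_at_split)
    have "((\<lambda>x. exp (- l * x)) \<longlongrightarrow> 0) at_top"
      using filterlim_compose[OF tendsto_power_div_exp_0[of 0], of "\<lambda>x. l * x"] l
      by (simp add: exp_minus divide_inverse filterlim_tendsto_pos_mult_at_top[OF tendsto_const _ filterlim_ident])
    from tendsto_minus[OF tendsto_mult[OF this dcdf_tendsto_1[OF s]]]
    show "((\<lambda>t. - ?g t) \<longlongrightarrow> 0) at_top" by simp
  qed
  also have "(LBINT t:{0<..}. l * ?g t - exp (- l * t) * dpdf s t) =
      (LBINT t:{0<..}. l * ?g t) - (LBINT t:{0<..}. exp (- l * t) * dpdf s t)"
    using i by (rule set_integral_diff(2))
  also have "(LBINT t:{0<..}. exp (- l * t) * dpdf s t) = dickman_lt s l"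
    unfolding set_lebesgue_integral_def f0 dickman_lt_def ..
  also have "(LBINT t:{0<..}. l * ?g t) = l * (\<integral>t. ?g t \<partial>lborel)"
    unfolding set_integral_mult_right set_lebesgue_integral_def g0 ..
  finally show "l * (\<integral>t. ?g t \<partial>lborel) = dickman_lt s l" using s by (simp add: dcdf_nonpos)
qed

definition dickman_moment :: "real \<Rightarrow> real \<Rightarrow> real" where
  "dickman_moment s l = (\<integral>t. (t * exp (- l * t)) * dpdf s t \<partial>lborel)"

lemma integrable_dickman_moment:
  assumes "s > 0" "l > 0" shows "integrable lborel (\<lambda>t. (t * exp (- l * t)) * dpdf s t)"
proof (rule integrable_mult_dpdf[where B = "1 / l"])
  fix t :: real assume t: "t > 0"
  have "l * t \<le> exp (l * t)" using exp_ge_add_one_self[of "l * t"] by linarith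
  then have "t * exp (- l * t) \<le> 1 / l"
    using assms by (simp add: exp_minus field_simps)
  then show "\<bar>t * exp (- l * t)\<bar> \<le> 1 / l" using t by simp
qed (use assms in auto)

lemma dickman_moment_eq:
  assumes s: "s > 0" and l: "l > 0"
  shows "dickman_moment s l = s * ((1 - exp (- l)) / l) * dickman_lt s l"
proof -
  let ?g = "\<lambda>t. exp (- l * t) * dcdf s t"
  have int: "integrable lborel ?g" by (rule laplace_dcdf[OF s l])
  have shift: "exp (- l * (1 + 1 * x)) * dcdf s (1 + 1 * x - 1) = exp (- l) * ?g x" for x
    by (simp add: algebra_simps flip: exp_add)
  have i1: "integrable lborel (\<lambda>t. exp (- l * t) * dcdf s (t - 1))"
    using lborel_integrable_real_affine_iff[of 1 "\<lambda>t. exp (- l * t) * dcdf s (t - 1)" 1] int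
    unfolding shift by simp
  have e1: "(\<integral>t. exp (- l * t) * dcdf s (t - 1) \<partial>lborel) = exp (- l) * (\<integral>t. ?g t \<partial>lborel)"
    using lborel_integral_real_affine[of 1 "\<lambda>t. exp (- l * t) * dcdf s (t - 1)" 1]
    unfolding shift by simp
  have "dickman_moment s l = (\<integral>t. s * (?g t - exp (- l * t) * dcdf s (t - 1)) \<partial>lborel)"
    unfolding dickman_moment_def
  proof (intro Bochner_Integration.integral_cong refl)
    fix t show "t * exp (- l * t) * dpdf s t = s * (?g t - exp (- l * t) * dcdf s (t - 1))"
    proof (cases "t > 0")
      case True
      have "t * exp (- l * t) * dpdf s t = exp (- l * t) * (t * dpdf s t)" by simp
      also have "\<dots> = exp (- l * t) * (s * (dcdf s t - dcdf s (t - 1)))" by (simp only: mult_dpdf[OF True])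
      finally show ?thesis by (simp add: algebra_simps)
    qed (use s in \<open>simp add: dcdf_nonpos\<close>)
  qed
  also have "\<dots> = s * ((\<integral>t. ?g t \<partial>lborel) - exp (- l) * (\<integral>t. ?g t \<partial>lborel))"
    using int i1 e1 by simp
  also have "\<dots> = s * (1 - exp (- l)) * (\<integral>t. ?g t \<partial>lborel)"
    by (simp add: algebra_simps)
  also have "(\<integral>t. ?g t \<partial>lborel) = dickman_lt s l / l"
    using laplace_dcdf(2)[OF s l] l by (simp add: field_simps)
  finally show ?thesis by simp
qed

text \<open>Convexity in \<open>l\<close> replaces differentiation under the integral sign.\<close>

lemma dickman_lt_subgradient:
  assumes s: "s > 0" and x: "x > 0" and y: "y > 0"
  shows "dickman_lt s y \<ge> dickman_lt s x - (y - x) * dickman_moment s x"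
proof -
  have "dickman_lt s x - (y - x) * dickman_moment s x =
      (\<integral>t. exp (- x * t) * dpdf s t - (y - x) * ((t * exp (- x * t)) * dpdf s t) \<partial>lborel)"
    using integrable_exp_dpdf[OF s, of x] integrable_dickman_moment[OF s x] x by (simp add: dickman_lt_def dickman_moment_def)
  also have "\<dots> \<le> dickman_lt s y"
    unfolding dickman_lt_def
  proof (intro integral_mono Bochner_Integration.integrable_diff integrable_mult_right integrable_exp_dpdf integrable_dickman_moment)
    fix t
    have "exp (- x * t) * (1 - (y - x) * t) \<le> exp (- x * t) * exp (- (y - x) * t)"
    proof (rule mult_left_mono)
      show "1 - (y - x) * t \<le> exp (- (y - x) * t)" using exp_ge_add_one_self[of "- (y - x) * t"] by linarith
    qed simp
    also have "\<dots> = exp (- y * t)" by (simp add: algebra_simps flip: exp_add)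
    finally have "exp (- x * t) * (1 - (y - x) * t) * dpdf s t \<le> exp (- y * t) * dpdf s t"
      using dpdf_nonneg[OF s] by (intro mult_right_mono)
    then show "exp (- x * t) * dpdf s t - (y - x) * (t * exp (- x * t) * dpdf s t) \<le> exp (- y * t) * dpdf s t"
      by (simp add: algebra_simps)
  qed (use assms in auto)
  finally show ?thesis .
qed

lemma dickman_moment_bounds:
  assumes s: "s > 0" and l: "l > 0" shows "0 \<le> dickman_moment s l" "dickman_moment s l \<le> s"
proof -
  have k: "0 \<le> (1 - exp (- l)) / l" "(1 - exp (- l)) / l \<le> 1"
    using exp_quot_nonneg[of l] exp_quot_le_1[of l] l by (auto simp: exp_quot_def)
  show "0 \<le> dickman_moment s l" unfolding dickman_moment_eq[OF assms]
    using s k dickman_lt_nonneg[OF s] by (intro mult_nonneg_nonneg) auto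
  have "s * ((1 - exp (- l)) / l) * dickman_lt s l \<le> s * 1 * 1"
    using s l k dickman_lt_nonneg[OF s] dickman_lt_le_1[OF s] by (intro mult_mono mult_nonneg_nonneg) auto
  then show "dickman_moment s l \<le> s" unfolding dickman_moment_eq[OF assms] by simp
qed

lemma isCont_dickman_lt:
  assumes s: "s > 0" and x: "x > 0" shows "isCont (dickman_lt s) x"
proof -
  have lip: "\<bar>dickman_lt s y - dickman_lt s x\<bar> \<le> s * \<bar>y - x\<bar>" if y: "y > 0" for y
  proof -
    have 1: "\<bar>(y - x) * dickman_moment s x\<bar> \<le> s * \<bar>y - x\<bar>" "\<bar>(x - y) * dickman_moment s y\<bar> \<le> s * \<bar>y - x\<bar>"
      using dickman_moment_bounds[OF s x] dickman_moment_bounds[OF s y] s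
      by (auto simp: abs_mult mult.commute[of s] abs_minus_commute intro!: mult_left_mono)
    show ?thesis
      using dickman_lt_subgradient[OF s x y] dickman_lt_subgradient[OF s y x] 1 by linarith
  qed
  have "((\<lambda>y. s * \<bar>y - x\<bar>) \<longlongrightarrow> s * \<bar>x - x\<bar>) (at x)" by (intro tendsto_intros)
  then have 0: "((\<lambda>y. s * \<bar>y - x\<bar>) \<longlongrightarrow> 0) (at x)" by simp
  have "\<forall>\<^sub>F y in at x. y > 0" using x by (intro order_tendstoD(1)[OF tendsto_ident_at])
  then have "((\<lambda>y. dickman_lt s y - dickman_lt s x) \<longlongrightarrow> 0) (at x)"
    by (intro Lim_null_comparison[OF _ 0]) (auto elim!: eventually_mono intro!: lip)
  then show ?thesis unfolding isCont_def by (simp add: LIM_zero_iff)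
qed

lemma dickman_lt_deriv:
  assumes s: "s > 0" and x: "x > 0" shows "(dickman_lt s has_real_derivative - dickman_moment s x) (at x)"
  unfolding has_field_derivative_iff
proof -
  have pos: "\<forall>\<^sub>F y in at x. y > 0" using x by (intro order_tendstoD(1)[OF tendsto_ident_at])
  have "isCont (\<lambda>l. s * ((1 - exp (- l)) / l) * dickman_lt s l) x"
    using x by (intro continuous_intros isCont_dickman_lt s) auto
  then have "((\<lambda>l. s * ((1 - exp (- l)) / l) * dickman_lt s l) \<longlongrightarrow> dickman_moment s x) (at x)"
    unfolding isCont_def dickman_moment_eq[OF s x] .
  then have "(dickman_moment s \<longlongrightarrow> dickman_moment s x) (at x)"
    by (rule Lim_transform_eventually) (use pos in \<open>auto elim!: eventually_mono simp: dickman_moment_eq s\<close>)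
  then have 0: "((\<lambda>y. \<bar>dickman_moment s y - dickman_moment s x\<bar>) \<longlongrightarrow> 0) (at x)"
    by (intro tendsto_rabs_zero) (simp add: LIM_zero_iff)
  have "((\<lambda>y. (dickman_lt s y - dickman_lt s x) / (y - x) - - dickman_moment s x) \<longlongrightarrow> 0) (at x)"
  proof (rule Lim_null_comparison[OF _ 0])
    have "\<forall>\<^sub>F y in at x. y \<noteq> x" by (simp add: eventually_at_filter)
    with pos show "\<forall>\<^sub>F y in at x. norm ((dickman_lt s y - dickman_lt s x) / (y - x) - - dickman_moment s x) \<le> \<bar>dickman_moment s y - dickman_moment s x\<bar>"
    proof eventually_elim
      case (elim y)
      have 1: "(y - x) * (- dickman_moment s x) \<le> dickman_lt s y - dickman_lt s x"
        using dickman_lt_subgradient[OF s x elim(1)] by simp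
      have 2: "dickman_lt s y - dickman_lt s x \<le> (y - x) * (- dickman_moment s y)"
        using dickman_lt_subgradient[OF s elim(1) x] by (simp add: algebra_simps)
      show ?case
      proof (cases "y > x")
        case True
        then have "- dickman_moment s x \<le> (dickman_lt s y - dickman_lt s x) / (y - x)" "(dickman_lt s y - dickman_lt s x) / (y - x) \<le> - dickman_moment s y"
          using 1 2 by (simp_all only: pos_le_divide_eq pos_divide_le_eq diff_gt_0_iff_gt mult.commute)
        then show ?thesis unfolding real_norm_def by linarith
      next
        case False
        then have "y - x < 0" using elim by simp
        then have "(dickman_lt s y - dickman_lt s x) / (y - x) \<le> - dickman_moment s x" "- dickman_moment s y \<le> (dickman_lt s y - dickman_lt s x) / (y - x)"
          using 1 2 by (simp_all only: neg_le_divide_eq neg_divide_le_eq mult.commute)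
        then show ?thesis unfolding real_norm_def by linarith
      qed
    qed
  qed
  then show "((\<lambda>y. (dickman_lt s y - dickman_lt s x) / (y - x)) \<longlongrightarrow> - dickman_moment s x) (at x)"
    by (simp only: LIM_zero_iff)
qed

lemma dickman_lt_eq:
  assumes s: "s > 0" and l: "l \<ge> 0"
  shows "dickman_lt s l = exp (- s * dickman_psi l)"
proof -
  have zero: "dickman_lt s 0 = 1" using dpdf_integral[OF s] by (simp add: dickman_lt_def)
  define E where "E = (\<lambda>x. dickman_lt s x * exp (s * dickman_psi x))"
  have "(E has_real_derivative 0) (at x within {0<..})" if "x \<in> {0<..}" for x
  proof -
    have x: "x > 0" using that by simp
    have "(E has_real_derivative - dickman_moment s x * exp (s * dickman_psi x)
        + exp (s * dickman_psi x) * (s * ((1 - exp (- x)) / x)) * dickman_lt s x) (at x)"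
      unfolding E_def
      by (intro DERIV_mult dickman_lt_deriv s x DERIV_fun_exp DERIV_cmult dickman_psi_deriv)
    also have "- dickman_moment s x * exp (s * dickman_psi x)
        + exp (s * dickman_psi x) * (s * ((1 - exp (- x)) / x)) * dickman_lt s x = 0"
      by (simp add: dickman_moment_eq[OF s x])
    finally show ?thesis by (rule has_field_derivative_at_within)
  qed
  then obtain c where c: "\<And>x. x > 0 \<Longrightarrow> E x = c"
    using has_field_derivative_zero_constant[of "{0<..}" E] by auto
  have "(\<lambda>n. dickman_lt s (1 / real (Suc n))) \<longlonglongrightarrow> (\<integral>t. dpdf s t \<partial>lborel)"
    unfolding dickman_lt_def
  proof (rule integral_dominated_convergence)
    show "integrable lborel (dpdf s)" by (rule dpdf_integral[OF s])
    show "AE t in lborel. (\<lambda>n. exp (- (1 / real (Suc n)) * t) * dpdf s t) \<longlonglongrightarrow> dpdf s t"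
    proof (rule AE_I2)
      fix t
      have "(\<lambda>n. exp (- (1 / real (Suc n)) * t) * dpdf s t) \<longlonglongrightarrow> exp (- 0 * t) * dpdf s t"
        using LIMSEQ_inverse_real_of_nat by (intro tendsto_intros) (simp add: inverse_eq_divide)
      then show "(\<lambda>n. exp (- (1 / real (Suc n)) * t) * dpdf s t) \<longlonglongrightarrow> dpdf s t" by simp
    qed
    show "AE t in lborel. norm (exp (- (1 / real (Suc n)) * t) * dpdf s t) \<le> dpdf s t" for n
    proof (rule AE_I2)
      fix t show "norm (exp (- (1 / real (Suc n)) * t) * dpdf s t) \<le> dpdf s t"
        using dpdf_nonneg[OF s, of t] by (cases "t > 0") (auto simp: abs_mult intro!: mult_left_le_one_le)
    qed
  qed (use s in measurable)
  then have "(\<lambda>n. dickman_lt s (1 / real (Suc n)) * exp (s * dickman_psi (1 / real (Suc n)))) \<longlonglongrightarrow> 1 * exp (s * 0)"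
    using dpdf_integral(2)[OF s] by (intro tendsto_intros dickman_psi_tendsto_0) simp
  then have "(\<lambda>n. E (1 / real (Suc n))) \<longlonglongrightarrow> 1" by (simp add: E_def)
  moreover have "(\<lambda>n. E (1 / real (Suc n))) = (\<lambda>n. c)" using c by simp
  ultimately have "c = 1" by (simp add: LIMSEQ_const_iff)
  show ?thesis
  proof (cases "l = 0")
    case False
    then have "dickman_lt s l * exp (s * dickman_psi l) = 1"
      using c[of l] l \<open>c = 1\<close> by (simp add: E_def)
    then show ?thesis by (simp add: exp_minus field_simps)
  qed (simp add: zero dickman_psi_0)
qed

lemma dickman_density_eq:
  assumes s: "s > 0" shows "dickman_density s = dpdf s"
proof -
  have d: "is_dickman_density s (dpdf s)"
    unfolding is_dickman_density_def
  proof (intro conjI allI impI)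
    fix l :: real assume "l \<ge> 0"
    from dickman_lt_eq[OF s this]
    show "(\<integral>t. exp (- l * t) * dpdf s t \<partial>lborel) = exp (- s * (LBINT u:{0<..<1}. (1 - exp (- l * u)) / u))"
      by (simp only: dickman_lt_def dickman_psi_def)
  qed (simp_all add: dpdf_nonneg[OF s] continuous_on_dpdf[OF s] dpdf_integral(1)[OF s])
  then have "is_dickman_density s (dickman_density s)"
    unfolding dickman_density_def by (rule someI[where P = "is_dickman_density s"])
  then show ?thesis using d by (rule dickman_density_unique)
qed

lemma integrable_sexp:
  fixes w :: "real \<Rightarrow> real"
  assumes [measurable]: "w \<in> borel_measurable borel"
    and w: "\<And>s. s > 0 \<Longrightarrow> \<bar>w s\<bar> \<le> B * exp (- c * s)" and c: "c > \<theta>"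
  shows "set_integrable lborel {0<..} (\<lambda>s. s * exp (\<theta> * s) * w s)"
  unfolding set_integrable_def
proof (rule Bochner_Integration.integrable_bound)
  show "integrable lborel (\<lambda>s. B * (indicator {0<..} s *\<^sub>R (s * exp (- (c - \<theta>) * s))))"
    using LBINT_exp(3)[of "c - \<theta>"] c unfolding set_integrable_def by (intro integrable_mult_right) simp
  show "AE s in lborel. norm (indicator {0<..} s *\<^sub>R (s * exp (\<theta> * s) * w s))
      \<le> norm (B * (indicator {0<..} s *\<^sub>R (s * exp (- (c - \<theta>) * s))))"
  proof (rule AE_I2)
    fix s :: real
    show "norm (indicator {0<..} s *\<^sub>R (s * exp (\<theta> * s) * w s))
      \<le> norm (B * (indicator {0<..} s *\<^sub>R (s * exp (- (c - \<theta>) * s))))"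
    proof (cases "s > 0")
      case True
      have B: "B \<ge> 0" using order_trans[OF abs_ge_zero w[OF True]] by (simp add: zero_le_mult_iff)
      have "s * exp (\<theta> * s) * \<bar>w s\<bar> \<le> s * exp (\<theta> * s) * (B * exp (- c * s))"
        using True w[OF True] by (intro mult_left_mono) auto
      also have "\<dots> = B * (s * (exp (\<theta> * s) * exp (- c * s)))" by simp
      also have "exp (\<theta> * s) * exp (- c * s) = exp (- (c - \<theta>) * s)"
        by (simp add: algebra_simps flip: exp_add)
      finally show ?thesis using True B by (simp add: abs_mult)
    qed simp
  qed
qed measurable

lemma dcdf_chernoff:
  assumes s: "s > 0" and l: "l \<ge> 0"
  shows "dcdf s t \<le> exp (l * t) * exp (- dickman_psi l * s)"
proof -
  have "dcdf s t = (\<integral>u. indicator {..t} u * dpdf s u \<partial>lborel)"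
    using dpdf_integral(3)[OF s] by simp
  also have "\<dots> \<le> (\<integral>u. exp (l * t) * (exp (- l * u) * dpdf s u) \<partial>lborel)"
  proof (rule integral_mono)
    show "integrable lborel (\<lambda>u. indicator {..t} u * dpdf s u)"
      using s by (intro integrable_mult_dpdf[where B = 1]) (auto simp: indicator_def)
    show "integrable lborel (\<lambda>u. exp (l * t) * (exp (- l * u) * dpdf s u))"
      by (intro integrable_mult_right integrable_exp_dpdf s l)
    fix u
    have "indicator {..t} u \<le> exp (l * t) * exp (- l * u)"
    proof (cases "u \<le> t")
      case True
      then have "l * u \<le> l * t" using l by (intro mult_left_mono)
      then show ?thesis using True by (simp flip: exp_add)
    qed simp
    then have "indicator {..t} u * dpdf s u \<le> exp (l * t) * exp (- l * u) * dpdf s u"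
      using dpdf_nonneg[OF s] by (intro mult_right_mono)
    then show "indicator {..t} u * dpdf s u \<le> exp (l * t) * (exp (- l * u) * dpdf s u)"
      by (simp add: mult.assoc)
  qed
  also have "\<dots> = exp (l * t) * dickman_lt s l" by (simp add: dickman_lt_def)
  finally show ?thesis using dickman_lt_eq[OF s l] by (simp add: mult.commute)
qed

section \<open>The limit measure\<close>

text \<open>The distribution function of the measure with density \<open>\<integral>s. s exp (\<theta> s) f\<^sub>s(t)\<close>, which is \<open>G\<^sub>\<theta> * G\<^sub>\<theta>\<close>.\<close>

definition tilt_cdf :: "real \<Rightarrow> real \<Rightarrow> real" where
  "tilt_cdf \<theta> t = (LBINT s:{0<..}. s * exp (\<theta> * s) * dcdf s t)"

lemma tilt_cdf_integrable: "set_integrable lborel {0<..} (\<lambda>s. s * exp (\<theta> * s) * dcdf s t)"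
proof -
  obtain l where l: "l > 0" "dickman_psi l > \<theta>" using dickman_psi_large by blast
  show ?thesis
    using dcdf_chernoff[of _ l t] dcdf_nonneg l
    by (intro integrable_sexp[where B = "exp (l * t)" and c = "dickman_psi l"]) auto
qed

lemma tilt_cdf_nonpos: "t \<le> 0 \<Longrightarrow> tilt_cdf \<theta> t = 0"
proof -
  assume t: "t \<le> 0"
  have "tilt_cdf \<theta> t = (LBINT s:({0<..} :: real set). (0::real))"
    unfolding tilt_cdf_def using t by (intro set_lebesgue_integral_cong) (auto simp: dcdf_nonpos)
  then show ?thesis by simp
qed

lemma tilt_cdf_mono: "x \<le> y \<Longrightarrow> tilt_cdf \<theta> x \<le> tilt_cdf \<theta> y"
  unfolding tilt_cdf_def
  by (intro set_integral_mono tilt_cdf_integrable mult_left_mono dcdf_mono) auto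

lemma LBINT_Ioi_pos:
  assumes i: "set_integrable lborel {0<..} f" and pos: "\<And>s::real. s > 0 \<Longrightarrow> f s > (0::real)"
  shows "(LBINT s:{0<..}. f s) > 0"
proof -
  let ?g = "\<lambda>s. indicator {0<..} s *\<^sub>R f s"
  have nn: "AE s in lborel. ?g s \<ge> 0" using pos by (intro AE_I2) (auto simp: indicator_def less_imp_le)
  have "(\<integral>s. ?g s \<partial>lborel) \<noteq> 0"
  proof
    assume "(\<integral>s. ?g s \<partial>lborel) = 0"
    then have "AE s in lborel. ?g s = 0"
      using integral_nonneg_eq_0_iff_AE[OF i[unfolded set_integrable_def] nn] by simp
    then have "AE s in lborel. s \<notin> {0<..<1::real}"
    proof eventually_elim
      case (elim s)
      then show ?case using pos[of s] by (cases "s > 0") auto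
    qed
    then have "{0<..<1::real} \<in> null_sets lborel" by (subst AE_iff_null_sets) auto
    then have "emeasure lborel {0<..<1::real} = 0" by auto
    then show False by simp
  qed
  moreover have "(\<integral>s. ?g s \<partial>lborel) \<ge> 0" by (rule integral_nonneg_AE[OF nn])
  ultimately show ?thesis unfolding set_lebesgue_integral_def by linarith
qed

lemma tilt_cdf_diff:
  "set_integrable lborel {0<..} (\<lambda>s. s * exp (\<theta> * s) * (dcdf s x - dcdf s y))"
  "tilt_cdf \<theta> x - tilt_cdf \<theta> y = (LBINT s:{0<..}. s * exp (\<theta> * s) * (dcdf s x - dcdf s y))"
  using set_integral_diff[OF tilt_cdf_integrable[of \<theta> x] tilt_cdf_integrable[of \<theta> y]]
  by (simp_all add: tilt_cdf_def right_diff_distrib)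

lemma tilt_cdf_diff_pos: "t > 0 \<Longrightarrow> tilt_cdf \<theta> t - tilt_cdf \<theta> (t - 1) > 0"
  unfolding tilt_cdf_diff(2) by (intro LBINT_Ioi_pos tilt_cdf_diff(1) mult_pos_pos dcdf_diff_pos) auto

lemma G_eq:
  assumes "t > 0" shows "t * G \<theta> t = tilt_cdf \<theta> t - tilt_cdf \<theta> (t - 1)"
proof -
  have "t * G \<theta> t = (LBINT s:{0<..}. t * (exp (\<theta> * s) * dickman_density s t))"
    unfolding G_def by simp
  also have "\<dots> = (LBINT s:{0<..}. s * exp (\<theta> * s) * (dcdf s t - dcdf s (t - 1)))"
  proof (rule set_lebesgue_integral_cong)
    show "\<forall>s. s \<in> {0<..} \<longrightarrow> t * (exp (\<theta> * s) * dickman_density s t) = s * exp (\<theta> * s) * (dcdf s t - dcdf s (t - 1))"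
    proof (intro allI impI)
      fix s :: real assume "s \<in> {0<..}"
      then have "t * (exp (\<theta> * s) * dickman_density s t) = exp (\<theta> * s) * (t * dpdf s t)"
        by (simp add: dickman_density_eq)
      then show "t * (exp (\<theta> * s) * dickman_density s t) = s * exp (\<theta> * s) * (dcdf s t - dcdf s (t - 1))"
        by (simp add: mult_dpdf[OF assms])
    qed
  qed simp
  finally show ?thesis by (simp add: tilt_cdf_diff(2))
qed

lemma G_pos: "t > 0 \<Longrightarrow> G \<theta> t > 0"
  using G_eq[of t \<theta>] tilt_cdf_diff_pos[of t \<theta>] by (metis zero_less_mult_pos)

lemma isCont_tilt_cdf: "isCont (tilt_cdf \<theta>) t"
  unfolding continuous_at_sequentially
proof (intro allI impI)
  fix X :: "nat \<Rightarrow> real" assume X: "X \<longlonglongrightarrow> t"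
  then have "Bseq X" by (simp add: convergent_imp_Bseq convergentI)
  then obtain K where K: "\<And>n. \<bar>X n\<bar> \<le> K" by (auto simp: Bseq_def)
  have "(\<lambda>n. \<integral>s. indicator {0<..} s *\<^sub>R (s * exp (\<theta> * s) * dcdf s (X n)) \<partial>lborel) \<longlonglongrightarrow>
      (\<integral>s. indicator {0<..} s *\<^sub>R (s * exp (\<theta> * s) * dcdf s t) \<partial>lborel)"
  proof (rule integral_dominated_convergence)
    show "integrable lborel (\<lambda>s. indicator {0<..} s *\<^sub>R (s * exp (\<theta> * s) * dcdf s K))"
      using tilt_cdf_integrable unfolding set_integrable_def .
    show "AE s in lborel. (\<lambda>n. indicator {0<..} s *\<^sub>R (s * exp (\<theta> * s) * dcdf s (X n))) \<longlonglongrightarrow>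
        indicator {0<..} s *\<^sub>R (s * exp (\<theta> * s) * dcdf s t)"
    proof (rule AE_I2)
      fix s :: real
      show "(\<lambda>n. indicator {0<..} s *\<^sub>R (s * exp (\<theta> * s) * dcdf s (X n))) \<longlonglongrightarrow>
        indicator {0<..} s *\<^sub>R (s * exp (\<theta> * s) * dcdf s t)"
        by (cases "s > 0") (auto intro!: tendsto_intros isCont_tendsto_compose[OF isCont_dcdf X])
    qed
    show "AE s in lborel. norm (indicator {0<..} s *\<^sub>R (s * exp (\<theta> * s) * dcdf s (X n)))
        \<le> indicator {0<..} s *\<^sub>R (s * exp (\<theta> * s) * dcdf s K)" for n
      using K[of n] dcdf_nonneg
      by (intro AE_I2) (auto simp: indicator_def abs_mult intro!: mult_left_mono dcdf_mono)
  qed measurable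
  then show "(tilt_cdf \<theta> \<circ> X) \<longlonglongrightarrow> tilt_cdf \<theta> t" by (simp add: tilt_cdf_def set_lebesgue_integral_def o_def)
qed

lemma continuous_on_tilt_cdf: "continuous_on A h \<Longrightarrow> continuous_on A (\<lambda>x. tilt_cdf \<theta> (h x))"
  by (rule continuous_on_compose2[of UNIV]) (auto simp: continuous_on_eq_continuous_at isCont_tilt_cdf)

definition lap_fun :: "real \<Rightarrow> (real \<Rightarrow> real) \<Rightarrow> real \<Rightarrow> real" where
  "lap_fun l h s = (\<integral>u. (exp (- l * u) * h (exp (- u))) * dpdf s u \<partial>lborel)"

definition tilt_fun :: "real \<Rightarrow> real \<Rightarrow> (real \<Rightarrow> real) \<Rightarrow> real" where
  "tilt_fun \<theta> l h = (LBINT s:{0<..}. s * exp (\<theta> * s) * lap_fun l h s)"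

lemma lap_fun_integrable:
  assumes s: "s > 0" and l: "l \<ge> 0" and h: "continuous_on UNIV h"
  shows "integrable lborel (\<lambda>u. (exp (- l * u) * h (exp (- u))) * dpdf s u)"
proof -
  obtain B where B: "B \<ge> 0" "\<And>x. 0 \<le> x \<Longrightarrow> x \<le> 1 \<Longrightarrow> \<bar>h x\<bar> \<le> B"
    using continuous_bounded_01[OF h] by blast
  have [measurable]: "h \<in> borel_measurable borel" using h by (rule borel_measurable_continuous_onI)
  show ?thesis
  proof (rule integrable_mult_dpdf[OF s, where B = B])
    fix t :: real assume t: "t > 0"
    have "\<bar>exp (- l * t)\<bar> * \<bar>h (exp (- t))\<bar> \<le> 1 * B"
      using t l B by (intro mult_mono) auto
    then show "\<bar>exp (- l * t) * h (exp (- t))\<bar> \<le> B" by (simp add: abs_mult)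
  qed measurable
qed

lemma lap_fun_bound:
  assumes l: "l \<ge> 0" and h: "continuous_on UNIV h"
  obtains B where "\<And>s. s > 0 \<Longrightarrow> \<bar>lap_fun l h s\<bar> \<le> B * exp (- dickman_psi l * s)"
proof -
  obtain B where B: "B \<ge> 0" "\<And>x. 0 \<le> x \<Longrightarrow> x \<le> 1 \<Longrightarrow> \<bar>h x\<bar> \<le> B"
    using continuous_bounded_01[OF h] by blast
  have "\<bar>lap_fun l h s\<bar> \<le> B * exp (- dickman_psi l * s)" if s: "s > 0" for s
  proof -
    have "\<bar>lap_fun l h s\<bar> \<le> (\<integral>u. \<bar>(exp (- l * u) * h (exp (- u))) * dpdf s u\<bar> \<partial>lborel)"
      unfolding lap_fun_def by (rule integral_abs_bound)
    also have "\<dots> \<le> (\<integral>u. B * (exp (- l * u) * dpdf s u) \<partial>lborel)"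
    proof (intro integral_mono integrable_abs lap_fun_integrable s l h integrable_mult_right integrable_exp_dpdf)
      fix u
      show "\<bar>exp (- l * u) * h (exp (- u)) * dpdf s u\<bar> \<le> B * (exp (- l * u) * dpdf s u)"
      proof (cases "u > 0")
        case True
        have "\<bar>h (exp (- u))\<bar> * (exp (- l * u) * dpdf s u) \<le> B * (exp (- l * u) * dpdf s u)"
          using True dpdf_nonneg[OF s] B by (intro mult_right_mono) auto
        then show ?thesis using dpdf_nonneg[OF s] by (simp add: abs_mult mult_ac)
      qed simp
    qed
    also have "\<dots> = B * dickman_lt s l" by (simp add: dickman_lt_def)
    finally show ?thesis using dickman_lt_eq[OF s l] by (simp add: mult.commute)
  qed
  then show ?thesis using that by blast
qed

lemma tilt_fun_integrable:
  assumes l: "l \<ge> 0" "dickman_psi l > \<theta>" and h: "continuous_on UNIV h"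
  shows "set_integrable lborel {0<..} (\<lambda>s. s * exp (\<theta> * s) * lap_fun l h s)"
proof -
  have [measurable]: "h \<in> borel_measurable borel" using h by (rule borel_measurable_continuous_onI)
  obtain B where "\<And>s. s > 0 \<Longrightarrow> \<bar>lap_fun l h s\<bar> \<le> B * exp (- dickman_psi l * s)"
    using lap_fun_bound[OF l(1) h] by blast
  moreover have "lap_fun l h \<in> borel_measurable borel"
    unfolding lap_fun_def[abs_def] by measurable
  ultimately show ?thesis using l(2) by (intro integrable_sexp)
qed

lemma pos_functional_tilt_fun:
  assumes l: "l \<ge> 0" "dickman_psi l > \<theta>"
  shows "pos_functional (tilt_fun \<theta> l)"
  unfolding pos_functional_def
proof (intro conjI allI impI)
  fix f g :: "real \<Rightarrow> real" assume c: "continuous_on UNIV f" "continuous_on UNIV g"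
  have "tilt_fun \<theta> l (\<lambda>x. f x + g x) = (LBINT s:{0<..}. s * exp (\<theta> * s) * lap_fun l f s + s * exp (\<theta> * s) * lap_fun l g s)"
    unfolding tilt_fun_def
  proof (rule set_lebesgue_integral_cong)
    have "lap_fun l (\<lambda>x. f x + g x) s = lap_fun l f s + lap_fun l g s" if "s > 0" for s
      using lap_fun_integrable[OF that l(1) c(1)] lap_fun_integrable[OF that l(1) c(2)]
      by (simp add: lap_fun_def distrib_left distrib_right)
    then show "\<forall>s. s \<in> {0<..} \<longrightarrow> s * exp (\<theta> * s) * lap_fun l (\<lambda>x. f x + g x) s =
        s * exp (\<theta> * s) * lap_fun l f s + s * exp (\<theta> * s) * lap_fun l g s" by (auto simp: distrib_left)
  qed simp
  then show "tilt_fun \<theta> l (\<lambda>x. f x + g x) = tilt_fun \<theta> l f + tilt_fun \<theta> l g"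
    using set_integral_add(2)[OF tilt_fun_integrable[OF l c(1)] tilt_fun_integrable[OF l c(2)]] by (simp add: tilt_fun_def)
  assume le: "\<forall>x\<in>{0..1}. f x \<le> g x"
  have "lap_fun l f s \<le> lap_fun l g s" if s: "s > 0" for s
    unfolding lap_fun_def
  proof (intro integral_mono lap_fun_integrable s l c)
    fix u show "exp (- l * u) * f (exp (- u)) * dpdf s u \<le> exp (- l * u) * g (exp (- u)) * dpdf s u"
      using le dpdf_nonneg[OF s] by (cases "u > 0") (auto intro!: mult_right_mono mult_left_mono)
  qed
  then show "tilt_fun \<theta> l f \<le> tilt_fun \<theta> l g"
    unfolding tilt_fun_def by (intro set_integral_mono tilt_fun_integrable l c mult_left_mono) auto
next
  fix c :: real and f :: "real \<Rightarrow> real"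
  have "lap_fun l (\<lambda>x. c * f x) s = c * lap_fun l f s" for s
  proof -
    have "lap_fun l (\<lambda>x. c * f x) s = (\<integral>u. c * ((exp (- l * u) * f (exp (- u))) * dpdf s u) \<partial>lborel)"
      unfolding lap_fun_def by (rule Bochner_Integration.integral_cong) simp_all
    then show ?thesis by (simp add: lap_fun_def)
  qed
  then have "tilt_fun \<theta> l (\<lambda>x. c * f x) = (LBINT s:{0<..}. c * (s * exp (\<theta> * s) * lap_fun l f s))"
    unfolding tilt_fun_def by (intro set_lebesgue_integral_cong) simp_all
  then show "tilt_fun \<theta> l (\<lambda>x. c * f x) = c * tilt_fun \<theta> l f"
    by (simp add: tilt_fun_def)
qed

lemma tilt_fun_power:
  assumes l: "l \<ge> 0" "dickman_psi (l + real k) > \<theta>"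
  shows "tilt_fun \<theta> l (\<lambda>x. x ^ k) = 1 / (dickman_psi (l + real k) - \<theta>)\<^sup>2"
proof -
  have "tilt_fun \<theta> l (\<lambda>x. x ^ k) = (LBINT s:{0<..}. s * exp (- (dickman_psi (l + real k) - \<theta>) * s))"
    unfolding tilt_fun_def
  proof (rule set_lebesgue_integral_cong)
    have "lap_fun l (\<lambda>x. x ^ k) s = exp (- s * dickman_psi (l + real k))" if "s > 0" for s
    proof -
      have "lap_fun l (\<lambda>x. x ^ k) s = dickman_lt s (l + real k)"
        unfolding lap_fun_def dickman_lt_def
      proof (rule Bochner_Integration.integral_cong)
        fix u :: real
        have "exp (- u) ^ k = exp (- real k * u)" by (simp flip: exp_of_nat_mult)
        then have "exp (- l * u) * exp (- u) ^ k = exp (- (l + real k) * u)"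
          by (simp add: minus_add_distrib[symmetric] distrib_right del: minus_add_distrib flip: exp_add)
        then show "exp (- l * u) * exp (- u) ^ k * dpdf s u = exp (- (l + real k) * u) * dpdf s u" by simp
      qed simp
      then show ?thesis using dickman_lt_eq[OF that] l by simp
    qed
    then show "\<forall>s. s \<in> {0<..} \<longrightarrow> s * exp (\<theta> * s) * lap_fun l (\<lambda>x. x ^ k) s =
        s * exp (- (dickman_psi (l + real k) - \<theta>) * s)"
      by (simp add: left_diff_distrib mult.commute[of s] flip: exp_add)
  qed simp
  then show ?thesis using LBINT_exp(4)[of "dickman_psi (l + real k) - \<theta>"] l by simp
qed

lemma tilt_fun_sandwich:
  assumes l: "l \<ge> 0" "dickman_psi l > \<theta>" and h: "continuous_on UNIV h"
    and q: "\<And>u. exp (- l * u) * h (exp (- u)) = q u"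
  shows "(\<And>u. indicator {..t} u \<le> q u) \<Longrightarrow> tilt_cdf \<theta> t \<le> tilt_fun \<theta> l h"
    and "(\<And>u. q u \<le> indicator {..t} u) \<Longrightarrow> tilt_fun \<theta> l h \<le> tilt_cdf \<theta> t"
proof -
  have i: "integrable lborel (\<lambda>u. indicator {..t} u * dpdf s u)" if "s > 0" for s
    using that by (intro integrable_mult_dpdf[where B = 1]) (auto simp: indicator_def)
  have i2: "integrable lborel (\<lambda>u. q u * dpdf s u)" if "s > 0" for s
    using lap_fun_integrable[OF that l(1) h] unfolding q .
  have lap_fun: "lap_fun l h s = (\<integral>u. q u * dpdf s u \<partial>lborel)" for s unfolding lap_fun_def q ..
  show "tilt_cdf \<theta> t \<le> tilt_fun \<theta> l h" if *: "\<And>u. indicator {..t} u \<le> q u"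
    unfolding tilt_cdf_def tilt_fun_def
  proof (intro set_integral_mono tilt_cdf_integrable tilt_fun_integrable l h mult_left_mono)
    fix s :: real assume s: "s \<in> {0<..}"
    have "(\<integral>u. indicator {..t} u * dpdf s u \<partial>lborel) \<le> lap_fun l h s"
      unfolding lap_fun using s by (intro integral_mono i i2 mult_right_mono * dpdf_nonneg) auto
    then show "dcdf s t \<le> lap_fun l h s" using dpdf_integral(3)[of s t] s by simp
  qed auto
  show "tilt_fun \<theta> l h \<le> tilt_cdf \<theta> t" if *: "\<And>u. q u \<le> indicator {..t} u"
    unfolding tilt_cdf_def tilt_fun_def
  proof (intro set_integral_mono tilt_cdf_integrable tilt_fun_integrable l h mult_left_mono)
    fix s :: real assume s: "s \<in> {0<..}"
    have "lap_fun l h s \<le> (\<integral>u. indicator {..t} u * dpdf s u \<partial>lborel)"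
      unfolding lap_fun using s by (intro integral_mono i i2 mult_right_mono * dpdf_nonneg) auto
    then show "lap_fun l h s \<le> dcdf s t" using dpdf_integral(3)[of s t] s by simp
  qed auto
qed

section \<open>Asymptotics of the renewal sequence\<close>

lemma weighted_mean_null:
  fixes b w :: "nat \<Rightarrow> real"
  assumes b: "b \<longlonglongrightarrow> 0" and w: "\<And>m. w m \<ge> 0"
    and S: "filterlim (\<lambda>N. \<Sum>m=1..N. w m) at_top sequentially"
  shows "(\<lambda>N. (\<Sum>m=1..N. w m * \<bar>b m\<bar>) / (\<Sum>m=1..N. w m)) \<longlonglongrightarrow> 0"
proof (rule tendstoI)
  fix e :: real assume e: "e > 0"
  define S where "S = (\<lambda>N. \<Sum>m=1..N. w m)"
  have "\<forall>\<^sub>F m in sequentially. \<bar>b m\<bar> < e / 2"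
    using tendstoD[OF b, of "e / 2"] e by simp
  then obtain M where M: "\<And>m. m \<ge> M \<Longrightarrow> \<bar>b m\<bar> < e / 2"
    unfolding eventually_sequentially by blast
  define C where "C = (\<Sum>m=1..M. w m * \<bar>b m\<bar>)"
  have C: "C \<ge> 0" unfolding C_def using w by (intro sum_nonneg) auto
  have "\<forall>\<^sub>F N in sequentially. S N > 2 * C / e + 1"
    using S unfolding filterlim_at_top_dense S_def by blast
  then show "\<forall>\<^sub>F N in sequentially. dist ((\<Sum>m=1..N. w m * \<bar>b m\<bar>) / (\<Sum>m=1..N. w m)) 0 < e"
  proof eventually_elim
    case (elim N)
    have "2 * C / e \<ge> 0" using C e by simp
    then have SN: "S N > 0" using elim by linarith
    have "(\<Sum>m=1..N. w m * \<bar>b m\<bar>) \<le> (\<Sum>m=1..N. (if m \<le> M then w m * \<bar>b m\<bar> else 0) + w m * (e / 2))"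
    proof (rule sum_mono)
      fix m assume "m \<in> {1..N}"
      show "w m * \<bar>b m\<bar> \<le> (if m \<le> M then w m * \<bar>b m\<bar> else 0) + w m * (e / 2)"
        using w[of m] e M[of m] mult_left_mono[of "\<bar>b m\<bar>" "e / 2" "w m"] by (auto simp: less_imp_le)
    qed
    also have "\<dots> = (\<Sum>m=1..N. if m \<le> M then w m * \<bar>b m\<bar> else 0) + S N * (e / 2)"
      by (simp only: sum.distrib S_def sum_distrib_right)
    also have "(\<Sum>m=1..N. if m \<le> M then w m * \<bar>b m\<bar> else 0) = (\<Sum>m\<in>{1..N} \<inter> {m. m \<le> M}. w m * \<bar>b m\<bar>)"
      by (subst sum.inter_restrict) auto
    also have "\<dots> \<le> C" unfolding C_def using w by (intro sum_mono2) auto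
    finally have "(\<Sum>m=1..N. w m * \<bar>b m\<bar>) \<le> C + S N * (e / 2)" by simp
    also have "C < S N * (e / 2)"
    proof -
      have "2 * C / e < S N" using elim by simp
      then show ?thesis using e by (simp add: field_simps)
    qed
    finally have "(\<Sum>m=1..N. w m * \<bar>b m\<bar>) < e * S N" by simp
    moreover have "(\<Sum>m=1..N. w m * \<bar>b m\<bar>) \<ge> 0" using w by (intro sum_nonneg) auto
    ultimately have "dist ((\<Sum>m=1..N. w m * \<bar>b m\<bar>) / S N) 0 < e"
      using SN by (simp add: dist_real_def pos_divide_less_eq)
    then show ?case by (simp only: S_def)
  qed
qed

lemma riemann_sum_tendsto:
  fixes g :: "real \<Rightarrow> real"
  assumes g: "continuous_on {0..1} g"
  shows "(\<lambda>N. (\<Sum>m=1..N. g (real m / real N)) / real N) \<longlonglongrightarrow> integral {0..1} g"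
proof (rule tendstoI)
  fix e :: real assume e: "e > 0"
  have "uniformly_continuous_on {0..1} g" using g by (intro compact_uniformly_continuous) auto
  then obtain d where d: "d > 0" "\<And>x y. x \<in> {0..1} \<Longrightarrow> y \<in> {0..1} \<Longrightarrow> dist x y < d \<Longrightarrow> dist (g x) (g y) < e / 2"
    unfolding uniformly_continuous_on_def using e by (metis half_gt_zero)
  define K where "K = (\<lambda>x. integral {0..x} g)"
  have Kd: "(K has_real_derivative g x) (at x within {0..1})" if "x \<in> {0..1}" for x
    unfolding K_def using that g by (intro integral_has_real_derivative)
  have Kc: "continuous_on {0..1} K" using Kd by (intro DERIV_continuous_on)
  have "\<forall>\<^sub>F N in sequentially. real N > 1 / d"
    using filterlim_real_sequentially unfolding filterlim_at_top_dense by blast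
  then show "\<forall>\<^sub>F N in sequentially. dist ((\<Sum>m=1..N. g (real m / real N)) / real N) (integral {0..1} g) < e"
    using eventually_gt_at_top[of 0]
  proof eventually_elim
    case (elim N)
    have step: "\<bar>g (real m / real N) / real N - (K (real m / real N) - K (real (m - 1) / real N))\<bar> \<le> e / 2 / real N"
      if m: "m \<in> {1..N}" for m
    proof -
      define x where "x = real (m - 1) / real N"
      define y where "y = real m / real N"
      have xy: "0 \<le> x" "x < y" "y \<le> 1" "y - x = 1 / real N"
        using m elim by (auto simp: x_def y_def divide_simps of_nat_diff)
      have "\<exists>l z. x < z \<and> z < y \<and> (K has_real_derivative l) (at z) \<and> K y - K x = (y - x) * l"
      proof (rule MVT)
        show "continuous_on {x..y} K" using xy by (intro continuous_on_subset[OF Kc]) auto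
        show "K differentiable (at z)" if "x < z" "z < y" for z
        proof -
          have "(K has_real_derivative g z) (at z within {0..1})" using that xy by (intro Kd) auto
          then have "(K has_real_derivative g z) (at z)" using that xy by (simp add: at_within_Icc_at)
          then show ?thesis by (auto simp: real_differentiable_def)
        qed
      qed (use xy in auto)
      then obtain l z where z: "x < z" "z < y" "(K has_real_derivative l) (at z)" "K y - K x = (y - x) * l" by blast
      have "(K has_real_derivative g z) (at z within {0..1})" using z xy by (intro Kd) auto
      then have "(K has_real_derivative g z) (at z)" using z xy by (simp add: at_within_Icc_at)
      with z(3) have l: "l = g z" by (rule DERIV_unique)
      have "1 / real N < d" using elim d(1) by (simp add: field_simps)
      then have "dist y z < d" using z xy by (simp add: dist_real_def)
      then have "dist (g y) (g z) < e / 2" using z xy by (intro d) auto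
      moreover have "g y / real N - (K y - K x) = (g y - g z) / real N"
        unfolding z(4) l xy(4) by (simp add: diff_divide_distrib)
      ultimately have "\<bar>g y / real N - (K y - K x)\<bar> = \<bar>g y - g z\<bar> / real N" "\<bar>g y - g z\<bar> \<le> e / 2"
        by (auto simp: dist_real_def abs_divide)
      then have "\<bar>g y / real N - (K y - K x)\<bar> \<le> e / 2 / real N"
        by (simp only:) (rule divide_right_mono, simp_all)
      then show ?thesis by (simp add: x_def y_def)
    qed
    have tel: "(\<Sum>m=1..N. K (real m / real N) - K (real (m - 1) / real N)) = integral {0..1} g"
    proof -
      have "(\<Sum>m=1..n. K (real m / real N) - K (real (m - 1) / real N)) = K (real n / real N) - K 0" for n
        by (induction n) auto
      then show ?thesis using elim by (simp add: K_def)
    qed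
    have "\<bar>(\<Sum>m=1..N. g (real m / real N) / real N - (K (real m / real N) - K (real (m - 1) / real N)))\<bar>
        \<le> (\<Sum>m=1..N. \<bar>g (real m / real N) / real N - (K (real m / real N) - K (real (m - 1) / real N))\<bar>)"
      by (rule sum_abs)
    also have "\<dots> \<le> (\<Sum>m=1..N. e / 2 / real N)" by (intro sum_mono step)
    also have "\<dots> = e / 2" using elim by simp
    also have "\<dots> < e" using e by simp
    finally have "\<bar>(\<Sum>m=1..N. g (real m / real N) / real N) - integral {0..1} g\<bar> < e"
      unfolding sum_subtractf[of "\<lambda>m. g (real m / real N) / real N"] tel .
    then show ?case by (simp add: dist_real_def sum_divide_distrib)
  qed
qed

lemma sum_inverse_ge_ln:
  assumes "1 \<le> n" "n \<le> N"
  shows "(\<Sum>m=n..N. 1 / real m) \<ge> ln (real N / real n)"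
proof -
  have "(\<Sum>m=n..N. 1 / real m) \<ge> ln (real (Suc N)) - ln (real n)"
    using assms(2)
  proof (induction N rule: dec_induct)
    case base
    have "ln (real (Suc n)) - ln (real n) = ln (real (Suc n) / real n)"
      using assms by (subst ln_div) auto
    also have "real (Suc n) / real n = 1 + 1 / real n" using assms by (simp add: field_simps)
    also have "ln (1 + 1 / real n) \<le> 1 / real n" by (intro ln_add_one_self_le_self) simp
    finally show ?case by simp
  next
    case (step N)
    have "ln (real (Suc (Suc N))) - ln (real (Suc N)) = ln (real (Suc (Suc N)) / real (Suc N))"
      by (subst ln_div) auto
    also have "real (Suc (Suc N)) / real (Suc N) = 1 + 1 / real (Suc N)" by (simp add: field_simps)
    also have "ln (1 + 1 / real (Suc N)) \<le> 1 / real (Suc N)" by (intro ln_add_one_self_le_self) simp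
    finally show ?case using step by simp
  qed
  moreover have "ln (real N) \<le> ln (real (Suc N))" using assms by simp
  moreover have "ln (real N / real n) = ln (real N) - ln (real n)" using assms by (simp add: ln_div)
  ultimately show ?thesis by simp
qed

lemma ln_real_at_top: "filterlim (\<lambda>N. ln (real N)) at_top sequentially"
  by (rule filterlim_compose[OF ln_at_top filterlim_real_sequentially])

lemma harm_over_ln: "(\<lambda>N. harm N / ln (real N)) \<longlonglongrightarrow> (1::real)"
proof -
  have "(\<lambda>N. (harm N - ln (real N)) / ln (real N) + 1) \<longlonglongrightarrow> 0 + 1"
    by (intro tendsto_intros tendsto_divide_0[OF euler_mascheroni_LIMSEQ] filterlim_at_top_imp_at_infinity
        ln_real_at_top)
  moreover have "\<forall>\<^sub>F N in sequentially. (harm N - ln (real N)) / ln (real N) + 1 = harm N / ln (real N)"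
    using eventually_ge_at_top[of 2] by eventually_elim (simp add: diff_divide_distrib)
  ultimately show ?thesis by (auto elim: Lim_transform_eventually)
qed

lemma harm_sum_at_top: "filterlim (\<lambda>N. \<Sum>m=1..N. 1 / real m) at_top sequentially"
  using harm_at_top by (simp add: harm_def[abs_def] inverse_eq_divide)

locale dickman_renewal =
  fixes r :: "nat \<Rightarrow> real" and a \<theta> :: real and lam :: "nat \<Rightarrow> real"
  assumes r_pos: "\<And>n. n \<ge> 1 \<Longrightarrow> r n > 0"
    and a_pos: "a > 0"
    and r_asymp: "r \<sim>[at_top] (\<lambda>n. a / real n)"
    and lam_pos: "\<And>N. N \<ge> 2 \<Longrightarrow> lam N > 0"
    and lam_asymp: "\<exists>\<epsilon>::nat \<Rightarrow> real. \<epsilon> \<longlonglongrightarrow> 0 \<and>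
                      (\<forall>N\<ge>2. lam N = 1 + \<theta> / ln (real N) * (1 + \<epsilon> N))"
begin

definition err :: "nat \<Rightarrow> real" where "err m = real m * r m - a"

lemma err_tendsto: "err \<longlonglongrightarrow> 0"
proof -
  have "(\<lambda>n. r n / (a / real n)) \<longlonglongrightarrow> 1"
  proof (rule asymp_equivD_strong[OF r_asymp])
    show "\<forall>\<^sub>F n in sequentially. r n \<noteq> 0 \<or> a / real n \<noteq> 0"
      using eventually_gt_at_top[of 0] by eventually_elim (use a_pos in simp)
  qed
  then have "(\<lambda>n. a * (r n / (a / real n)) - a) \<longlonglongrightarrow> a * 1 - a" by (intro tendsto_intros)
  moreover have "a * (r n / (a / real n)) - a = err n" for n
    using a_pos by (simp add: err_def)
  ultimately show ?thesis by simp
qed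

lemma err_bounded: obtains B where "B > 0" "\<And>m. \<bar>err m\<bar> \<le> B"
proof -
  have "Bseq err" by (rule convergent_imp_Bseq[OF convergentI[OF err_tendsto]])
  then obtain B where "B > 0" "\<forall>m. norm (err m) \<le> B" by (rule BseqE)
  then show ?thesis using that[of B] by simp
qed

lemma r_eq: "m \<ge> 1 \<Longrightarrow> r m = (a + err m) / real m"
  by (simp add: err_def)

lemma RN_pos: "N \<ge> 1 \<Longrightarrow> RN r N > 0"
  unfolding RN_def using r_pos by (intro sum_pos) auto

lemma RN_tendsto: "(\<lambda>N. RN r N / ln (real N)) \<longlonglongrightarrow> a"
proof -
  have lim: "(\<lambda>N. (\<Sum>m=1..N. 1 / real m * \<bar>err m\<bar>) / (\<Sum>m=1..N. 1 / real m) * (harm N / ln (real N))) \<longlonglongrightarrow> 0 * 1"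
    by (intro tendsto_mult weighted_mean_null err_tendsto harm_sum_at_top harm_over_ln) auto
  have "\<forall>\<^sub>F N in sequentially. norm (RN r N / ln (real N) - a * (harm N / ln (real N))) \<le>
     (\<Sum>m=1..N. 1 / real m * \<bar>err m\<bar>) / (\<Sum>m=1..N. 1 / real m) * (harm N / ln (real N))"
    using eventually_ge_at_top[of 2]
  proof eventually_elim
    case (elim N)
    have h: "harm N = (\<Sum>m=1..N. 1 / real m)" by (simp add: harm_def inverse_eq_divide)
    have hp: "harm N > (0::real)" using elim by (intro harm_pos) simp
    have "RN r N = (\<Sum>m=1..N. a * (1 / real m) + 1 / real m * err m)"
      unfolding RN_def by (intro sum.cong) (auto simp: r_eq add_divide_distrib)
    also have "\<dots> = a * harm N + (\<Sum>m=1..N. 1 / real m * err m)"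
      by (simp add: h sum.distrib sum_distrib_left)
    finally have "RN r N - a * harm N = (\<Sum>m=1..N. 1 / real m * err m)" by simp
    moreover have "\<bar>\<Sum>m=1..N. 1 / real m * err m\<bar> \<le> (\<Sum>m=1..N. 1 / real m * \<bar>err m\<bar>)"
      by (rule order_trans[OF sum_abs]) (simp add: abs_mult)
    ultimately have "\<bar>RN r N - a * harm N\<bar> \<le> (\<Sum>m=1..N. 1 / real m * \<bar>err m\<bar>)" by simp
    moreover have "norm (RN r N / ln (real N) - a * (harm N / ln (real N))) = \<bar>RN r N - a * harm N\<bar> / ln (real N)"
      using elim by (simp add: abs_divide flip: diff_divide_distrib)
    ultimately have "norm (RN r N / ln (real N) - a * (harm N / ln (real N))) \<le>
        (\<Sum>m=1..N. 1 / real m * \<bar>err m\<bar>) / ln (real N)"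
      using elim by (simp only:) (rule divide_right_mono, simp_all)
    also have "(\<Sum>m=1..N. 1 / real m * \<bar>err m\<bar>) / ln (real N) =
        (\<Sum>m=1..N. 1 / real m * \<bar>err m\<bar>) / harm N * (harm N / ln (real N))"
      using hp by (simp del: harm_pos_iff)
    finally show ?case unfolding h .
  qed
  then have "(\<lambda>N. RN r N / ln (real N) - a * (harm N / ln (real N))) \<longlonglongrightarrow> 0"
    by (rule Lim_null_comparison) (use lim in simp)
  from tendsto_add[OF this tendsto_mult_left[OF harm_over_ln, of a]] show ?thesis by simp
qed

lemma lam_tendsto: "(\<lambda>N. ln (real N) * (1 - lam N)) \<longlonglongrightarrow> - \<theta>" "lam \<longlonglongrightarrow> 1"
proof -
  obtain \<epsilon> where e: "\<epsilon> \<longlonglongrightarrow> 0" "\<And>N. N \<ge> 2 \<Longrightarrow> lam N = 1 + \<theta> / ln (real N) * (1 + \<epsilon> N)"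
    using lam_asymp by blast
  have "(\<lambda>N. - \<theta> * (1 + \<epsilon> N)) \<longlonglongrightarrow> - \<theta> * (1 + 0)" by (intro tendsto_intros e)
  moreover have "\<forall>\<^sub>F N in sequentially. - \<theta> * (1 + \<epsilon> N) = ln (real N) * (1 - lam N)"
    using eventually_ge_at_top[of 2] by eventually_elim (simp add: e(2))
  ultimately show 1: "(\<lambda>N. ln (real N) * (1 - lam N)) \<longlonglongrightarrow> - \<theta>"
    by (auto elim: Lim_transform_eventually)
  have "(\<lambda>N. 1 - (ln (real N) * (1 - lam N)) / ln (real N)) \<longlonglongrightarrow> 1 - 0"
    by (intro tendsto_intros tendsto_divide_0[OF 1] filterlim_at_top_imp_at_infinity ln_real_at_top)
  moreover have "\<forall>\<^sub>F N in sequentially. 1 - (ln (real N) * (1 - lam N)) / ln (real N) = lam N"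
    using eventually_ge_at_top[of 2] by eventually_elim simp
  ultimately show "lam \<longlonglongrightarrow> 1" by (auto elim: Lim_transform_eventually)
qed

lemma scale_tendsto: "(\<lambda>N. lam N * ln (real N) / RN r N) \<longlonglongrightarrow> 1 / a"
proof -
  have "(\<lambda>N. lam N * inverse (RN r N / ln (real N))) \<longlonglongrightarrow> 1 * inverse a"
    using a_pos by (intro tendsto_intros lam_tendsto RN_tendsto) auto
  then show ?thesis by (simp add: inverse_eq_divide)
qed

lemma sum_one_minus_exp_tendsto:
  assumes l: "l > 0"
  shows "(\<lambda>N. \<Sum>m=1..N. r m * (1 - exp (- l * (real m / real N)))) \<longlonglongrightarrow> a * dickman_psi l"
proof -
  have cont: "continuous_on {0..1} (\<lambda>u. l * exp_quot (l * u))"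
    by (intro continuous_intros continuous_on_compose2[OF continuous_on_exp_quot[of UNIV]]) auto
  have "integral {0..1} (\<lambda>u. l * exp_quot (l * u)) = dickman_psi l"
    using dickman_psi_eq(2)[of l] l by (intro integral_unique) simp
  then have main: "(\<lambda>N. a * ((\<Sum>m=1..N. l * exp_quot (l * (real m / real N))) / real N)) \<longlonglongrightarrow> a * dickman_psi l"
    using riemann_sum_tendsto[OF cont] by (intro tendsto_mult_left) simp
  have "filterlim (\<lambda>N. \<Sum>m=1..N. 1::real) at_top sequentially"
    using filterlim_real_sequentially by simp
  from weighted_mean_null[OF err_tendsto _ this]
  have ces: "(\<lambda>N. l * ((\<Sum>m=1..N. \<bar>err m\<bar>) / real N)) \<longlonglongrightarrow> l * 0" by (intro tendsto_mult_left) simp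
  have "\<forall>\<^sub>F N in sequentially. norm ((\<Sum>m=1..N. r m * (1 - exp (- l * (real m / real N))))
      - a * ((\<Sum>m=1..N. l * exp_quot (l * (real m / real N))) / real N)) \<le> l * ((\<Sum>m=1..N. \<bar>err m\<bar>) / real N)"
    using eventually_ge_at_top[of 1]
  proof eventually_elim
    case (elim N)
    have eq: "r m * (1 - exp (- l * (real m / real N))) - a * (l * exp_quot (l * (real m / real N)) / real N)
        = err m * (l * exp_quot (l * (real m / real N)) / real N)" if m: "m \<in> {1..N}" for m
    proof -
      have "l * exp_quot (l * (real m / real N)) / real N = (1 - exp (- l * (real m / real N))) / real m"
        using m l elim by (simp add: exp_quot_def field_simps)
      moreover have "r m * (1 - exp (- l * (real m / real N))) = (a + err m) * ((1 - exp (- l * (real m / real N))) / real m)"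
        using m by (simp add: r_eq)
      ultimately show ?thesis by (simp only: distrib_right)
    qed
    have "(\<Sum>m=1..N. r m * (1 - exp (- l * (real m / real N))))
      - a * ((\<Sum>m=1..N. l * exp_quot (l * (real m / real N))) / real N)
      = (\<Sum>m=1..N. r m * (1 - exp (- l * (real m / real N))) - a * (l * exp_quot (l * (real m / real N)) / real N))"
      by (simp add: sum_subtractf sum_distrib_left sum_divide_distrib)
    also have "\<dots> = (\<Sum>m=1..N. err m * (l * exp_quot (l * (real m / real N)) / real N))"
      by (rule sum.cong[OF refl eq])
    also have "norm \<dots> \<le> (\<Sum>m=1..N. \<bar>err m\<bar> * (l / real N))"
    proof (rule order_trans[OF norm_sum sum_mono])
      fix m
      have "0 \<le> exp_quot (l * (real m / real N))" "exp_quot (l * (real m / real N)) \<le> 1"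
        using l by (auto intro!: exp_quot_nonneg exp_quot_le_1)
      then have "\<bar>l * exp_quot (l * (real m / real N)) / real N\<bar> \<le> l / real N"
        using l by (simp add: abs_mult divide_right_mono)
      then show "norm (err m * (l * exp_quot (l * (real m / real N)) / real N)) \<le> \<bar>err m\<bar> * (l / real N)"
        unfolding real_norm_def abs_mult[of "err m"] by (intro mult_left_mono) auto
    qed
    also have "\<dots> = l * ((\<Sum>m=1..N. \<bar>err m\<bar>) / real N)"
      unfolding sum_distrib_right[symmetric] by simp
    finally show ?case .
  qed
  then have "(\<lambda>N. (\<Sum>m=1..N. r m * (1 - exp (- l * (real m / real N))))
      - a * ((\<Sum>m=1..N. l * exp_quot (l * (real m / real N))) / real N)) \<longlonglongrightarrow> 0"
    by (rule Lim_null_comparison) (use ces in simp)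
  from tendsto_add[OF this main] show ?thesis by simp
qed

definition u :: "nat \<Rightarrow> nat \<Rightarrow> real" where "u N = U r N (lam N)"

definition p :: "nat \<Rightarrow> nat \<Rightarrow> real" where "p N m = lam N * Tprob r N m"

definition q :: "nat \<Rightarrow> real \<Rightarrow> real" where
  "q N x = (\<Sum>m=1..N. p N m * exp (- x) ^ m)"

lemma renewal: "renewal_seq (p N) (u N)"
  unfolding renewal_seq_def u_def p_def
  by (intro conjI allI U_renewal[of r N "lam N"]) (simp add: Tprob_def)

lemma p_nonneg: "N \<ge> 2 \<Longrightarrow> p N m \<ge> 0"
  using lam_pos[of N] r_pos[of m] RN_pos[of N]
  by (cases "1 \<le> m \<and> m \<le> N") (auto simp: p_def Tprob_def less_imp_le)

lemma p_eq: "m \<in> {1..N} \<Longrightarrow> p N m = lam N / RN r N * r m"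
  by (simp add: p_def Tprob_def)

lemma p_gt: "m > N \<Longrightarrow> p N m = 0"
  by (simp add: p_def Tprob_def)

lemma u_nonneg: "N \<ge> 2 \<Longrightarrow> u N n \<ge> 0"
  using renewal_seq_nonneg[OF renewal p_nonneg] .

lemma one_minus_q:
  assumes "N \<ge> 1"
  shows "1 - q N x = 1 - lam N + lam N / RN r N * (\<Sum>m=1..N. r m * (1 - exp (- x * real m)))"
proof -
  have "q N x = (\<Sum>m=1..N. lam N / RN r N * (r m * exp (- x * real m)))"
    unfolding q_def
  proof (rule sum.cong)
    fix m assume m: "m \<in> {1..N}"
    have "exp (- x) ^ m = exp (- x * real m)" by (simp add: mult.commute flip: exp_of_nat_mult)
    then show "p N m * exp (- x) ^ m = lam N / RN r N * (r m * exp (- x * real m))"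
      using m by (simp add: p_eq)
  qed simp
  also have "\<dots> = lam N / RN r N * (\<Sum>m=1..N. r m * exp (- x * real m))"
    by (simp add: sum_distrib_left)
  also have "(\<Sum>m=1..N. r m * exp (- x * real m)) = RN r N - (\<Sum>m=1..N. r m * (1 - exp (- x * real m)))"
    by (simp add: RN_def right_diff_distrib sum_subtractf)
  finally have "q N x = lam N / RN r N * (RN r N - (\<Sum>m=1..N. r m * (1 - exp (- x * real m))))" .
  then show ?thesis using RN_pos[OF assms] by (simp add: right_diff_distrib)
qed

lemma q_tendsto:
  assumes "l > 0"
  shows "(\<lambda>N. ln (real N) * (1 - q N (l / real N))) \<longlonglongrightarrow> dickman_psi l - \<theta>"
proof -
  have "(\<lambda>N. ln (real N) * (1 - lam N) + lam N * ln (real N) / RN r N * (\<Sum>m=1..N. r m * (1 - exp (- l * (real m / real N)))))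
     \<longlonglongrightarrow> - \<theta> + 1 / a * (a * dickman_psi l)"
    by (intro tendsto_add tendsto_mult lam_tendsto scale_tendsto sum_one_minus_exp_tendsto assms)
  moreover have "\<forall>\<^sub>F N in sequentially. ln (real N) * (1 - lam N) + lam N * ln (real N) / RN r N *
      (\<Sum>m=1..N. r m * (1 - exp (- l * (real m / real N)))) = ln (real N) * (1 - q N (l / real N))"
    using eventually_ge_at_top[of 1]
  proof eventually_elim
    case (elim N)
    have "- (l / real N) * real m = - l * (real m / real N)" for m by simp
    then show ?case unfolding one_minus_q[OF elim] by (simp add: algebra_simps)
  qed
  ultimately show ?thesis using a_pos by (auto elim: Lim_transform_eventually)
qed

end

lemma exp_weighted_ramp:
  fixes x y l :: real
  assumes "x < y"
  obtains h \<phi> where "continuous_on UNIV h" "\<And>t. exp (- l * t) * h (exp (- t)) = \<phi> t"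
    "\<And>t. indicator {..x} t \<le> (\<phi> t :: real)" "\<And>t. \<phi> t \<le> indicator {..y} t"
proof -
  define \<phi> :: "real \<Rightarrow> real" where "\<phi> = (\<lambda>t. max 0 (min 1 ((y - t) / (y - x))))"
  define h :: "real \<Rightarrow> real" where "h = (\<lambda>w. if w \<le> 0 then 0 else \<phi> (- ln w) * exp (l * (- ln w)))"
  have "continuous_on UNIV h"
    unfolding h_def
  proof (rule continuous_on_comp_ln[where K = y])
    show "continuous_on UNIV (\<lambda>t. \<phi> t * exp (l * t))"
      unfolding \<phi>_def using assms by (intro continuous_intros) auto
    show "\<phi> t * exp (l * t) = 0" if "y \<le> t" for t
    proof -
      have "(y - t) / (y - x) \<le> 0" using that assms by (intro divide_nonpos_nonneg) auto
      then show ?thesis by (simp add: \<phi>_def)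
    qed
  qed
  moreover have "exp (- l * t) * h (exp (- t)) = \<phi> t" for t
  proof -
    have "exp (- l * t) * h (exp (- t)) = \<phi> t * (exp (- l * t) * exp (l * t))" by (simp add: h_def)
    then show ?thesis by (simp flip: exp_add)
  qed
  moreover have "indicator {..x} t \<le> \<phi> t" for t
  proof (cases "t \<le> x")
    case True
    then have "1 \<le> (y - t) / (y - x)" using assms by simp
    then show ?thesis using True by (simp add: \<phi>_def)
  qed (simp add: \<phi>_def)
  moreover have "\<phi> t \<le> indicator {..y} t" for t
  proof (cases "t \<le> y")
    case False
    then have "(y - t) / (y - x) \<le> 0" using assms by (intro divide_nonpos_nonneg) auto
    then show ?thesis using False by (simp add: \<phi>_def)
  qed (simp add: \<phi>_def)
  ultimately show ?thesis using that by blast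
qed

lemma finite_nat_le_real: "finite {j::nat. real j \<le> x}"
proof (rule finite_subset)
  show "{j::nat. real j \<le> x} \<subseteq> {..nat \<lfloor>x\<rfloor>}" by (auto simp: le_nat_floor)
qed simp

context dickman_renewal
begin

definition v :: "nat \<Rightarrow> nat \<Rightarrow> real" where "v N = self_conv (u N)"

text \<open>\<open>W N\<close> is the rescaled distribution function of \<open>v N = u N * u N\<close>, and \<open>PN l N h\<close> integrates the
  test function \<open>t \<mapsto> exp (- l t) h (exp (- t))\<close> against it.\<close>

definition W :: "nat \<Rightarrow> real \<Rightarrow> real" where
  "W N t = (\<Sum>j\<in>{j. real j \<le> t * real N}. v N j) / (ln (real N))\<^sup>2"

definition PN :: "real \<Rightarrow> nat \<Rightarrow> (real \<Rightarrow> real) \<Rightarrow> real" where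
  "PN l N h = (\<Sum>j. v N j * (exp (- l * (real j / real N)) * h (exp (- (real j / real N))))) / (ln (real N))\<^sup>2"

lemma v_nonneg: "N \<ge> 2 \<Longrightarrow> v N j \<ge> 0"
  unfolding v_def using u_nonneg by (intro self_conv_nonneg)

lemma u_sums:
  assumes "N \<ge> 2" "q N x < 1"
  shows "(\<lambda>j. u N j * exp (- x * real j)) sums (1 / (1 - q N x))"
    and "(\<lambda>j. v N j * exp (- x * real j)) sums (1 / (1 - q N x))\<^sup>2"
proof -
  have e: "exp (- x) ^ j = exp (- x * real j)" for j by (simp add: mult.commute flip: exp_of_nat_mult)
  show "(\<lambda>j. u N j * exp (- x * real j)) sums (1 / (1 - q N x))"
    using renewal_seq_sums(1)[OF renewal p_nonneg[OF assms(1)] p_gt, where z = "exp (- x)" and q = "q N x"] assms(2)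
    by (simp add: q_def e)
  show "(\<lambda>j. v N j * exp (- x * real j)) sums (1 / (1 - q N x))\<^sup>2"
    using renewal_seq_sums(2)[OF renewal p_nonneg[OF assms(1)] p_gt, where z = "exp (- x)" and q = "q N x"] assms(2)
    by (simp add: q_def e v_def)
qed

lemma PN_summable:
  assumes N: "N \<ge> 2" "q N (l / real N) < 1" and h: "continuous_on UNIV h"
  shows "summable (\<lambda>j. v N j * (exp (- l * (real j / real N)) * h (exp (- (real j / real N)))))"
proof -
  obtain B where B: "B \<ge> 0" "\<And>x. 0 \<le> x \<Longrightarrow> x \<le> 1 \<Longrightarrow> \<bar>h x\<bar> \<le> B"
    using continuous_bounded_01[OF h] by blast
  have "summable (\<lambda>j. (v N j * exp (- (l / real N) * real j)) * B)"
    using u_sums(2)[OF N] by (intro summable_mult2) (simp add: sums_iff)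
  then show ?thesis
  proof (rule summable_comparison_test'[where N = 0])
    fix j :: nat
    have "norm (v N j * (exp (- l * (real j / real N)) * h (exp (- (real j / real N)))))
        = (v N j * exp (- (l / real N) * real j)) * \<bar>h (exp (- (real j / real N)))\<bar>"
      using v_nonneg[OF N(1), of j] by (simp add: abs_mult)
    also have "\<dots> \<le> (v N j * exp (- (l / real N) * real j)) * B"
      using v_nonneg[OF N(1), of j] by (intro mult_left_mono B) auto
    finally show "norm (v N j * (exp (- l * (real j / real N)) * h (exp (- (real j / real N)))))
        \<le> (v N j * exp (- (l / real N) * real j)) * B" .
  qed
qed

lemma pos_functional_PN:
  assumes N: "N \<ge> 2" "q N (l / real N) < 1"
  shows "pos_functional (PN l N)"
  unfolding pos_functional_def
proof (intro conjI allI impI)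
  fix f g :: "real \<Rightarrow> real" assume c: "continuous_on UNIV f" "continuous_on UNIV g"
  show "PN l N (\<lambda>x. f x + g x) = PN l N f + PN l N g"
    unfolding PN_def distrib_left add_divide_distrib[symmetric]
    by (subst suminf_add[OF PN_summable[OF N c(1)] PN_summable[OF N c(2)]]) (rule refl)
  assume le: "\<forall>x\<in>{0..1}. f x \<le> g x"
  have "(\<Sum>j. v N j * (exp (- l * (real j / real N)) * f (exp (- (real j / real N)))))
      \<le> (\<Sum>j. v N j * (exp (- l * (real j / real N)) * g (exp (- (real j / real N)))))"
    using v_nonneg[OF N(1)] le
    by (intro suminf_le PN_summable N c mult_left_mono) auto
  then show "PN l N f \<le> PN l N g" unfolding PN_def by (intro divide_right_mono) auto
next
  fix c :: real and f :: "real \<Rightarrow> real" assume f: "continuous_on UNIV f"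
  have "(\<Sum>j. v N j * (exp (- l * (real j / real N)) * (c * f (exp (- (real j / real N))))))
      = (\<Sum>j. c * (v N j * (exp (- l * (real j / real N)) * f (exp (- (real j / real N))))))"
    by (simp only: mult.left_commute)
  also have "\<dots> = c * (\<Sum>j. v N j * (exp (- l * (real j / real N)) * f (exp (- (real j / real N)))))"
    by (rule suminf_mult[OF PN_summable[OF N f]])
  finally show "PN l N (\<lambda>x. c * f x) = c * PN l N f" by (simp add: PN_def)
qed

lemma PN_power:
  assumes N: "N \<ge> 2" "q N ((l + real k) / real N) < 1"
  shows "PN l N (\<lambda>x. x ^ k) = 1 / (ln (real N) * (1 - q N ((l + real k) / real N)))\<^sup>2"
proof -
  have "exp (- l * (real j / real N)) * exp (- (real j / real N)) ^ k = exp (- ((l + real k) / real N) * real j)" for j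
  proof -
    have "exp (- (real j / real N)) ^ k = exp (- (real k * (real j / real N)))" by (simp flip: exp_of_nat_mult)
    then have "exp (- l * (real j / real N)) * exp (- (real j / real N)) ^ k
        = exp (- l * (real j / real N) + - (real k * (real j / real N)))" by (simp only: exp_add)
    also have "- l * (real j / real N) + - (real k * (real j / real N)) = - ((l + real k) / real N) * real j"
      using N(1) by (simp add: field_simps)
    finally show ?thesis .
  qed
  then have "PN l N (\<lambda>x. x ^ k) = (\<Sum>j. v N j * exp (- ((l + real k) / real N) * real j)) / (ln (real N))\<^sup>2"
    by (simp only: PN_def)
  also have "\<dots> = (1 / (1 - q N ((l + real k) / real N)))\<^sup>2 / (ln (real N))\<^sup>2"
    using u_sums(2)[OF N] by (simp only: sums_iff)
  finally show ?thesis by (simp add: power_divide power_mult_distrib mult.commute)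
qed

lemma q_less_1:
  assumes "l > 0" "dickman_psi l > \<theta>"
  shows "\<forall>\<^sub>F N in sequentially. q N (l / real N) < 1"
proof -
  have "\<forall>\<^sub>F N in sequentially. ln (real N) * (1 - q N (l / real N)) > 0"
    using order_tendstoD(1)[OF q_tendsto[OF assms(1)], of 0] assms(2) by simp
  then show ?thesis using eventually_ge_at_top[of 2]
  proof eventually_elim
    case (elim N)
    have "ln (real N) > 0" using elim by simp
    then show ?case using elim by (simp add: zero_less_mult_iff)
  qed
qed

lemma PN_tendsto:
  assumes l: "l > 0" "\<And>x. x \<ge> l \<Longrightarrow> dickman_psi x > \<theta>" and h: "continuous_on UNIV h"
  shows "(\<lambda>N. PN l N h) \<longlonglongrightarrow> tilt_fun \<theta> l h"
proof (rule pos_functional_tendsto[where PN = "PN l" and P = "tilt_fun \<theta> l" and h = h])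
  show "\<forall>\<^sub>F N in sequentially. pos_functional (PN l N)"
    using q_less_1[OF l(1) l(2)[OF order_refl]] eventually_ge_at_top[of 2]
    by eventually_elim (rule pos_functional_PN)
  show "pos_functional (tilt_fun \<theta> l)" using l by (intro pos_functional_tilt_fun) auto
  show "continuous_on UNIV h" by (rule h)
  fix k :: nat
  have lk: "l + real k > 0" "dickman_psi (l + real k) > \<theta>" using l by auto
  have "(\<lambda>N. 1 / (ln (real N) * (1 - q N ((l + real k) / real N)))\<^sup>2) \<longlonglongrightarrow> 1 / (dickman_psi (l + real k) - \<theta>)\<^sup>2"
    using lk by (intro tendsto_intros q_tendsto) auto
  moreover have "\<forall>\<^sub>F N in sequentially. 1 / (ln (real N) * (1 - q N ((l + real k) / real N)))\<^sup>2 = PN l N (\<lambda>x. x ^ k)"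
    using q_less_1[OF lk] eventually_ge_at_top[of 2] by eventually_elim (simp add: PN_power)
  ultimately have "(\<lambda>N. PN l N (\<lambda>x. x ^ k)) \<longlonglongrightarrow> 1 / (dickman_psi (l + real k) - \<theta>)\<^sup>2"
    by (rule Lim_transform_eventually)
  then show "(\<lambda>N. PN l N (\<lambda>x. x ^ k)) \<longlonglongrightarrow> tilt_fun \<theta> l (\<lambda>x. x ^ k)"
    using tilt_fun_power[of l \<theta> k] l lk by simp
qed

lemma PN_sandwich:
  assumes N: "N \<ge> 2" "q N (l / real N) < 1" and h: "continuous_on UNIV h"
    and \<phi>: "\<And>t. exp (- l * t) * h (exp (- t)) = \<phi> t"
  shows "(\<And>t. indicator {..x} t \<le> \<phi> t) \<Longrightarrow> W N x \<le> PN l N h"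
    and "(\<And>t. \<phi> t \<le> indicator {..x} t) \<Longrightarrow> PN l N h \<le> W N x"
proof -
  let ?A = "{j::nat. real j \<le> x * real N}"
  have A: "real j / real N \<in> {..x} \<longleftrightarrow> j \<in> ?A" for j
    using N(1) by (simp add: pos_divide_le_eq)
  have sm: "summable (\<lambda>j. v N j * \<phi> (real j / real N))"
    using PN_summable[OF N h] unfolding \<phi> .
  have PN: "PN l N h = (\<Sum>j. v N j * \<phi> (real j / real N)) / (ln (real N))\<^sup>2"
    unfolding PN_def \<phi> ..
  have ind: "(\<Sum>j\<in>?A. v N j) = (\<Sum>j\<in>?A. v N j * indicator {..x} (real j / real N))"
    using A by (intro sum.cong) (auto simp del: atMost_iff)
  show "W N x \<le> PN l N h" if *: "\<And>t. indicator {..x} t \<le> \<phi> t"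
  proof -
    have pos: "\<phi> t \<ge> 0" for t using order_trans[OF _ *[of t], of 0] by simp
    have "(\<Sum>j\<in>?A. v N j) \<le> (\<Sum>j\<in>?A. v N j * \<phi> (real j / real N))"
      unfolding ind by (intro sum_mono mult_left_mono * v_nonneg N)
    also have "\<dots> \<le> (\<Sum>j. v N j * \<phi> (real j / real N))"
      by (intro sum_le_suminf sm finite_nat_le_real mult_nonneg_nonneg v_nonneg N pos)
    finally show ?thesis unfolding W_def PN by (intro divide_right_mono) auto
  qed
  show "PN l N h \<le> W N x" if *: "\<And>t. \<phi> t \<le> indicator {..x} t"
  proof -
    have sums: "(\<lambda>j. v N j * indicator {..x} (real j / real N)) sums (\<Sum>j\<in>?A. v N j)"
      unfolding ind using A by (intro sums_finite finite_nat_le_real) (auto simp del: atMost_iff)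
    have "(\<Sum>j. v N j * \<phi> (real j / real N)) \<le> (\<Sum>j. v N j * indicator {..x} (real j / real N))"
      by (intro suminf_le sm mult_left_mono * v_nonneg N sums_summable[OF sums])
    also have "\<dots> = (\<Sum>j\<in>?A. v N j)" using sums by (simp add: sums_iff)
    finally show ?thesis unfolding W_def PN by (intro divide_right_mono) auto
  qed
qed

lemma W_tendsto: "(\<lambda>N. W N t) \<longlonglongrightarrow> tilt_cdf \<theta> t"
proof (rule tendstoI)
  fix e :: real assume e: "e > 0"
  obtain l where l: "l > 0" "\<And>x. x \<ge> l \<Longrightarrow> dickman_psi x > \<theta>" using dickman_psi_large by blast
  have l2: "l \<ge> 0" "dickman_psi l > \<theta>" using l by auto
  obtain d where d: "d > 0" "\<And>x. dist x t < d \<Longrightarrow> dist (tilt_cdf \<theta> x) (tilt_cdf \<theta> t) < e / 2"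
    using isCont_tilt_cdf[of t \<theta>, unfolded continuous_at_eps_delta, rule_format, of "e / 2"] e by auto
  define x where "x = t - d / 2"
  define y where "y = t + d / 2"
  have "dist x t < d" "dist y t < d" using d(1) by (auto simp: x_def y_def dist_real_def)
  then have "\<bar>tilt_cdf \<theta> x - tilt_cdf \<theta> t\<bar> < e / 2" "\<bar>tilt_cdf \<theta> y - tilt_cdf \<theta> t\<bar> < e / 2"
    using d(2)[of x] d(2)[of y] unfolding dist_real_def by auto
  then have xy: "x < t" "t < y" "tilt_cdf \<theta> x > tilt_cdf \<theta> t - e / 2" "tilt_cdf \<theta> y < tilt_cdf \<theta> t + e / 2"
    using d(1) unfolding x_def y_def by linarith+
  obtain h1 \<phi>1 where 1: "continuous_on UNIV h1" "\<And>t. exp (- l * t) * h1 (exp (- t)) = \<phi>1 t"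
    "\<And>s. indicator {..x} s \<le> (\<phi>1 s :: real)" "\<And>s. \<phi>1 s \<le> indicator {..t} s"
    using exp_weighted_ramp[OF xy(1), of l] by blast
  obtain h2 \<phi>2 where 2: "continuous_on UNIV h2" "\<And>t. exp (- l * t) * h2 (exp (- t)) = \<phi>2 t"
    "\<And>s. indicator {..t} s \<le> (\<phi>2 s :: real)" "\<And>s. \<phi>2 s \<le> indicator {..y} s"
    using exp_weighted_ramp[OF xy(2), of l] by blast
  have lim1: "(\<lambda>N. PN l N h1) \<longlonglongrightarrow> tilt_fun \<theta> l h1" by (rule PN_tendsto[OF l 1(1)])
  have lim2: "(\<lambda>N. PN l N h2) \<longlonglongrightarrow> tilt_fun \<theta> l h2" by (rule PN_tendsto[OF l 2(1)])
  have "tilt_cdf \<theta> x \<le> tilt_fun \<theta> l h1" by (rule tilt_fun_sandwich(1)[OF l2 1(1-3)])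
  then have "tilt_cdf \<theta> t - e < tilt_fun \<theta> l h1" using xy(3) e by linarith
  then have "\<forall>\<^sub>F N in sequentially. tilt_cdf \<theta> t - e < PN l N h1"
    by (rule order_tendstoD(1)[OF lim1])
  moreover have "tilt_fun \<theta> l h2 \<le> tilt_cdf \<theta> y" by (rule tilt_fun_sandwich(2)[OF l2 2(1,2,4)])
  then have "tilt_fun \<theta> l h2 < tilt_cdf \<theta> t + e" using xy(4) e by linarith
  then have "\<forall>\<^sub>F N in sequentially. PN l N h2 < tilt_cdf \<theta> t + e"
    by (rule order_tendstoD(2)[OF lim2])
  ultimately show "\<forall>\<^sub>F N in sequentially. dist (W N t) (tilt_cdf \<theta> t) < e"
    using q_less_1[OF l(1) l2(2)] eventually_ge_at_top[of 2]
  proof eventually_elim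
    case (elim N)
    have "PN l N h1 \<le> W N t" by (rule PN_sandwich(2)[OF elim(4,3) 1(1,2,4)])
    moreover have "W N t \<le> PN l N h2" by (rule PN_sandwich(1)[OF elim(4,3) 2(1-3)])
    ultimately show ?case using elim by (simp add: dist_real_def abs_less_iff)
  qed
qed

lemma W_mono: "N \<ge> 2 \<Longrightarrow> x \<le> y \<Longrightarrow> W N x \<le> W N y"
proof -
  assume N: "N \<ge> 2" and xy: "x \<le> y"
  have "x * real N \<le> y * real N" using xy by (intro mult_right_mono) auto
  then have "(\<Sum>j\<in>{j. real j \<le> x * real N}. v N j) \<le> (\<Sum>j\<in>{j. real j \<le> y * real N}. v N j)"
    using N by (intro sum_mono2 finite_nat_le_real v_nonneg) (auto intro: order_trans)
  then show ?thesis unfolding W_def by (intro divide_right_mono) auto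
qed

lemma W_neg: "N \<ge> 2 \<Longrightarrow> t < 0 \<Longrightarrow> W N t = 0"
proof -
  assume "N \<ge> 2" "t < 0"
  then have "t * real N < 0" by (simp add: mult_neg_pos)
  then have "{j::nat. real j \<le> t * real N} = {}" by (auto simp: not_le intro: less_le_trans)
  then show ?thesis by (simp add: W_def)
qed

text \<open>Pointwise convergence of monotone functions to a continuous limit is locally uniform.\<close>

lemma W_uniform:
  assumes T: "T > 0" and e: "e > 0"
  shows "\<forall>\<^sub>F N in sequentially. \<forall>t\<le>T. \<bar>W N t - tilt_cdf \<theta> t\<bar> \<le> e"
proof -
  have "uniformly_continuous_on {0..T} (tilt_cdf \<theta>)"
    using continuous_on_tilt_cdf[of "{0..T}" "\<lambda>x. x" \<theta>] by (intro compact_uniformly_continuous) auto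
  then obtain d where d: "d > 0"
    "\<And>x y. x \<in> {0..T} \<Longrightarrow> y \<in> {0..T} \<Longrightarrow> dist x y < d \<Longrightarrow> dist (tilt_cdf \<theta> x) (tilt_cdf \<theta> y) < e / 2"
    unfolding uniformly_continuous_on_def using e by (metis half_gt_zero)
  obtain K :: nat where K: "real K > T / d" using reals_Archimedean2 by blast
  have K0: "K > 0" using K T d by (cases K) (auto simp: divide_less_0_iff)
  have Td: "T / real K < d" using K K0 d by (simp add: field_simps)
  define x where "x = (\<lambda>i::nat. real i * T / real K)"
  have "\<forall>\<^sub>F N in sequentially. \<forall>i\<in>{..K}. dist (W N (x i)) (tilt_cdf \<theta> (x i)) < e / 2"
    using e by (intro eventually_ball_finite ballI tendstoD[OF W_tendsto]) auto
  then show ?thesis using eventually_ge_at_top[of 2]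
  proof eventually_elim
    case (elim N)
    show ?case
    proof (intro allI impI)
      fix t assume tT: "t \<le> T"
      show "\<bar>W N t - tilt_cdf \<theta> t\<bar> \<le> e"
      proof (cases "t < 0")
        case True
        then show ?thesis using W_neg[OF elim(2)] e by (simp add: tilt_cdf_nonpos)
      next
        case False
        show ?thesis
        proof (cases "t = T")
          case True
          have "x K = T" using K0 by (simp add: x_def)
          moreover have "dist (W N (x K)) (tilt_cdf \<theta> (x K)) < e / 2" using elim by blast
          ultimately show ?thesis using True e by (simp add: dist_real_def)
        next
          case F2: False
          define i where "i = nat \<lfloor>t * real K / T\<rfloor>"
          have y0: "t * real K / T \<ge> 0" using False T by simp
          have i1: "real i \<le> t * real K / T" "t * real K / T < real i + 1"
            using y0 unfolding i_def by linarith+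
          have xi: "x i \<le> t" "t \<le> x (Suc i)"
            using i1 T K0 by (auto simp: x_def field_simps)
          have "t * real K / T < real K" using F2 tT T K0 by (simp add: field_simps)
          then have iK: "i < K" using i1(1) by linarith
          have xr: "x j \<in> {0..T}" if "j \<le> K" for j
          proof -
            have "real j * T \<le> real K * T" using that T by (intro mult_right_mono) auto
            then show ?thesis using T K0 by (simp add: x_def field_simps)
          qed
          have gap: "x (Suc i) - x i = T / real K" by (simp add: x_def add_divide_distrib distrib_right)
          have "dist (tilt_cdf \<theta> (x i)) (tilt_cdf \<theta> t) < e / 2" "dist (tilt_cdf \<theta> (x (Suc i))) (tilt_cdf \<theta> t) < e / 2"
            using xi gap Td False tT iK by (intro d xr; simp add: dist_real_def)+
          moreover have "dist (W N (x i)) (tilt_cdf \<theta> (x i)) < e / 2" "dist (W N (x (Suc i))) (tilt_cdf \<theta> (x (Suc i))) < e / 2"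
            using elim(1) iK by auto
          moreover have "W N (x i) \<le> W N t" "W N t \<le> W N (x (Suc i))"
            using xi by (auto intro: W_mono[OF elim(2)])
          ultimately show ?thesis unfolding dist_real_def by linarith
        qed
      qed
    qed
  qed
qed

definition rate :: "nat \<Rightarrow> real" where "rate N = lam N * ln (real N) / RN r N"

lemma rate_nonneg: "N \<ge> 2 \<Longrightarrow> rate N \<ge> 0"
  using lam_pos[of N] RN_pos[of N] by (simp add: rate_def)

lemma lam_over_RN: "N \<ge> 2 \<Longrightarrow> lam N / RN r N = rate N / ln (real N)"
  by (simp add: rate_def)

lemma window_sum:
  assumes N: "N \<ge> 2" and n: "n \<ge> 1"
  shows "(\<Sum>m=1..min n M. v N (n - m)) =
    (ln (real N))\<^sup>2 * (W N ((real n - 1) / real N) - W N ((real n - 1 - real M) / real N))"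
proof -
  define A where "A = {j::nat. real j \<le> real n - 1}"
  define B where "B = {j::nat. real j \<le> real n - 1 - real M}"
  have ln: "ln (real N) \<noteq> 0" using N by simp
  have BA: "B \<subseteq> A" by (auto simp: A_def B_def)
  have fin: "finite A" unfolding A_def by (rule finite_nat_le_real)
  have W: "W N ((real n - 1) / real N) = (\<Sum>j\<in>A. v N j) / (ln (real N))\<^sup>2"
    "W N ((real n - 1 - real M) / real N) = (\<Sum>j\<in>B. v N j) / (ln (real N))\<^sup>2"
    using N by (simp_all add: W_def A_def B_def)
  have "(\<Sum>m=1..min n M. v N (n - m)) = (\<Sum>j\<in>A - B. v N j)"
  proof (rule sum.reindex_bij_witness[of _ "\<lambda>j. n - j" "\<lambda>m. n - m"])
    fix j assume "j \<in> A - B"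
    then have "real j \<le> real n - 1" "\<not> real j \<le> real n - 1 - real M" by (auto simp: A_def B_def)
    then have "j + 1 \<le> n" "n < j + 1 + M" by linarith+
    then show "n - j \<in> {1..min n M}" "n - (n - j) = j" by auto
  next
    fix m assume m: "m \<in> {1..min n M}"
    then show "n - m \<in> A - B" by (auto simp: A_def B_def of_nat_diff)
    show "n - (n - m) = m" using m by auto
  qed auto
  also have "\<dots> = (\<Sum>j\<in>A. v N j) - (\<Sum>j\<in>B. v N j)" by (rule sum_diff[OF fin BA])
  finally show ?thesis unfolding W using ln by (simp add: right_diff_distrib)
qed

lemma mult_u_eq:
  assumes N: "N \<ge> 2"
  shows "real n * u N n = lam N / RN r N * (\<Sum>m=1..min n N. (a + err m) * v N (n - m))"
proof -
  have "real n * u N n = (\<Sum>m=1..n. real m * p N m * v N (n - m))"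
    unfolding v_def by (rule renewal_seq_derivative[OF renewal])
  also have "\<dots> = (\<Sum>m=1..min n N. real m * p N m * v N (n - m))"
    by (rule sum.mono_neutral_right) (auto simp: p_gt)
  also have "\<dots> = (\<Sum>m=1..min n N. lam N / RN r N * ((a + err m) * v N (n - m)))"
  proof (rule sum.cong)
    fix m assume "m \<in> {1..min n N}"
    then have "p N m = lam N / RN r N * r m" by (intro p_eq) auto
    then show "real m * p N m * v N (n - m) = lam N / RN r N * ((a + err m) * v N (n - m))"
      by (simp add: err_def)
  qed simp
  finally show ?thesis by (simp only: sum_distrib_left)
qed

lemma mult_u_approx:
  assumes N: "N \<ge> 2" and n: "n \<ge> 1" and B: "\<And>m. \<bar>err m\<bar> \<le> B" and e: "\<And>m. m > M \<Longrightarrow> \<bar>err m\<bar> \<le> e" "e \<ge> 0"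
  defines "s \<equiv> (real n - 1) / real N"
  shows "\<bar>real n * u N n / ln (real N) - rate N * (a * (W N s - W N (s - 1)))\<bar>
    \<le> rate N * (B * (W N s - W N (s - real M / real N)) + e * W N s)"
proof -
  let ?L = "ln (real N)"
  have L: "?L > 0" using N by simp
  have s1: "(real n - 1 - real N) / real N = s - 1" using N by (simp add: s_def diff_divide_distrib)
  have sM: "(real n - 1 - real M) / real N = s - real M / real N" by (simp add: s_def diff_divide_distrib)
  have w1: "(\<Sum>m=1..min n N. v N (n - m)) = ?L\<^sup>2 * (W N s - W N (s - 1))"
    using window_sum[OF N n, of N] unfolding s1 s_def[symmetric] .
  have wM: "(\<Sum>m=1..min n M. v N (n - m)) = ?L\<^sup>2 * (W N s - W N (s - real M / real N))"
    using window_sum[OF N n, of M] unfolding sM s_def[symmetric] .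
  have alg: "c / ?L * (a * (?L\<^sup>2 * X) + Y) / ?L = c * (a * X) + c * (Y / ?L\<^sup>2)" for c X Y
    using L by (simp add: field_simps power2_eq_square)
  have B0: "B \<ge> 0" using order_trans[OF abs_ge_zero B] .
  have v0: "v N j \<ge> 0" for j using v_nonneg[OF N] .
  have nu: "real n * u N n = rate N / ?L * (a * (\<Sum>m=1..min n N. v N (n - m)) + (\<Sum>m=1..min n N. err m * v N (n - m)))"
    unfolding mult_u_eq[OF N] lam_over_RN[OF N] by (simp only: distrib_right sum.distrib sum_distrib_left mult.assoc)
  have "real n * u N n / ?L = rate N * (a * (W N s - W N (s - 1))) + rate N * ((\<Sum>m=1..min n N. err m * v N (n - m)) / ?L\<^sup>2)"
    unfolding nu w1 by (rule alg)
  then have eq: "real n * u N n / ?L - rate N * (a * (W N s - W N (s - 1))) =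
      rate N * ((\<Sum>m=1..min n N. err m * v N (n - m)) / ?L\<^sup>2)" by simp
  have "\<bar>\<Sum>m=1..min n N. err m * v N (n - m)\<bar> \<le> (\<Sum>m=1..min n N. \<bar>err m\<bar> * v N (n - m))"
    by (rule order_trans[OF sum_abs]) (simp add: abs_mult v0)
  also have "\<dots> \<le> (\<Sum>m=1..min n N. (if m \<le> M then B * v N (n - m) else 0) + e * v N (n - m))"
  proof (rule sum_mono)
    fix m
    show "\<bar>err m\<bar> * v N (n - m) \<le> (if m \<le> M then B * v N (n - m) else 0) + e * v N (n - m)"
    proof (cases "m \<le> M")
      case True
      have "\<bar>err m\<bar> * v N (n - m) \<le> B * v N (n - m)" by (intro mult_right_mono B v0)
      moreover have "e * v N (n - m) \<ge> 0" using e v0 by simp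
      ultimately show ?thesis using True by simp
    next
      case False
      then have "\<bar>err m\<bar> * v N (n - m) \<le> e * v N (n - m)" using e by (intro mult_right_mono v0) auto
      then show ?thesis using False by simp
    qed
  qed
  also have "\<dots> = (\<Sum>m\<in>{1..min n N} \<inter> {m. m \<le> M}. B * v N (n - m)) + e * (\<Sum>m=1..min n N. v N (n - m))"
    unfolding sum.distrib sum_distrib_left by (subst sum.inter_restrict) auto
  also have "(\<Sum>m\<in>{1..min n N} \<inter> {m. m \<le> M}. B * v N (n - m)) \<le> (\<Sum>m=1..min n M. B * v N (n - m))"
    using B0 v0 by (intro sum_mono2) auto
  also have "\<dots> = B * (\<Sum>m=1..min n M. v N (n - m))" by (simp only: sum_distrib_left)
  finally have "\<bar>\<Sum>m=1..min n N. err m * v N (n - m)\<bar> \<le>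
      ?L\<^sup>2 * (B * (W N s - W N (s - real M / real N)) + e * (W N s - W N (s - 1)))"
    unfolding w1 wM by (simp add: algebra_simps)
  also have "\<dots> \<le> ?L\<^sup>2 * (B * (W N s - W N (s - real M / real N)) + e * W N s)"
  proof (intro mult_left_mono add_left_mono)
    show "W N s - W N (s - 1) \<le> W N s" unfolding W_def using v0 by (simp add: sum_nonneg)
  qed (use e in auto)
  finally have "\<bar>\<Sum>m=1..min n N. err m * v N (n - m)\<bar> / ?L\<^sup>2 \<le> B * (W N s - W N (s - real M / real N)) + e * W N s"
    using L by (simp add: pos_divide_le_eq mult.commute)
  then have "rate N * (\<bar>\<Sum>m=1..min n N. err m * v N (n - m)\<bar> / ?L\<^sup>2) \<le>
      rate N * (B * (W N s - W N (s - real M / real N)) + e * W N s)"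
    using rate_nonneg[OF N] by (rule mult_left_mono)
  moreover have "\<bar>rate N * ((\<Sum>m=1..min n N. err m * v N (n - m)) / ?L\<^sup>2)\<bar> =
      rate N * (\<bar>\<Sum>m=1..min n N. err m * v N (n - m)\<bar> / ?L\<^sup>2)"
    using rate_nonneg[OF N] by (simp add: abs_mult)
  ultimately show ?thesis unfolding eq by (simp only:)
qed

lemma local_limit:
  assumes dT: "0 < \<delta>" "\<delta> < T" and \<kappa>: "\<kappa> > 0"
  shows "\<forall>\<^sub>F N in sequentially. \<forall>n::nat. \<delta> * real N \<le> real n \<and> real n \<le> T * real N \<longrightarrow>
    \<bar>real n * u N n / ln (real N) - (tilt_cdf \<theta> (real n / real N) - tilt_cdf \<theta> (real n / real N - 1))\<bar> \<le> \<kappa>"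
proof -
  obtain B where B: "B > 0" "\<And>m. \<bar>err m\<bar> \<le> B" using err_bounded by blast
  define K where "K = tilt_cdf \<theta> T"
  have H0: "tilt_cdf \<theta> x \<ge> 0" for x using tilt_cdf_mono[of "min x 0" x \<theta>] tilt_cdf_nonpos[of "min x 0" \<theta>] by simp
  have K: "K \<ge> 0" unfolding K_def by (rule H0)
  define e where "e = a * \<kappa> / (4 * (K + 1))"
  have e: "e > 0" using a_pos \<kappa> K by (simp add: e_def)
  have eK: "e * (K + 1) = a * \<kappa> / 4" using K by (simp add: e_def divide_simps)
  have "\<forall>\<^sub>F m in sequentially. \<bar>err m\<bar> < e" using tendstoD[OF err_tendsto e] by simp
  then obtain M where M: "\<And>m. m > M \<Longrightarrow> \<bar>err m\<bar> \<le> e"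
    unfolding eventually_sequentially by (meson less_imp_le)
  define D where "D = 8 * B / a + 8 + K"
  have D: "D > 0" using B a_pos K by (simp add: D_def add_pos_nonneg)
  define \<eta> where "\<eta> = min 1 (\<kappa> / (2 * D))"
  have \<eta>: "\<eta> > 0" "\<eta> \<le> 1" "\<eta> * D \<le> \<kappa> / 2"
  proof -
    show "\<eta> > 0" "\<eta> \<le> 1" using \<kappa> D by (auto simp: \<eta>_def)
    have "\<eta> \<le> \<kappa> / (2 * D)" by (simp add: \<eta>_def)
    then show "\<eta> * D \<le> \<kappa> / 2" using D by (simp add: field_simps)
  qed
  have "uniformly_continuous_on {-3..T} (tilt_cdf \<theta>)"
    using continuous_on_tilt_cdf[of "{-3..T}" "\<lambda>x. x" \<theta>] by (intro compact_uniformly_continuous) auto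
  then obtain d where d: "d > 0"
    "\<And>x y. x \<in> {-3..T} \<Longrightarrow> y \<in> {-3..T} \<Longrightarrow> dist x y < d \<Longrightarrow> dist (tilt_cdf \<theta> x) (tilt_cdf \<theta> y) < \<eta>"
    unfolding uniformly_continuous_on_def using \<eta>(1) by metis
  have "\<forall>\<^sub>F N in sequentially. real N > (real M + 1) / min 1 d"
    using filterlim_real_sequentially unfolding filterlim_at_top_dense by blast
  moreover have "T > 0" using dT by simp
  then have "\<forall>\<^sub>F N in sequentially. \<forall>t\<le>T. \<bar>W N t - tilt_cdf \<theta> t\<bar> \<le> \<eta>" using \<eta> by (intro W_uniform)
  moreover have "(\<lambda>N. rate N * a) \<longlonglongrightarrow> 1 / a * a"
    unfolding rate_def by (intro tendsto_intros scale_tendsto)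
  then have "\<forall>\<^sub>F N in sequentially. dist (rate N * a) 1 < \<eta>"
    using a_pos \<eta>(1) by (intro tendstoD) simp_all
  ultimately show ?thesis using eventually_ge_at_top[of 2]
  proof eventually_elim
    case (elim N)
    show ?case
    proof (intro allI impI)
      fix n :: nat assume n: "\<delta> * real N \<le> real n \<and> real n \<le> T * real N"
      define t where "t = real n / real N"
      define s where "s = (real n - 1) / real N"
      have N: "N \<ge> 2" "real N > 0" using elim(4) by auto
      have "0 < \<delta> * real N" using dT N by simp
      then have n1: "n \<ge> 1" using n by (cases n) auto
      have t: "0 < t" "t \<le> T" using n n1 N by (auto simp: t_def field_simps)
      have st: "s = t - 1 / real N" by (simp add: s_def t_def diff_divide_distrib)
      have "real M + 1 < real N * min 1 d"
        using elim(1) d(1) pos_divide_less_eq[of "min 1 d" "real M + 1" "real N"] by simp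
      then have "(real M + 1) / real N < min 1 d"
        unfolding pos_divide_less_eq[OF N(2)] by (simp only: mult.commute)
      then have MN: "real M / real N + 1 / real N < 1" "real M / real N + 1 / real N < d"
        by (auto simp: add_divide_distrib)
      have MN0: "real M / real N \<ge> 0" "1 / real N > 0" using N by auto
      have near: "\<bar>W N x - tilt_cdf \<theta> y\<bar> \<le> 2 * \<eta>" if "x \<le> y" "y \<le> T" "-3 \<le> x" "y - x < d" for x y
      proof -
        have "\<bar>W N x - tilt_cdf \<theta> x\<bar> \<le> \<eta>" using elim(2) that by auto
        moreover have "dist (tilt_cdf \<theta> x) (tilt_cdf \<theta> y) < \<eta>" using that by (intro d) (auto simp: dist_real_def)
        ultimately show ?thesis unfolding dist_real_def by linarith
      qed
      have 1: "\<bar>W N s - tilt_cdf \<theta> t\<bar> \<le> 2 * \<eta>" using MN MN0 t unfolding st by (intro near) linarith+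
      have 2: "\<bar>W N (s - 1) - tilt_cdf \<theta> (t - 1)\<bar> \<le> 2 * \<eta>" using MN MN0 t unfolding st by (intro near) linarith+
      have 3: "\<bar>W N (s - real M / real N) - tilt_cdf \<theta> t\<bar> \<le> 2 * \<eta>" using MN MN0 t unfolding st by (intro near) linarith+
      define X where "X = W N s - W N (s - 1)"
      define Y where "Y = W N s - W N (s - real M / real N)"
      define Z where "Z = W N s"
      define E where "E = tilt_cdf \<theta> t - tilt_cdf \<theta> (t - 1)"
      have X: "\<bar>X - E\<bar> \<le> 4 * \<eta>" using 1 2 unfolding X_def E_def by linarith
      have Y: "Y \<le> 4 * \<eta>" using 1 3 unfolding Y_def by linarith
      have sT: "s \<le> T" using t MN0 st by linarith
      have "\<bar>W N s - tilt_cdf \<theta> s\<bar> \<le> \<eta>" using elim(2) sT by auto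
      moreover have "tilt_cdf \<theta> s \<le> K" unfolding K_def using sT by (rule tilt_cdf_mono)
      ultimately have Z: "Z \<le> K + 1" using \<eta>(2) unfolding Z_def by linarith
      have E: "0 \<le> E" "E \<le> K" using tilt_cdf_mono[of "t - 1" t \<theta>] tilt_cdf_mono[OF t(2), of \<theta>] H0[of "t - 1"]
        unfolding E_def K_def by linarith+
      define c where "c = rate N"
      have c0: "c \<ge> 0" unfolding c_def using rate_nonneg[OF N(1)] .
      have ca: "\<bar>c * a - 1\<bar> \<le> \<eta>" using elim(3) unfolding c_def dist_real_def by simp
      then have ca2: "c * a \<le> 2" using \<eta>(2) by linarith
      then have c2: "c \<le> 2 / a" using a_pos by (simp add: field_simps)
      have "\<bar>real n * u N n / ln (real N) - c * (a * X)\<bar> \<le> c * (B * Y + e * Z)"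
        using mult_u_approx[OF N(1) n1 B(2) M less_imp_le[OF e]]
        unfolding c_def X_def Y_def Z_def s_def .
      also have "\<dots> \<le> c * (B * (4 * \<eta>) + e * (K + 1))"
        using c0 B(1) e Y Z by (intro mult_left_mono add_mono) auto
      also have "\<dots> \<le> 2 / a * (B * (4 * \<eta>) + e * (K + 1))"
        using c2 B(1) e K \<eta>(1) by (intro mult_right_mono add_nonneg_nonneg mult_nonneg_nonneg) auto
      also have "\<dots> = 8 * B / a * \<eta> + \<kappa> / 2"
        unfolding eK using a_pos by (simp add: field_simps)
      finally have I: "\<bar>real n * u N n / ln (real N) - c * (a * X)\<bar> \<le> 8 * B / a * \<eta> + \<kappa> / 2" .
      have "\<bar>c * (a * X) - E\<bar> = \<bar>c * a * (X - E) + (c * a - 1) * E\<bar>" by (simp add: algebra_simps)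
      also have "\<dots> \<le> c * a * \<bar>X - E\<bar> + \<bar>c * a - 1\<bar> * E"
        using c0 a_pos E by (intro order_trans[OF abs_triangle_ineq]) (simp add: abs_mult)
      also have "\<dots> \<le> 2 * (4 * \<eta>) + \<eta> * K"
        using ca ca2 X E \<eta>(1) by (intro add_mono mult_mono) auto
      finally have II: "\<bar>c * (a * X) - E\<bar> \<le> 8 * \<eta> + \<eta> * K" by simp
      have "8 * B / a * \<eta> + 8 * \<eta> + \<eta> * K = \<eta> * D" by (simp add: D_def algebra_simps)
      then have "\<bar>real n * u N n / ln (real N) - E\<bar> \<le> \<kappa>" using I II \<eta>(3) by linarith
      then show "\<bar>real n * u N n / ln (real N) - (tilt_cdf \<theta> (real n / real N) - tilt_cdf \<theta> (real n / real N - 1))\<bar> \<le> \<kappa>"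
        unfolding E_def t_def .
    qed
  qed
qed

lemma G_scaled:
  assumes "N \<ge> 2" "n \<ge> 1"
  shows "ln (real N) / real N * G \<theta> (real n / real N) =
    ln (real N) / real n * (tilt_cdf \<theta> (real n / real N) - tilt_cdf \<theta> (real n / real N - 1))"
proof -
  let ?E = "tilt_cdf \<theta> (real n / real N) - tilt_cdf \<theta> (real n / real N - 1)"
  have t: "real n / real N > 0" using assms by simp
  have "G \<theta> (real n / real N) = ?E / (real n / real N)"
    unfolding G_eq[OF t, symmetric] by (rule nonzero_mult_div_cancel_left[symmetric]) (use t in linarith)
  then have "ln (real N) / real N * G \<theta> (real n / real N) = ln (real N) / real N * (?E / (real n / real N))"
    by (simp only:)
  also have "\<dots> = ln (real N) / real n * ?E" using assms by simp
  finally show ?thesis .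
qed

theorem local_renewal:
  assumes dT: "0 < \<delta>" "\<delta> < T" and \<epsilon>: "\<epsilon> > 0"
  shows "\<forall>\<^sub>F N in sequentially. \<forall>n::nat. \<delta> * real N \<le> real n \<and> real n \<le> T * real N \<longrightarrow>
    \<bar>u N n - ln (real N) / real N * G \<theta> (real n / real N)\<bar> \<le> \<epsilon> * (ln (real N) / real N * G \<theta> (real n / real N))"
proof -
  define E where "E = (\<lambda>t. tilt_cdf \<theta> t - tilt_cdf \<theta> (t - 1))"
  have "continuous_on {\<delta>..T} E" unfolding E_def by (intro continuous_intros continuous_on_tilt_cdf)
  then obtain x where x: "x \<in> {\<delta>..T}" "\<And>t. t \<in> {\<delta>..T} \<Longrightarrow> E x \<le> E t"
    using continuous_attains_inf[of "{\<delta>..T}" E] dT by auto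
  have Ex: "E x > 0" unfolding E_def using x(1) dT by (intro tilt_cdf_diff_pos) auto
  have "\<forall>\<^sub>F N in sequentially. \<forall>n::nat. \<delta> * real N \<le> real n \<and> real n \<le> T * real N \<longrightarrow>
    \<bar>real n * u N n / ln (real N) - (tilt_cdf \<theta> (real n / real N) - tilt_cdf \<theta> (real n / real N - 1))\<bar> \<le> \<epsilon> * E x"
    using \<epsilon> Ex by (intro local_limit dT) simp
  then show ?thesis using eventually_ge_at_top[of 2]
  proof eventually_elim
    case (elim N)
    show ?case
    proof (intro allI impI)
      fix n :: nat assume n: "\<delta> * real N \<le> real n \<and> real n \<le> T * real N"
      have N: "N \<ge> 2" "real N > 0" "ln (real N) > 0" using elim(2) by auto
      have "0 < \<delta> * real N" using dT N by simp
      then have n1: "n \<ge> 1" using n by (cases n) auto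
      have t: "real n / real N \<in> {\<delta>..T}" using n N by (simp add: field_simps)
      define y where "y = E (real n / real N)"
      have "\<bar>real n * u N n / ln (real N) - y\<bar> \<le> \<epsilon> * E x" using elim(1) n unfolding y_def E_def by blast
      also have "\<dots> \<le> \<epsilon> * y" unfolding y_def using \<epsilon> x(2)[OF t] by simp
      finally have "ln (real N) / real n * \<bar>real n * u N n / ln (real N) - y\<bar> \<le> ln (real N) / real n * (\<epsilon> * y)"
        using N n1 by (intro mult_left_mono) auto
      moreover have "ln (real N) / real n * \<bar>real n * u N n / ln (real N) - y\<bar> =
          \<bar>ln (real N) / real n * (real n * u N n / ln (real N) - y)\<bar>"
        using N n1 by (simp add: abs_mult)
      moreover have "ln (real N) / real n * (real n * u N n / ln (real N) - y) = u N n - ln (real N) / real n * y"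
        using N n1 by (simp add: field_simps)
      ultimately have "\<bar>u N n - ln (real N) / real n * y\<bar> \<le> ln (real N) / real n * (\<epsilon> * y)" by (simp only:)
      moreover have "ln (real N) / real n * (\<epsilon> * y) = \<epsilon> * (ln (real N) / real n * y)" by simp
      moreover have "ln (real N) / real N * G \<theta> (real n / real N) = ln (real N) / real n * y"
        unfolding y_def E_def by (rule G_scaled[OF N(1) n1])
      ultimately show "\<bar>u N n - ln (real N) / real N * G \<theta> (real n / real N)\<bar> \<le> \<epsilon> * (ln (real N) / real N * G \<theta> (real n / real N))"
        by (simp only:)
    qed
  qed
qed

end

lemma dcdf_1_lower:
  assumes s: "s > 0" "s * dickman_psi 1 \<le> 1 / 4"
  shows "dcdf s 1 \<ge> 1 / 4"
proof -
  have i1: "integrable lborel (\<lambda>u. indicator {..1} u * dpdf s u)"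
    using s(1) by (intro integrable_mult_dpdf[where B = 1]) (auto simp: indicator_def)
  have i2: "integrable lborel (\<lambda>u. exp (- 1) * dpdf s u)"
    using dpdf_integral(1)[OF s(1)] by simp
  have "dickman_lt s 1 \<le> (\<integral>u. indicator {..1} u * dpdf s u + exp (- 1) * dpdf s u \<partial>lborel)"
    unfolding dickman_lt_def
  proof (intro integral_mono integrable_exp_dpdf Bochner_Integration.integrable_add i1 i2 s)
    fix u
    show "exp (- 1 * u) * dpdf s u \<le> indicator {..1} u * dpdf s u + exp (- 1) * dpdf s u"
    proof (cases "u > 0")
      case True
      have "exp (- u) \<le> indicator {..1} u + exp (- 1)"
        using True by (cases "u \<le> 1") (auto intro: order_trans[of _ 1])
      then have "exp (- u) * dpdf s u \<le> (indicator {..1} u + exp (- 1)) * dpdf s u"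
        using dpdf_nonneg[OF s(1)] by (rule mult_right_mono)
      then show ?thesis by (simp add: distrib_right)
    qed simp
  qed simp
  also have "\<dots> = dcdf s 1 + exp (- 1)"
    using i1 i2 dpdf_integral[OF s(1)] by simp
  finally have "dickman_lt s 1 \<le> dcdf s 1 + exp (- 1)" .
  moreover have "dickman_lt s 1 \<ge> 1 - s * dickman_psi 1"
    using dickman_lt_eq[OF s(1), of 1] exp_ge_add_one_self[of "- s * dickman_psi 1"] by simp
  moreover have "exp (- 1 :: real) \<le> 1 / 2"
    using exp_ge_add_one_self[of "1::real"] by (simp add: exp_minus field_simps)
  ultimately show ?thesis using s(2) by linarith
qed

text \<open>Only the values of \<open>s\<close> between \<open>1 / (2 L)\<close> and \<open>1 / L\<close>, where \<open>L = - ln t\<close>, are used.\<close>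

lemma tilt_cdf_lower:
  obtains c L0 where "c > 0" "L0 > 0" "\<And>t. 0 < t \<Longrightarrow> t < 1 \<Longrightarrow> - ln t \<ge> L0 \<Longrightarrow> tilt_cdf \<theta> t \<ge> c / (ln t)\<^sup>2"
proof -
  define c where "c = exp (- \<bar>\<theta>\<bar>) * exp (- 1) / 16"
  define L0 where "L0 = max 1 (4 * dickman_psi 1)"
  have "tilt_cdf \<theta> t \<ge> c / (ln t)\<^sup>2" if t: "0 < t" "t < 1" "- ln t \<ge> L0" for t
  proof -
    define L where "L = - ln t"
    have L: "L \<ge> 1" "L \<ge> 4 * dickman_psi 1" using t by (auto simp: L_def L0_def)
    define I where "I = {1 / (2 * L)..1 / L}"
    have I: "I \<in> sets lborel" "emeasure lborel I < \<infinity>" "measure lborel I = 1 / (2 * L)"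
      using L by (auto simp: I_def field_simps)
    define k where "k = 1 / (2 * L) * exp (- \<bar>\<theta>\<bar>) * (1 / 4 * exp (- 1))"
    have k: "k \<le> s * exp (\<theta> * s) * dcdf s t" if s: "s \<in> I" for s
    proof -
      have s1: "1 / (2 * L) \<le> s" "s * L \<le> 1" "s > 0"
      proof -
        show "1 / (2 * L) \<le> s" "s * L \<le> 1" using s L by (auto simp: I_def field_simps)
        have "0 < 1 / (2 * L)" using L by simp
        also have "\<dots> \<le> s" using s by (simp add: I_def)
        finally show "s > 0" .
      qed
      have "s * 1 \<le> s * L" using L s1 by (intro mult_left_mono) auto
      then have s_le: "s \<le> 1" using s1 by linarith
      have "s * (4 * dickman_psi 1) \<le> s * L" using L s1 by (intro mult_left_mono) auto
      with s1(2) have "s * (4 * dickman_psi 1) \<le> 1" by linarith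
      then have "s * dickman_psi 1 \<le> 1 / 4" by simp
      then have F1: "dcdf s 1 \<ge> 1 / 4" using s1 by (intro dcdf_1_lower)
      have "t powr s = exp (- (s * L))" using t by (simp add: powr_def L_def)
      then have "exp (- 1) \<le> t powr s" using s1 by simp
      then have "1 / 4 * exp (- 1) \<le> dcdf s 1 * t powr s"
        using F1 by (intro mult_mono) auto
      then have F: "1 / 4 * exp (- 1) \<le> dcdf s t" using dcdf_small[of s t] s1 t by simp
      have "\<bar>\<theta> * s\<bar> \<le> \<bar>\<theta>\<bar>" using s_le s1 by (simp add: abs_mult mult_left_le)
      then have "exp (- \<bar>\<theta>\<bar>) \<le> exp (\<theta> * s)" by simp
      then show ?thesis unfolding k_def using s1 F L by (intro mult_mono) auto
    qed
    have "k * (1 / (2 * L)) = (\<integral>s. indicator I s *\<^sub>R k \<partial>lborel)"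
      using I by (simp add: mult.commute)
    also have "\<dots> \<le> (\<integral>s. indicator {0<..} s *\<^sub>R (s * exp (\<theta> * s) * dcdf s t) \<partial>lborel)"
    proof (rule integral_mono)
      show "integrable lborel (\<lambda>s. indicator I s *\<^sub>R k)" using I by simp
      show "integrable lborel (\<lambda>s. indicator {0<..} s *\<^sub>R (s * exp (\<theta> * s) * dcdf s t))"
        using tilt_cdf_integrable unfolding set_integrable_def .
      fix s
      show "indicator I s *\<^sub>R k \<le> indicator {0<..} s *\<^sub>R (s * exp (\<theta> * s) * dcdf s t)"
      proof (cases "s \<in> I")
        case True
        have "0 < 1 / (2 * L)" using L by simp
        also have "\<dots> \<le> s" using True by (simp add: I_def)
        finally have "s > 0" .
        then show ?thesis using k[OF True] True by simp
      next
        case False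
        then show ?thesis using dcdf_nonneg[of s t] by (cases "s > 0") auto
      qed
    qed
    also have "\<dots> = tilt_cdf \<theta> t" by (simp add: tilt_cdf_def set_lebesgue_integral_def)
    finally have "k * (1 / (2 * L)) \<le> tilt_cdf \<theta> t" .
    moreover have "k * (1 / (2 * L)) = c / L\<^sup>2"
      using L by (simp add: k_def c_def power2_eq_square field_simps)
    ultimately show ?thesis by (simp add: L_def)
  qed
  moreover have "c > 0" "L0 > 0" by (auto simp: c_def L0_def)
  ultimately show ?thesis using that by blast
qed

context dickman_renewal
begin

lemma mult_r_lower: obtains c where "c > 0" "\<And>m. m \<ge> 1 \<Longrightarrow> real m * r m \<ge> c"
proof -
  have "\<forall>\<^sub>F m in sequentially. \<bar>err m\<bar> < a / 2" using tendstoD[OF err_tendsto, of "a / 2"] a_pos by simp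
  then obtain M where M: "\<And>m. m \<ge> M \<Longrightarrow> \<bar>err m\<bar> < a / 2"
    unfolding eventually_sequentially by blast
  define S where "S = insert (a / 2) ((\<lambda>m. real m * r m) ` {1..M})"
  have S: "finite S" "S \<noteq> {}" by (auto simp: S_def)
  have "Min S > 0" using S a_pos r_pos by (auto simp: S_def)
  moreover have "real m * r m \<ge> Min S" if "m \<ge> 1" for m
  proof (cases "m \<le> M")
    case True
    then show ?thesis using that S by (intro Min_le) (auto simp: S_def)
  next
    case False
    then have "a / 2 \<le> real m * r m" using M[of m] unfolding err_def by linarith
    moreover have "Min S \<le> a / 2" using S by (intro Min_le) (auto simp: S_def)
    ultimately show ?thesis by linarith
  qed
  ultimately show ?thesis using that by blast
qed

lemma sum_one_minus_exp_lower:
  assumes c: "c > 0" "\<And>m. m \<ge> 1 \<Longrightarrow> real m * r m \<ge> c" and n: "1 \<le> n" "n \<le> N"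
  shows "(\<Sum>m=1..N. r m * (1 - exp (- (1 / real n) * real m))) \<ge> c * (1 - exp (- 1)) * ln (real N / real n)"
proof -
  have "c * (1 - exp (- 1)) * ln (real N / real n) \<le> c * (1 - exp (- 1)) * (\<Sum>m=n..N. 1 / real m)"
    using c by (intro mult_left_mono sum_inverse_ge_ln n) auto
  also have "\<dots> = (\<Sum>m=n..N. c / real m * (1 - exp (- 1)))"
    by (simp add: sum_distrib_left mult.commute)
  also have "\<dots> \<le> (\<Sum>m=n..N. r m * (1 - exp (- (1 / real n) * real m)))"
  proof (intro sum_mono mult_mono)
    fix m assume m: "m \<in> {n..N}"
    then have m1: "m \<ge> 1" using n by auto
    show "c / real m \<le> r m" using c(2)[OF m1] m1 by (simp add: field_simps)
    have "1 \<le> real m / real n" using m n by simp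
    then show "1 - exp (- 1) \<le> 1 - exp (- (1 / real n) * real m)" by simp
    show "0 \<le> r m" using r_pos[OF m1] by simp
  qed simp
  also have "\<dots> \<le> (\<Sum>m=1..N. r m * (1 - exp (- (1 / real n) * real m)))"
  proof (rule sum_mono2)
    fix m assume "m \<in> {1..N} - {n..N}"
    then show "0 \<le> r m * (1 - exp (- (1 / real n) * real m))"
      using r_pos[of m] by (intro mult_nonneg_nonneg) auto
  qed (use n in auto)
  finally show ?thesis .
qed

lemma sum_u_upper:
  obtains C L1 N1 where "C > 0" "L1 > 0" "\<And>N n. N \<ge> N1 \<Longrightarrow> 1 \<le> n \<Longrightarrow> n \<le> N \<Longrightarrow> ln (real N / real n) \<ge> L1 \<Longrightarrow>
    (\<Sum>j\<le>n. u N j) \<le> C * ln (real N) / ln (real N / real n)"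
proof -
  obtain c1 where c1: "c1 > 0" "\<And>m. m \<ge> 1 \<Longrightarrow> real m * r m \<ge> c1" using mult_r_lower by blast
  define c2 where "c2 = c1 * (1 - exp (- 1)) / (2 * a)"
  have c2: "c2 > 0" using c1 a_pos by (simp add: c2_def)
  define L1 where "L1 = 2 * (\<bar>\<theta>\<bar> + 1) / c2"
  have L1: "L1 > 0" using c2 by (simp add: L1_def add_nonneg_pos)
  have "\<forall>\<^sub>F N in sequentially. ln (real N) * (1 - lam N) > - \<theta> - 1"
    by (rule order_tendstoD(1)[OF lam_tendsto(1)]) simp
  moreover have "\<forall>\<^sub>F N in sequentially. rate N > 1 / (2 * a)"
    unfolding rate_def using a_pos by (intro order_tendstoD(1)[OF scale_tendsto]) (simp add: field_simps)
  ultimately have "\<forall>\<^sub>F N in sequentially. N \<ge> 2 \<and> ln (real N) * (1 - lam N) > - \<theta> - 1 \<and> rate N > 1 / (2 * a)"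
    using eventually_ge_at_top[of 2] by eventually_elim simp
  then obtain N1 where N1: "\<And>N. N \<ge> N1 \<Longrightarrow> N \<ge> 2 \<and> ln (real N) * (1 - lam N) > - \<theta> - 1 \<and> rate N > 1 / (2 * a)"
    unfolding eventually_sequentially by blast
  have "(\<Sum>j\<le>n. u N j) \<le> 2 * exp 1 / c2 * ln (real N) / ln (real N / real n)"
    if N: "N \<ge> N1" and n: "1 \<le> n" "n \<le> N" and Ln: "ln (real N / real n) \<ge> L1" for N n
  proof -
    define L where "L = ln (real N / real n)"
    have L: "L \<ge> L1" "L > 0" using Ln L1 by (auto simp: L_def)
    have N2: "N \<ge> 2" "ln (real N) > 0" and NA: "ln (real N) * (1 - lam N) > - \<theta> - 1" and NB: "rate N > 1 / (2 * a)"
      using N1[OF N] by auto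
    define S where "S = (\<Sum>m=1..N. r m * (1 - exp (- (1 / real n) * real m)))"
    have S: "S \<ge> c1 * (1 - exp (- 1)) * L"
      unfolding S_def L_def by (rule sum_one_minus_exp_lower[OF c1 n])
    have S0: "c1 * (1 - exp (- 1)) * L \<ge> 0" using c1 L by simp
    have "ln (real N) * (1 - q N (1 / real n)) = ln (real N) * (1 - lam N) + rate N * S"
      unfolding S_def one_minus_q[OF order_trans[OF one_le_numeral N2(1)]] rate_def by (simp add: distrib_left)
    moreover have "rate N * S \<ge> 1 / (2 * a) * (c1 * (1 - exp (- 1)) * L)"
      using NB S S0 rate_nonneg[OF N2(1)] by (intro mult_mono) auto
    then have "rate N * S \<ge> c2 * L" by (simp add: c2_def)
    moreover have "c2 * L \<ge> 2 * (\<bar>\<theta>\<bar> + 1)"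
      using L(1) c2 by (simp add: L1_def pos_divide_le_eq mult.commute)
    moreover have "x \<ge> z / 2" if "x = y + w" "z \<le> w" "2 * (\<bar>\<theta>\<bar> + 1) \<le> z" "- \<theta> - 1 < y" for x y z w
      using that abs_ge_self[of \<theta>] by argo
    ultimately have main: "ln (real N) * (1 - q N (1 / real n)) \<ge> c2 * L / 2"
      using NA by blast
    have c2L: "c2 * L / 2 > 0" using c2 L by simp
    have "ln (real N) * (1 - q N (1 / real n)) > 0" using main c2L by linarith
    then have q1: "1 - q N (1 / real n) > 0" using N2 by (simp add: zero_less_mult_iff)
    then have sums: "(\<lambda>j. u N j * exp (- (1 / real n) * real j)) sums (1 / (1 - q N (1 / real n)))"
      by (intro u_sums N2) simp
    have "(\<Sum>j\<le>n. u N j) \<le> (\<Sum>j\<le>n. exp 1 * (u N j * exp (- (1 / real n) * real j)))"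
    proof (rule sum_mono)
      fix j assume "j \<in> {..n}"
      then have "real j / real n \<le> 1" using n by simp
      then have "1 \<le> exp (1 + - (1 / real n) * real j)" by simp
      then have "u N j * 1 \<le> u N j * exp (1 + - (1 / real n) * real j)"
        using u_nonneg[OF N2(1)] by (intro mult_left_mono)
      then show "u N j \<le> exp 1 * (u N j * exp (- (1 / real n) * real j))"
        unfolding exp_add by (simp add: mult_ac)
    qed
    also have "\<dots> = exp 1 * (\<Sum>j\<le>n. u N j * exp (- (1 / real n) * real j))" by (simp only: sum_distrib_left)
    also have "\<dots> \<le> exp 1 * (1 / (1 - q N (1 / real n)))"
    proof (intro mult_left_mono)
      have "(\<Sum>j\<le>n. u N j * exp (- (1 / real n) * real j)) \<le> (\<Sum>j. u N j * exp (- (1 / real n) * real j))"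
        using u_nonneg[OF N2(1)] by (intro sum_le_suminf sums_summable[OF sums]) auto
      then show "(\<Sum>j\<le>n. u N j * exp (- (1 / real n) * real j)) \<le> 1 / (1 - q N (1 / real n))"
        unfolding sums_unique[OF sums, symmetric] .
    qed simp
    also have "\<dots> \<le> exp 1 * (2 * ln (real N) / (c2 * L))"
    proof (intro mult_left_mono)
      have "1 * (c2 * L) \<le> 2 * ln (real N) * (1 - q N (1 / real n))" using main by linarith
      then show "1 / (1 - q N (1 / real n)) \<le> 2 * ln (real N) / (c2 * L)"
        using q1 c2 L by (subst frac_le_eq) (auto simp: field_simps)
    qed simp
    also have "\<dots> = 2 * exp 1 / c2 * ln (real N) / L" by simp
    finally show ?thesis by (simp add: L_def)
  qed
  moreover have "2 * exp 1 / c2 > 0" using c2 by simp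
  ultimately show ?thesis using L1 that by blast
qed

lemma u_upper_small:
  obtains C L1 N1 where "C > 0" "L1 > 0" "N1 \<ge> 2" "\<And>N n. N \<ge> N1 \<Longrightarrow> 1 \<le> n \<Longrightarrow> n \<le> N \<Longrightarrow>
    ln (real N / real n) \<ge> L1 \<Longrightarrow> real n * u N n \<le> C * ln (real N) / (ln (real N / real n))\<^sup>2"
proof -
  obtain C L1 N1 where C: "C > 0" "L1 > 0" "\<And>N n. N \<ge> N1 \<Longrightarrow> 1 \<le> n \<Longrightarrow> n \<le> N \<Longrightarrow> ln (real N / real n) \<ge> L1 \<Longrightarrow>
    (\<Sum>j\<le>n. u N j) \<le> C * ln (real N) / ln (real N / real n)" using sum_u_upper by blast
  obtain B where B: "B > 0" "\<And>m. \<bar>err m\<bar> \<le> B" using err_bounded by blast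
  have "\<forall>\<^sub>F N in sequentially. rate N < 2 / a"
    unfolding rate_def using a_pos by (intro order_tendstoD(2)[OF scale_tendsto]) (simp add: field_simps)
  then obtain N2 where N2: "\<And>N. N \<ge> N2 \<Longrightarrow> rate N < 2 / a"
    unfolding eventually_sequentially by blast
  have "real n * u N n \<le> 2 / a * (a + B) * C\<^sup>2 * ln (real N) / (ln (real N / real n))\<^sup>2"
    if N: "N \<ge> max 2 (max N1 N2)" and n: "1 \<le> n" "n \<le> N" and Ln: "ln (real N / real n) \<ge> L1" for N n
  proof -
    have N': "N \<ge> 2" "ln (real N) > 0" using N by auto
    define L where "L = ln (real N / real n)"
    have L: "L > 0" using Ln C(2) by (simp add: L_def)
    have v0: "v N j \<ge> 0" for j using v_nonneg[OF N'(1)] .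
    have "(\<Sum>m=1..min n N. (a + err m) * v N (n - m)) \<le> (\<Sum>m=1..min n N. (a + B) * v N (n - m))"
      using B(2) v0 by (intro sum_mono mult_right_mono) (auto simp: abs_le_iff)
    also have "\<dots> = (a + B) * (\<Sum>m=1..min n N. v N (n - m))" by (simp only: sum_distrib_left)
    also have "(\<Sum>m=1..min n N. v N (n - m)) \<le> (\<Sum>m\<le>n. v N (n - m))"
      using v0 by (intro sum_mono2) auto
    also have "(\<Sum>m\<le>n. v N (n - m)) = (\<Sum>j\<le>n. v N j)"
      by (rule sum.nat_diff_reindex[of "v N" "Suc n", unfolded lessThan_Suc_atMost diff_Suc_Suc])
    also have "(\<Sum>j\<le>n. v N j) \<le> (\<Sum>j\<le>n. u N j)\<^sup>2"
      unfolding v_def using u_nonneg[OF N'(1)] by (rule sum_self_conv_le)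
    also have "\<dots> \<le> (C * ln (real N) / L)\<^sup>2"
      using u_nonneg[OF N'(1)] C(3)[OF _ n Ln] N unfolding L_def by (intro power_mono sum_nonneg) auto
    finally have 1: "(\<Sum>m=1..min n N. (a + err m) * v N (n - m)) \<le> (a + B) * (C * ln (real N) / L)\<^sup>2"
      using a_pos B by simp
    have "real n * u N n = rate N / ln (real N) * (\<Sum>m=1..min n N. (a + err m) * v N (n - m))"
      unfolding mult_u_eq[OF N'(1)] lam_over_RN[OF N'(1)] ..
    also have "\<dots> \<le> rate N / ln (real N) * ((a + B) * (C * ln (real N) / L)\<^sup>2)"
      using rate_nonneg[OF N'(1)] N' by (intro mult_left_mono 1) auto
    also have "\<dots> \<le> 2 / a / ln (real N) * ((a + B) * (C * ln (real N) / L)\<^sup>2)"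
      using N2[of N] N N' a_pos B by (intro mult_right_mono divide_right_mono) auto
    also have "\<dots> = 2 / a * (a + B) * C\<^sup>2 * ln (real N) / L\<^sup>2"
      using N' L by (simp add: power_divide power_mult_distrib power2_eq_square)
    finally show ?thesis unfolding L_def .
  qed
  moreover have "2 / a * (a + B) * C\<^sup>2 > 0" using a_pos B C by simp
  moreover have "max 2 (max N1 N2) \<ge> 2" by simp
  ultimately show ?thesis using C(2) that by blast
qed

theorem renewal_upper_bound:
  "\<exists>C>0. \<forall>N::nat. N \<ge> 2 \<longrightarrow> (\<forall>n::nat. 0 < n \<and> real n \<le> T * real N \<longrightarrow>
     u N n \<le> C * (ln (real N) / real N) * G \<theta> (real n / real N))"
proof -
  define g where "g = (\<lambda>N n. ln (real N) / real N * G \<theta> (real n / real N))"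
  have g_pos: "g N n > 0" if "N \<ge> 2" "n \<ge> 1" for N n :: nat
    unfolding g_def using that by (intro mult_pos_pos G_pos) auto
  obtain c L0 where c: "c > 0" "L0 > 0" "\<And>t. 0 < t \<Longrightarrow> t < 1 \<Longrightarrow> - ln t \<ge> L0 \<Longrightarrow> tilt_cdf \<theta> t \<ge> c / (ln t)\<^sup>2"
    using tilt_cdf_lower by blast
  obtain C1 L1 N1 where C1: "C1 > 0" "L1 > 0" "N1 \<ge> 2" "\<And>N n. N \<ge> N1 \<Longrightarrow> 1 \<le> n \<Longrightarrow> n \<le> N \<Longrightarrow>
    ln (real N / real n) \<ge> L1 \<Longrightarrow> real n * u N n \<le> C1 * ln (real N) / (ln (real N / real n))\<^sup>2"
    using u_upper_small by blast
  define \<delta> where "\<delta> = exp (- max L0 L1)"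
  have \<delta>: "\<delta> > 0" "\<delta> < 1" using c(2) by (auto simp: \<delta>_def)
  define T' where "T' = max 1 T"
  have "\<forall>\<^sub>F N in sequentially. \<forall>n::nat. \<delta> * real N \<le> real n \<and> real n \<le> T' * real N \<longrightarrow>
    \<bar>u N n - ln (real N) / real N * G \<theta> (real n / real N)\<bar> \<le> 1 * (ln (real N) / real N * G \<theta> (real n / real N))"
    by (intro local_renewal \<delta>) (use \<delta> in \<open>auto simp: T'_def\<close>)
  then obtain N2 where N2: "\<And>N n. N \<ge> N2 \<Longrightarrow> \<delta> * real N \<le> real n \<Longrightarrow> real n \<le> T' * real N \<Longrightarrow> \<bar>u N n - g N n\<bar> \<le> g N n"
    unfolding eventually_sequentially g_def by auto
  define N0 where "N0 = max N1 N2"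
  define S where "S = (\<Sum>N\<le>N0. \<Sum>n\<le>nat \<lceil>T' * real N0\<rceil>. \<bar>u N n / g N n\<bar>)"
  define C where "C = 2 + C1 / c + S"
  have S0: "S \<ge> 0" unfolding S_def by (intro sum_nonneg) auto
  have C1c: "C1 / c > 0" using C1 c by simp
  have "u N n \<le> C * g N n" if N: "N \<ge> 2" and n: "0 < n" "real n \<le> T * real N" for N n
  proof -
    have gp: "g N n > 0" using N n by (intro g_pos) auto
    have nT: "real n \<le> T' * real N"
    proof -
      have "T * real N \<le> T' * real N" unfolding T'_def by (intro mult_right_mono) auto
      then show ?thesis using n by linarith
    qed
    consider "N \<le> N0" | "N \<ge> N0" "\<delta> * real N \<le> real n" | "N \<ge> N0" "real n < \<delta> * real N" by linarith
    then have "\<exists>K\<ge>0. K \<le> C \<and> u N n \<le> K * g N n"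
    proof cases
      case 1
      have "T' * real N \<le> T' * real N0" using 1 by (intro mult_left_mono) (auto simp: T'_def)
      then have "n \<le> nat \<lceil>T' * real N0\<rceil>" using nT by linarith
      then have "\<bar>u N n / g N n\<bar> \<le> (\<Sum>n\<le>nat \<lceil>T' * real N0\<rceil>. \<bar>u N n / g N n\<bar>)"
        by (intro member_le_sum) auto
      also have "\<dots> \<le> S" unfolding S_def using 1
        by (intro member_le_sum[of N "{..N0}" "\<lambda>N. \<Sum>n\<le>nat \<lceil>T' * real N0\<rceil>. \<bar>u N n / g N n\<bar>"] sum_nonneg) auto
      finally have "u N n / g N n \<le> S" by linarith
      then have "u N n \<le> S * g N n" using gp by (simp add: pos_divide_le_eq)
      then show ?thesis using S0 C1c by (intro exI[of _ S]) (auto simp: C_def)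
    next
      case 2
      then have "\<bar>u N n - g N n\<bar> \<le> g N n" using nT by (intro N2) (auto simp: N0_def)
      then have "u N n \<le> 2 * g N n" by linarith
      then show ?thesis using S0 C1c by (intro exI[of _ 2]) (auto simp: C_def)
    next
      case 3
      define t where "t = real n / real N"
      have N': "real N > 0" using N by simp
      have t: "0 < t" "t < \<delta>" using 3 n N' by (auto simp: t_def pos_divide_less_eq)
      have t1: "t < 1" using t \<delta> by linarith
      have "ln t < ln \<delta>" using t by simp
      then have lt: "- ln t \<ge> L0" "- ln t \<ge> L1" by (auto simp: \<delta>_def)
      have lNn: "ln (real N / real n) = - ln t" using n N' by (simp add: t_def ln_div)
      have lt0: "ln t \<noteq> 0" using lt c(2) by auto
      have nN: "n \<le> N" using t1 N' by (simp add: t_def)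
      have "real n * u N n \<le> C1 * ln (real N) / (ln (real N / real n))\<^sup>2"
        using 3 n nN lt lNn by (intro C1(4)) (auto simp: N0_def)
      then have a1: "real n * u N n \<le> C1 * ln (real N) / (ln t)\<^sup>2" unfolding lNn by simp
      have "c / (ln t)\<^sup>2 \<le> tilt_cdf \<theta> t" by (rule c(3)[OF t(1) t1 lt(1)])
      then have "C1 / c * ln (real N) * (c / (ln t)\<^sup>2) \<le> C1 / c * ln (real N) * tilt_cdf \<theta> t"
        using C1c N by (intro mult_left_mono mult_nonneg_nonneg) auto
      moreover have "C1 / c * ln (real N) * (c / (ln t)\<^sup>2) = C1 * ln (real N) / (ln t)\<^sup>2" using c(1) by simp
      ultimately have "real n * u N n \<le> C1 / c * ln (real N) * tilt_cdf \<theta> t" using a1 by linarith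
      moreover have "real n * g N n = ln (real N) * tilt_cdf \<theta> t"
        using G_scaled[of N n] N n t1 by (simp add: g_def t_def tilt_cdf_nonpos)
      ultimately have "real n * u N n \<le> real n * (C1 / c * g N n)"
        by (simp add: mult.left_commute mult.assoc)
      then have "u N n \<le> C1 / c * g N n" by (rule mult_left_le_imp_le) (use n in simp)
      then show ?thesis using S0 C1c by (intro exI[of _ "C1 / c"]) (auto simp: C_def)
    qed
    then obtain K where K: "K \<le> C" "u N n \<le> K * g N n" by blast
    have "K * g N n \<le> C * g N n" using K(1) gp by (intro mult_right_mono) auto
    then show ?thesis using K(2) by linarith
  qed
  moreover have "C > 0" using S0 C1c by (simp add: C_def)
  ultimately show ?thesis unfolding g_def by (intro exI[of _ C]) (auto simp: mult.assoc)
qed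

end

theorem mainTheorem3:
  fixes r :: "nat \<Rightarrow> real" and a \<theta> :: real and lam :: "nat \<Rightarrow> real"
  assumes r_pos: "\<And>n. n \<ge> 1 \<Longrightarrow> r n > 0"
    and a_pos: "a > 0"
    and r_asymp: "r \<sim>[at_top] (\<lambda>n. a / real n)"
    and lam_pos: "\<And>N. N \<ge> 2 \<Longrightarrow> lam N > 0"
    and lam_asymp: "\<exists>\<epsilon>::nat \<Rightarrow> real. \<epsilon> \<longlonglongrightarrow> 0 \<and>
                      (\<forall>N\<ge>2. lam N = 1 + \<theta> / ln (real N) * (1 + \<epsilon> N))"
  shows "(\<forall>\<delta> T::real. 0 < \<delta> \<and> \<delta> < T \<longrightarrow>
            (\<forall>\<epsilon>>0. \<forall>\<^sub>F N in sequentially. \<forall>n::nat.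
               \<delta> * real N \<le> real n \<and> real n \<le> T * real N \<longrightarrow>
               \<bar>U r N (lam N) n - ln (real N) / real N * G \<theta> (real n / real N)\<bar>
                 \<le> \<epsilon> * (ln (real N) / real N * G \<theta> (real n / real N))))
       \<and> (\<forall>T::real. \<exists>C>0. \<forall>N::nat. N \<ge> 2 \<longrightarrow> (\<forall>n::nat. 0 < n \<and> real n \<le> T * real N \<longrightarrow>
               U r N (lam N) n \<le> C * (ln (real N) / real N) * G \<theta> (real n / real N)))"
proof -
  interpret dickman_renewal r a \<theta> lam
    by (unfold_locales; fact assms)
  show ?thesis
    using local_renewal renewal_upper_bound unfolding u_def by (intro conjI allI impI) auto
qed

end
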